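(* Let $d\ge1$, $\alpha\in(0,2)$ with $d<\alpha$, $\beta\in(0,1)$, $\eta>\frac{\alpha}{\beta d}$ and $\gamma>0$. Suppose $\delta>0$ is sufficiently small and $V_0$ is measurable with $0\le V_0(x)\le \delta G(\gamma,x)$ for all $x\in\mathbb{R}^d$. Then there is a solution $V$ of $$V(t,x)=\int_{\mathbb{R}^d}G(t,x-y)V_0(y)\,dy+\int_{\mathbb{R}^d}\int_0^t G(t-s,x-y)V(s,y)^{1+\eta}\,ds\,dy,\quad t>0,\ x\in\mathbb{R}^d,$$ which satisfies $V(t,x)\le C\,G(t+\gamma,x)$ for all $t>0$, $x\in\mathbb{R}^d$, for some constant $C$ independent of $(t,x)$. Moreover, this solution is jointly continuous on $(0,\infty)\times\mathbb{R}^d$.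
   Context: $p(t,x)$ is the transition density of the symmetric $\alpha$-stable process on $\mathbb{R}^d$ ($\int e^{i\xi\cdot x}p(t,x)dx=e^{-t|\xi|^\alpha}$); $g_\beta$ is the density of $D_1$ for a $\beta$-stable subordinator with $\mathbb{E}e^{-sD_t}=e^{-ts^\beta}$; $G(t,x)=\int_0^\infty p((t/u)^\beta,x)g_\beta(u)\,du$ is the heat kernel of $\partial_t^\beta V=-(-\Delta)^{\alpha/2}V$ (Caputo derivative of order $\beta$). *)

theory Defs
  imports "HOL-Analysis.Analysis"
begin

text \<open>Transition density of the symmetric alpha-stable process on the Euclidean space
  indexed by 'n, given by Fourier inversion of exp(-t |xi|^alpha):
  p(t,x) = (2 pi)^(-d) * integral of exp(-i xi.x) exp(-t|xi|^alpha) d xi;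
  the imaginary (sine) part vanishes by symmetry, leaving the cosine integral.\<close>
definition stable_density :: "real \<Rightarrow> real \<Rightarrow> real ^ 'n \<Rightarrow> real" where
  "stable_density \<alpha> t x =
     (1 / (2 * pi) ^ CARD('n)) *
     (\<integral>\<xi>. cos (\<xi> \<bullet> x) * exp (- (t * norm \<xi> powr \<alpha>)) \<partial>lborel)"

text \<open>g is a density of D_1 for a beta-stable subordinator: a nonnegative Borel
  function on (0,oo) whose Laplace transform is exp(-s^beta).\<close>
definition subordinator_density :: "real \<Rightarrow> (real \<Rightarrow> real) \<Rightarrow> bool" where
  "subordinator_density \<beta> g \<longleftrightarrow>
     g \<in> borel_measurable borel \<and> (\<forall>u. 0 \<le> g u) \<and> (\<forall>u\<le>0. g u = 0) \<and>
     (\<forall>s\<ge>0. (\<integral>\<^sup>+ u. ennreal (exp (- (s * u)) * g u) \<partial>lborel) = ennreal (exp (- (s powr \<beta>))))"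

definition frac_heat_kernel ::
  "real \<Rightarrow> real \<Rightarrow> (real \<Rightarrow> real) \<Rightarrow> real \<Rightarrow> real ^ 'n \<Rightarrow> real" where
  "frac_heat_kernel \<alpha> \<beta> g t x =
     (\<integral>u. indicator {0<..} u * (stable_density \<alpha> ((t / u) powr \<beta>) x * g u) \<partial>lborel)"

end

theory Submission
  imports Defs
begin

text \<open>
  Since \<open>d < \<alpha> < 2\<close>, the space is one-dimensional and \<open>1 < \<alpha> < 2\<close>. Everything rests on the
  two-sided bound \<open>G(t, x) \<asymp> T\<^sup>\<alpha> / (T + |x|)\<^sup>1\<^sup>+\<^sup>\<alpha>\<close> with \<open>T = t\<^sup>\<beta>\<^sup>/\<^sup>\<alpha>\<close>. The profile on the right nearly
  satisfies the semigroup property: its convolutions at times \<open>t\<close> and \<open>s\<close> are dominated by the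
  profile at time \<open>t + s\<close>. As it is also at most \<open>T\<^sup>-\<^sup>1\<close>, the Duhamel term of \<open>C G(t + \<gamma>, x)\<close> is at most a
  multiple of \<open>C\<^sup>1\<^sup>+\<^sup>\<eta> G(t + \<gamma>, x) \<integral> (s + \<gamma>)\<^sup>-\<^sup>\<beta>\<^sup>\<eta>\<^sup>/\<^sup>\<alpha> ds\<close>, where the integral converges because
  \<open>\<eta> > \<alpha>/\<beta>\<close>. For small data the monotone Picard iteration therefore stays below \<open>C G(t + \<gamma>, x)\<close> and
  increases to a solution.

  The bounds on \<open>G\<close> are inherited from the stable density, for which the upper bound follows from
  integration by parts in the Fourier integral. For the lower bound, the characteristic function is
  split into the contributions of small and of big jumps; the density then dominates the contribution
  of exactly one big jump.
\<close>

section \<open>The stable profile\<close>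

text \<open>The condition d < \<alpha> is what makes a single profile suffice. By scaling, with d =
  1 and \<theta> = \<beta>/\<alpha>, G(t,0) is p(1,0) t^(-\<theta>) times the moment of order
  \<theta> of D_1, and D_1 has finite positive moments only below order \<beta>; for d \<ge>
  \<alpha> the kernel would be unbounded at the origin. In the tail, where p(s,x) behaves like s
  |x|^(-1-\<alpha>), the moment of order -\<beta> takes over. Both being finite, averaging over the
  subordinator merely changes constants. The other obstacle is memory: G is no semigroup in time, so
  G(t-s) * G(s+\<gamma>) is not G(t+\<gamma>). Only an inequality survives, and it rests on the
  subadditivity of t^\<theta>. The two-sided bound is then needed to pass from G to the profile and,
  at the end, back to G. For the stable density, a lower bound has to be drawn from an oscillating
  integral. Factoring exp(-|xi|^\<alpha>) over jump sizes and expanding the big-jump factor gives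
  terms with nonnegative transforms, so that cancellation is replaced by dropping terms.\<close>

text \<open>Comparable to \<open>min (1/T) (T\<^sup>a / |x|\<^sup>1\<^sup>+\<^sup>a)\<close>.\<close>

definition stable_profile :: "real \<Rightarrow> real \<Rightarrow> real \<Rightarrow> real" where
  "stable_profile a T x = T powr a / (T + \<bar>x\<bar>) powr (1 + a)"

lemma stable_profile_nonneg [simp]: "0 \<le> stable_profile a T x"
  by (simp add: stable_profile_def)

lemma stable_profile_measurable [measurable]: "(\<lambda>p. stable_profile a (f p) (h p)) \<in> borel_measurable M"
  if [measurable]: "f \<in> borel_measurable M" "h \<in> borel_measurable M"
  unfolding stable_profile_def by measurable

lemma stable_profile_le_inverse:
  assumes "0 < T" "0 < a"
  shows "stable_profile a T x \<le> 1 / T"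
proof -
  have "T powr a * T = T powr (1 + a)" using assms by (simp add: powr_add)
  also have "\<dots> \<le> (T + \<bar>x\<bar>) powr (1 + a)" using assms by (intro powr_mono2) auto
  finally show ?thesis using assms by (simp add: stable_profile_def divide_simps add_pos_nonneg)
qed

text \<open>The ratio of the two profiles is extreme at x = 0, where it equals 1 / w, and at
  infinity, where it tends to \<open>w powr a\<close>. The sum of both dominates either case and is
  easy to integrate when w = u^(-\<theta>) and u is distributed by \<open>g\<close>.\<close>

lemma stable_profile_dilate_upper:
  assumes "0 < w" "0 < T" "0 < a"
  shows "stable_profile a (w * T) x \<le> (w powr a + 1 / w) * stable_profile a T x"
proof (cases "w \<le> 1")
  case True
  have pos: "0 < w * T + \<bar>x\<bar>" "0 < T + \<bar>x\<bar>" using assms by (auto intro: add_pos_nonneg)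
  have "w powr (1 + a) * (T + \<bar>x\<bar>) powr (1 + a) = (w * (T + \<bar>x\<bar>)) powr (1 + a)"
    using assms by (simp add: powr_mult)
  also have "\<dots> \<le> (w * T + \<bar>x\<bar>) powr (1 + a)"
    using assms True by (intro powr_mono2) (auto simp: distrib_left intro: mult_left_le_one_le)
  finally have le: "w powr (1 + a) * (T + \<bar>x\<bar>) powr (1 + a) \<le> (w * T + \<bar>x\<bar>) powr (1 + a)" .
  have "stable_profile a (w * T) x = w powr a * T powr a / (w * T + \<bar>x\<bar>) powr (1 + a)"
    using assms by (simp add: stable_profile_def powr_mult)
  also have "\<dots> \<le> w powr a * T powr a / (w powr (1 + a) * (T + \<bar>x\<bar>) powr (1 + a))"
    using assms le by (intro divide_left_mono) (use pos in auto)
  also have "\<dots> = 1 / w * stable_profile a T x"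
    using assms by (simp add: stable_profile_def powr_add)
  also have "\<dots> \<le> (w powr a + 1 / w) * stable_profile a T x"
    by (intro mult_right_mono) auto
  finally show ?thesis .
next
  case False
  have pos: "0 < w * T + \<bar>x\<bar>" "0 < T + \<bar>x\<bar>" using assms by (auto intro: add_pos_nonneg)
  have "T * 1 \<le> T * w" using assms False by (intro mult_left_mono) auto
  then have "T powr a * w powr a / (w * T + \<bar>x\<bar>) powr (1 + a) \<le> T powr a * w powr a / (T + \<bar>x\<bar>) powr (1 + a)"
    using assms False by (intro divide_left_mono powr_mono2) (use pos in \<open>auto simp: mult.commute\<close>)
  then have "stable_profile a (w * T) x \<le> w powr a * stable_profile a T x"
    using assms by (simp add: stable_profile_def powr_mult mult.commute)
  also have "\<dots> \<le> (w powr a + 1 / w) * stable_profile a T x"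
    using assms by (intro mult_right_mono) auto
  finally show ?thesis .
qed

text \<open>The same two extremes of the ratio, now combined by the minimum.\<close>

lemma stable_profile_dilate_lower:
  assumes "0 < w" "0 < T" "0 < a"
  shows "min (w powr a) (1 / w) * stable_profile a T x \<le> stable_profile a (w * T) x"
proof (cases "w \<le> 1")
  case True
  have pos: "0 < w * T + \<bar>x\<bar>" "0 < T + \<bar>x\<bar>" using assms by (auto intro: add_pos_nonneg)
  have "T * w \<le> T * 1" using assms True by (intro mult_left_mono) auto
  then have "T powr a * w powr a / (T + \<bar>x\<bar>) powr (1 + a) \<le> T powr a * w powr a / (w * T + \<bar>x\<bar>) powr (1 + a)"
    using assms True by (intro divide_left_mono powr_mono2) (use pos in \<open>auto simp: mult.commute\<close>)
  then have "w powr a * stable_profile a T x \<le> stable_profile a (w * T) x"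
    using assms by (simp add: stable_profile_def powr_mult mult.commute)
  moreover have "min (w powr a) (1 / w) * stable_profile a T x \<le> w powr a * stable_profile a T x"
    by (intro mult_right_mono) auto
  ultimately show ?thesis by linarith
next
  case False
  have pos: "0 < w * T + \<bar>x\<bar>" "0 < T + \<bar>x\<bar>" using assms by (auto intro: add_pos_nonneg)
  have "\<bar>x\<bar> * 1 \<le> \<bar>x\<bar> * w" using False by (intro mult_left_mono) auto
  then have "(w * T + \<bar>x\<bar>) powr (1 + a) \<le> (w * (T + \<bar>x\<bar>)) powr (1 + a)"
    using assms by (intro powr_mono2) (auto simp: algebra_simps)
  also have "\<dots> = w powr (1 + a) * (T + \<bar>x\<bar>) powr (1 + a)"
    using assms by (simp add: powr_mult)
  finally have le: "(w * T + \<bar>x\<bar>) powr (1 + a) \<le> w powr (1 + a) * (T + \<bar>x\<bar>) powr (1 + a)" .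
  have "min (w powr a) (1 / w) * stable_profile a T x \<le> 1 / w * stable_profile a T x"
    by (intro mult_right_mono) auto
  also have "\<dots> = w powr a * T powr a / (w powr (1 + a) * (T + \<bar>x\<bar>) powr (1 + a))"
    using assms by (simp add: stable_profile_def powr_add)
  also have "\<dots> \<le> w powr a * T powr a / (w * T + \<bar>x\<bar>) powr (1 + a)"
    using assms le by (intro divide_left_mono) (use pos in auto)
  also have "\<dots> = stable_profile a (w * T) x"
    using assms by (simp add: stable_profile_def powr_mult)
  finally show ?thesis .
qed

text \<open>The larger of the two denominators is at least half of \<open>M + |x|\<close>; this factor is pulled out
  and the other one stays integrable.\<close>

lemma stable_profile_mult_le:
  assumes "0 < T" "0 < S" "T \<le> M" "S \<le> M" "M \<le> T + S" "0 < a"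
  shows "stable_profile a T (x - y) * stable_profile a S y \<le> 2 powr (1 + a) * stable_profile a M x * (stable_profile a S y + stable_profile a T (x - y))"
proof -
  define A where "A = T + \<bar>x - y\<bar>"
  define B where "B = S + \<bar>y\<bar>"
  have pos: "0 < A" "0 < B" "0 < M + \<bar>x\<bar>" using assms by (auto simp: A_def B_def)
  have AB: "M + \<bar>x\<bar> \<le> A + B" using assms by (auto simp: A_def B_def)
  have single: "U powr a / D powr (1 + a) \<le> 2 powr (1 + a) * stable_profile a M x"
    if "0 < U" "U \<le> M" "M + \<bar>x\<bar> \<le> 2 * D" for U D
  proof -
    have D: "0 < D" using that pos by auto
    have "(M + \<bar>x\<bar>) powr (1 + a) \<le> (2 * D) powr (1 + a)"
      using that pos assms by (intro powr_mono2) auto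
    also have "\<dots> = 2 powr (1 + a) * D powr (1 + a)" using D by (simp add: powr_mult)
    finally have 1: "(M + \<bar>x\<bar>) powr (1 + a) \<le> 2 powr (1 + a) * D powr (1 + a)" .
    have 2: "U powr a \<le> M powr a" using that assms by (intro powr_mono2) auto
    have "U powr a * (M + \<bar>x\<bar>) powr (1 + a) \<le> M powr a * (2 powr (1 + a) * D powr (1 + a))"
      by (intro mult_mono 1 2) auto
    then show ?thesis using D pos by (simp add: stable_profile_def divide_simps mult_ac)
  qed
  show ?thesis
  proof (cases "A \<ge> B")
    case True
    have "stable_profile a T (x - y) \<le> 2 powr (1 + a) * stable_profile a M x"
      unfolding stable_profile_def[of a T] A_def[symmetric] using True AB assms by (intro single) auto
    then have "stable_profile a T (x - y) * stable_profile a S y \<le> 2 powr (1 + a) * stable_profile a M x * stable_profile a S y"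
      by (intro mult_right_mono) auto
    also have "\<dots> \<le> 2 powr (1 + a) * stable_profile a M x * (stable_profile a S y + stable_profile a T (x - y))"
      by (intro mult_left_mono) auto
    finally show ?thesis .
  next
    case False
    have "stable_profile a S y \<le> 2 powr (1 + a) * stable_profile a M x"
      unfolding stable_profile_def[of a S] B_def[symmetric] using False AB assms by (intro single) auto
    then have "stable_profile a T (x - y) * stable_profile a S y \<le> stable_profile a T (x - y) * (2 powr (1 + a) * stable_profile a M x)"
      by (intro mult_left_mono) auto
    also have "\<dots> = 2 powr (1 + a) * stable_profile a M x * stable_profile a T (x - y)" by simp
    also have "\<dots> \<le> 2 powr (1 + a) * stable_profile a M x * (stable_profile a S y + stable_profile a T (x - y))"
      by (intro mult_left_mono) auto
    finally show ?thesis .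
  qed
qed

lemma stable_profile_nn_integral_le:
  assumes "0 < T" "0 < a"
  shows "(\<integral>\<^sup>+ x. ennreal (stable_profile a T x) \<partial>lborel) \<le> ennreal (2 / a)"
proof -
  define f where "f x = T powr a * (T + x) powr (- a - 1)" for x
  have eq: "stable_profile a T x = f \<bar>x\<bar>" for x
    using assms by (simp add: f_def stable_profile_def powr_diff powr_add powr_minus divide_simps)
  have [measurable]: "f \<in> borel_measurable borel" unfolding f_def by measurable
  have half: "(\<integral>\<^sup>+ x. ennreal (f x) * indicator {0..} x \<partial>lborel) = ennreal (0 - (- (T powr a * (T + 0) powr (-a) / a)))"
  proof (rule nn_integral_FTC_atLeast)
    show "((\<lambda>x. - (T powr a * (T + x) powr (-a) / a)) has_real_derivative f x) (at x)" if "0 \<le> x" for x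
      using that assms unfolding f_def
      by (auto intro!: derivative_eq_intros simp: mult.commute)
    have "filterlim (\<lambda>x. T + x) at_top at_top"
      by (rule filterlim_tendsto_add_at_top[OF tendsto_const filterlim_ident])
    then have "((\<lambda>x. (T + x) powr (-a)) \<longlongrightarrow> 0) at_top"
      using assms by (intro tendsto_neg_powr) auto
    then have "((\<lambda>x. - (T powr a * (T + x) powr (-a) / a)) \<longlongrightarrow> - (T powr a * 0 / a)) at_top"
      by (intro tendsto_intros) (use assms in auto)
    then show "((\<lambda>x. - (T powr a * (T + x) powr (-a) / a)) \<longlongrightarrow> 0) at_top" by simp
  qed (auto simp: f_def)
  also have "\<dots> = ennreal (1 / a)" using assms by (simp add: powr_minus)
  finally have half: "(\<integral>\<^sup>+ x. ennreal (f x) * indicator {0..} x \<partial>lborel) = ennreal (1 / a)" .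
  have half': "(\<integral>\<^sup>+ x. ennreal (f (-x)) * indicator {0..} (-x) \<partial>lborel) = ennreal (1 / a)"
    using half nn_integral_real_affine[of "\<lambda>x. ennreal (f x) * indicator {0..} x" "-1" 0] by simp
  have "(\<integral>\<^sup>+ x. ennreal (stable_profile a T x) \<partial>lborel) \<le>
      (\<integral>\<^sup>+ x. ennreal (f x) * indicator {0..} x + ennreal (f (-x)) * indicator {0..} (-x) \<partial>lborel)"
    by (intro nn_integral_mono) (auto simp: eq indicator_def abs_if)
  also have "\<dots> = ennreal (1 / a) + ennreal (1 / a)"
    by (subst nn_integral_add) (auto simp: half half')
  also have "\<dots> = ennreal (2 / a)" using assms by (subst ennreal_plus[symmetric]) auto
  finally show ?thesis .
qed

lemma stable_profile_nn_integral_reflect_le: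
  assumes "0 < T" "0 < a"
  shows "(\<integral>\<^sup>+ y. ennreal (stable_profile a T (x - y)) \<partial>lborel) \<le> ennreal (2 / a)"
  using stable_profile_nn_integral_le[OF assms] nn_integral_real_affine[of "\<lambda>y. ennreal (stable_profile a T y)" "-1" x]
  by simp

text \<open>The conditions on M are those met by T = t^\<theta>, S = s^\<theta> and M = (t +
  s)^\<theta> for \<theta> < 1. The masses of both profiles, 2 / a each, do not depend on the scale,
  hence neither does the constant.\<close>

lemma stable_profile_convolution_le:
  assumes "0 < T" "0 < S" "T \<le> M" "S \<le> M" "M \<le> T + S" "0 < a"
  shows "(\<integral>\<^sup>+ y. ennreal (stable_profile a T (x - y) * stable_profile a S y) \<partial>lborel)
    \<le> ennreal (2 powr (1 + a) * (4 / a) * stable_profile a M x)"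
proof -
  have "(\<integral>\<^sup>+ y. ennreal (stable_profile a T (x - y) * stable_profile a S y) \<partial>lborel) \<le>
     (\<integral>\<^sup>+ y. ennreal (2 powr (1 + a) * stable_profile a M x) * (ennreal (stable_profile a S y) + ennreal (stable_profile a T (x - y))) \<partial>lborel)"
    using stable_profile_mult_le[OF assms]
    by (intro nn_integral_mono) (auto simp: ennreal_mult[symmetric] ennreal_plus[symmetric] simp del: ennreal_plus)
  also have "\<dots> = ennreal (2 powr (1 + a) * stable_profile a M x) *
      ((\<integral>\<^sup>+ y. ennreal (stable_profile a S y) \<partial>lborel) + (\<integral>\<^sup>+ y. ennreal (stable_profile a T (x - y)) \<partial>lborel))"
    by (subst nn_integral_cmult, simp, subst nn_integral_add) auto
  also have "\<dots> \<le> ennreal (2 powr (1 + a) * stable_profile a M x) * (ennreal (2 / a) + ennreal (2 / a))"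
    using assms by (intro mult_left_mono add_mono stable_profile_nn_integral_le stable_profile_nn_integral_reflect_le) auto
  also have "\<dots> = ennreal (2 powr (1 + a) * (4 / a) * stable_profile a M x)"
    using assms by (simp add: ennreal_mult[symmetric] ennreal_plus[symmetric] mult_ac del: ennreal_plus)
  finally show ?thesis .
qed

section \<open>Mild solutions for kernels comparable to the profile\<close>

text \<open>Each share r / (t + s) is at most 1 and therefore does not decrease when raised to a
  power \<theta> \<le> 1; the shares add up to 1.\<close>

lemma powr_add_le_add_powr:
  fixes t s \<theta> :: real
  assumes "0 < t" "0 < s" "0 < \<theta>" "\<theta> \<le> 1"
  shows "(t + s) powr \<theta> \<le> t powr \<theta> + s powr \<theta>"
proof -
  have *: "r / (t + s) * (t + s) powr \<theta> \<le> r powr \<theta>" if "0 < r" "r \<le> t + s" for r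
  proof -
    have "(r / (t + s)) powr 1 \<le> (r / (t + s)) powr \<theta>"
      using that assms by (intro powr_mono') auto
    then have "r / (t + s) * (t + s) powr \<theta> \<le> (r / (t + s)) powr \<theta> * (t + s) powr \<theta>"
      using that by (intro mult_right_mono) auto
    also have "\<dots> = r powr \<theta>" using that by (simp add: powr_divide)
    finally show ?thesis .
  qed
  have "(t + s) powr \<theta> = (t / (t + s) + s / (t + s)) * (t + s) powr \<theta>"
    using assms by (simp add: add_divide_distrib[symmetric])
  also have "\<dots> \<le> t powr \<theta> + s powr \<theta>"
    using *[of t] *[of s] assms by (simp add: distrib_right)
  finally show ?thesis .
qed

text \<open>The bound is free of t, which makes the later estimates global in time. With p =
  \<theta> * \<eta>, the condition p > 1 is the assumption on \<eta>.\<close>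

lemma nn_integral_shifted_powr_le:
  fixes \<gamma> p :: real
  assumes "0 < \<gamma>" "1 < p"
  shows "(\<integral>\<^sup>+ s. indicator {0<..<t} s * ennreal ((s + \<gamma>) powr (- p)) \<partial>lborel)
    \<le> ennreal (\<gamma> powr (1 - p) / (p - 1))"
proof -
  have "(\<integral>\<^sup>+ s. indicator {0<..<t} s * ennreal ((s + \<gamma>) powr (- p)) \<partial>lborel)
     \<le> (\<integral>\<^sup>+ s. ennreal ((s + \<gamma>) powr (- p)) * indicator {0..} s \<partial>lborel)"
    by (intro nn_integral_mono) (auto simp: indicator_def)
  also have "\<dots> = ennreal (0 - (- ((0 + \<gamma>) powr (- (p - 1)) / (p - 1))))"
  proof (rule nn_integral_FTC_atLeast)
    show "((\<lambda>s. - ((s + \<gamma>) powr (- (p - 1)) / (p - 1))) has_real_derivative (s + \<gamma>) powr (- p)) (at s)"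
      if "0 \<le> s" for s
      using that assms by (auto intro!: derivative_eq_intros simp: divide_simps) (simp add: algebra_simps)
    have "filterlim (\<lambda>s. \<gamma> + s) at_top at_top"
      by (rule filterlim_tendsto_add_at_top[OF tendsto_const filterlim_ident])
    then have "((\<lambda>s. (s + \<gamma>) powr (- (p - 1))) \<longlongrightarrow> 0) at_top"
      using assms by (intro tendsto_neg_powr) (auto simp: add.commute)
    then have "((\<lambda>s. - ((s + \<gamma>) powr (- (p - 1)) / (p - 1))) \<longlongrightarrow> - (0 / (p - 1))) at_top"
      by (intro tendsto_intros) (use assms in auto)
    then show "((\<lambda>s. - ((s + \<gamma>) powr (- (p - 1)) / (p - 1))) \<longlongrightarrow> 0) at_top" by simp
  qed auto
  also have "\<dots> = ennreal (\<gamma> powr (1 - p) / (p - 1))" by simp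
  finally show ?thesis .
qed

text \<open>Total weight of the kernel bound (t - s)^(-\<theta>) within distance c of its
  singularity. It vanishes with c, uniformly in t.\<close>

lemma nn_integral_singular_powr:
  fixes \<theta> c t :: real
  assumes "\<theta> < 1" "0 \<le> c"
  shows "(\<integral>\<^sup>+ s. indicator {t - c..t} s * ennreal ((t - s) powr (- \<theta>)) \<partial>lborel)
    = ennreal (c powr (1 - \<theta>) / (1 - \<theta>))"
proof -
  have "(\<integral>\<^sup>+ s. indicator {t - c..t} s * ennreal ((t - s) powr (- \<theta>)) \<partial>lborel)
    = (\<integral>\<^sup>+ r. ennreal (r powr (- \<theta>)) * indicator {0..c} r \<partial>lborel)"
    by (subst nn_integral_real_affine[where c="-1" and t=t])
      (auto intro!: nn_integral_cong simp: indicator_def)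
  also have "\<dots> = ennreal (c powr (1 - \<theta>) / (1 - \<theta>))"
    using has_integral_powr_from_0[of "-\<theta>" c] assms
    by (intro nn_integral_has_integral_lebesgue') (auto simp: add.commute)
  finally show ?thesis .
qed

text \<open>Continuity is local, and on a strip m < t < b the factor t^(-\<theta>) is at most
  m^(-\<theta>), which supplies fixed dominating functions.\<close>

lemma continuous_on_halfspaceI:
  fixes f :: "real \<times> 'a::topological_space \<Rightarrow> 'b::topological_space"
  assumes "\<And>m b. 0 < m \<Longrightarrow> m < b \<Longrightarrow> continuous_on ({m<..<b} \<times> UNIV) f"
  shows "continuous_on ({0<..} \<times> UNIV) f"
proof -
  have "continuous_on (\<Union>(m, b)\<in>{(m, b). 0 < m \<and> m < b}. {m<..<b::real} \<times> (UNIV :: 'a set)) f"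
    using assms by (intro continuous_on_open_UN) (auto intro: open_Times)
  also have "(\<Union>(m, b)\<in>{(m, b). 0 < m \<and> m < b}. {m<..<b::real} \<times> (UNIV :: 'a set)) = {0<..} \<times> UNIV"
  proof (intro equalityI subsetI)
    fix z :: "real \<times> 'a" assume "z \<in> {0<..} \<times> UNIV"
    then show "z \<in> (\<Union>(m, b)\<in>{(m, b). 0 < m \<and> m < b}. {m<..<b::real} \<times> (UNIV :: 'a set))"
      by (intro UN_I[of "(fst z / 2, fst z + 1)"]) (auto simp: mem_Times_iff)
  qed auto
  finally show ?thesis .
qed

text \<open>All that the fixed point argument knows of the kernel: no evolution equation and no
  semigroup identity. \<open>upper\<close> drives the estimates; \<open>lower\<close> gives
  nonnegativity and returns the final bound from the profile to \<open>G\<close>.\<close>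

locale heat_kernel_bounds =
  fixes G :: "real \<Rightarrow> real \<Rightarrow> real" and a \<theta> lo hi :: real
  assumes a_pos: "0 < a" and theta: "0 < \<theta>" "\<theta> < 1" and lo_pos: "0 < lo" and hi_pos: "0 < hi"
    and lower: "\<And>t x. 0 < t \<Longrightarrow> lo * stable_profile a (t powr \<theta>) x \<le> G t x"
    and upper: "\<And>t x. 0 < t \<Longrightarrow> G t x \<le> hi * stable_profile a (t powr \<theta>) x"
    and cont: "continuous_on ({0<..} \<times> UNIV) (\<lambda>(t, x). G t x)"
    and meas: "(\<lambda>(t, x). G t x) \<in> borel_measurable borel"
begin

definition "K t = stable_profile a (t powr \<theta>)"

definition "conv_const = hi * (2 powr (1 + a) * (4 / a))"

definition lin_term :: "(real \<Rightarrow> real) \<Rightarrow> real \<Rightarrow> real \<Rightarrow> ennreal" where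
  "lin_term V0 t x = (\<integral>\<^sup>+ y. ennreal (G t (x - y) * V0 y) \<partial>lborel)"

text \<open>The order of integration is that of the integral equation. Values in [0, \<infinity>]
  permit exchanging integrals and taking monotone limits before finiteness is known.\<close>

definition duhamel :: "(real \<Rightarrow> real \<Rightarrow> real) \<Rightarrow> real \<Rightarrow> real \<Rightarrow> ennreal" where
  "duhamel h t x = (\<integral>\<^sup>+ y. (\<integral>\<^sup>+ s. indicator {0<..<t} s * ennreal (G (t - s) (x - y) * h s y)
      \<partial>lborel) \<partial>lborel)"

lemma G_measurable [measurable]:
  assumes "f \<in> borel_measurable M" "h \<in> borel_measurable M"
  shows "(\<lambda>z. G (f z) (h z)) \<in> borel_measurable M"
  using measurable_compose[OF borel_measurable_Pair[OF assms] meas] by simp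

lemma K_nonneg [simp]: "0 \<le> K t x"
  by (simp add: K_def)

lemma K_measurable [measurable]: "(\<lambda>p. K (f p) (h p)) \<in> borel_measurable M"
  if [measurable]: "f \<in> borel_measurable M" "h \<in> borel_measurable M"
  unfolding K_def by measurable

lemma G_le: "0 < t \<Longrightarrow> G t x \<le> hi * K t x"
  using upper by (simp add: K_def)

lemma G_nonneg: "0 < t \<Longrightarrow> 0 \<le> G t x"
  using lower[of t x] lo_pos by (meson stable_profile_nonneg less_imp_le mult_nonneg_nonneg order_trans)

lemma K_le: "0 < t \<Longrightarrow> K t x \<le> t powr (- \<theta>)"
  using stable_profile_le_inverse[of "t powr \<theta>" a x] a_pos by (simp add: K_def powr_minus divide_inverse)

lemma conv_const_pos: "0 < conv_const"
  using a_pos hi_pos by (simp add: conv_const_def)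

lemma K_nn_integral_le: "0 < t \<Longrightarrow> (\<integral>\<^sup>+ x. ennreal (K t x) \<partial>lborel) \<le> ennreal (2 / a)"
  using stable_profile_nn_integral_le[of "t powr \<theta>" a] a_pos by (simp add: K_def)

lemma G_convolution_K_le:
  assumes "0 < t" "0 < s"
  shows "(\<integral>\<^sup>+ y. ennreal (G t (x - y) * K s y) \<partial>lborel) \<le> ennreal (conv_const * K (t + s) x)"
proof -
  have "(\<integral>\<^sup>+ y. ennreal (G t (x - y) * K s y) \<partial>lborel) \<le>
     (\<integral>\<^sup>+ y. ennreal hi * ennreal (stable_profile a (t powr \<theta>) (x - y) * stable_profile a (s powr \<theta>) y) \<partial>lborel)"
    using assms hi_pos upper[of t]
    by (intro nn_integral_mono)
       (auto simp: K_def ennreal_mult[symmetric] mult.assoc[symmetric] intro!: mult_right_mono)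
  also have "\<dots> = ennreal hi * (\<integral>\<^sup>+ y. ennreal (stable_profile a (t powr \<theta>) (x - y) * stable_profile a (s powr \<theta>) y) \<partial>lborel)"
    by (intro nn_integral_cmult) measurable
  also have "\<dots> \<le> ennreal hi * ennreal (2 powr (1 + a) * (4 / a) * stable_profile a ((t + s) powr \<theta>) x)"
    using assms a_pos theta powr_add_le_add_powr[of t s \<theta>]
    by (intro mult_left_mono stable_profile_convolution_le powr_mono2) auto
  also have "\<dots> = ennreal (conv_const * K (t + s) x)"
    using hi_pos a_pos by (simp add: ennreal_mult[symmetric] conv_const_def K_def mult_ac)
  finally show ?thesis .
qed

lemma lin_term_le:
  assumes "0 < t" "0 < \<gamma>" "0 \<le> B" "\<And>y. V0 y \<le> B * K \<gamma> y"
  shows "lin_term V0 t x \<le> ennreal (B * conv_const * K (t + \<gamma>) x)"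
proof -
  have "lin_term V0 t x \<le> (\<integral>\<^sup>+ y. ennreal B * ennreal (G t (x - y) * K \<gamma> y) \<partial>lborel)"
    unfolding lin_term_def
    using assms mult_left_mono[OF assms(4) G_nonneg[OF assms(1)]]
    by (intro nn_integral_mono) (auto simp: ennreal_mult'[symmetric] mult_ac intro!: ennreal_leI)
  also have "\<dots> = ennreal B * (\<integral>\<^sup>+ y. ennreal (G t (x - y) * K \<gamma> y) \<partial>lborel)"
    by (intro nn_integral_cmult) measurable
  also have "\<dots> \<le> ennreal B * ennreal (conv_const * K (t + \<gamma>) x)"
    using assms by (intro mult_left_mono G_convolution_K_le) auto
  finally show ?thesis using assms conv_const_pos by (simp add: ennreal_mult[symmetric] mult_ac)
qed

text \<open>With time outside, the space convolution can be estimated at each fixed s.\<close>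

lemma duhamel_swap:
  assumes [measurable]: "(\<lambda>(s, y). h s y) \<in> borel_measurable borel"
  shows "duhamel h t x = (\<integral>\<^sup>+ s. indicator {0<..<t} s *
      (\<integral>\<^sup>+ y. ennreal (G (t - s) (x - y) * h s y) \<partial>lborel) \<partial>lborel)"
proof -
  have [measurable]: "(\<lambda>(s, y). h s y) \<in> borel_measurable (lborel \<Otimes>\<^sub>M lborel)"
    using assms by (simp add: lborel_prod)
  have "duhamel h t x = (\<integral>\<^sup>+ s. (\<integral>\<^sup>+ y. indicator {0<..<t} s * ennreal (G (t - s) (x - y) * h s y)
      \<partial>lborel) \<partial>lborel)"
    unfolding duhamel_def by (rule lborel_pair.Fubini') measurable
  also have "\<dots> = (\<integral>\<^sup>+ s. indicator {0<..<t} s *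
      (\<integral>\<^sup>+ y. ennreal (G (t - s) (x - y) * h s y) \<partial>lborel) \<partial>lborel)"
    by (intro nn_integral_cong nn_integral_cmult) measurable
  finally show ?thesis .
qed

text \<open>For fixed s the inner integral is a linear term with elapsed time t - s and a datum
  below the profile at time s + \<gamma>. Since (t - s) + (s + \<gamma>) = t + \<gamma>, the
  resulting profile does not depend on s and leaves the time integral, where only (s +
  \<gamma>)^(-p) remains.\<close>

lemma duhamel_le:
  assumes [measurable]: "(\<lambda>(s, y). h s y) \<in> borel_measurable borel"
    and "0 < \<gamma>" "1 < p" "0 \<le> B" "0 < t"
    and h: "\<And>s y. 0 < s \<Longrightarrow> h s y \<le> B * (s + \<gamma>) powr (- p) * K (s + \<gamma>) y"
  shows "duhamel h t x \<le> ennreal (B * (\<gamma> powr (1 - p) / (p - 1)) * conv_const * K (t + \<gamma>) x)"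
proof -
  let ?c = "B * conv_const * K (t + \<gamma>) x"
  have "duhamel h t x \<le> (\<integral>\<^sup>+ s. ennreal ?c * (indicator {0<..<t} s * ennreal ((s + \<gamma>) powr (- p))) \<partial>lborel)"
    unfolding duhamel_swap[OF assms(1)]
  proof (intro nn_integral_mono)
    fix s
    show "indicator {0<..<t} s * (\<integral>\<^sup>+ y. ennreal (G (t - s) (x - y) * h s y) \<partial>lborel)
      \<le> ennreal ?c * (indicator {0<..<t} s * ennreal ((s + \<gamma>) powr (- p)))"
    proof (cases "s \<in> {0<..<t}")
      case True
      have "(\<integral>\<^sup>+ y. ennreal (G (t - s) (x - y) * h s y) \<partial>lborel)
         \<le> ennreal (B * (s + \<gamma>) powr (- p) * conv_const * K ((t - s) + (s + \<gamma>)) x)"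
        using True assms lin_term_le[of "t - s" "s + \<gamma>" "B * (s + \<gamma>) powr (- p)" "h s" x]
        by (simp add: lin_term_def)
      then show ?thesis
        using True assms conv_const_pos by (simp add: ennreal_mult[symmetric] mult_ac)
    qed simp
  qed
  also have "\<dots> = ennreal ?c * (\<integral>\<^sup>+ s. indicator {0<..<t} s * ennreal ((s + \<gamma>) powr (- p)) \<partial>lborel)"
    by (intro nn_integral_cmult) measurable
  also have "\<dots> \<le> ennreal ?c * ennreal (\<gamma> powr (1 - p) / (p - 1))"
    using assms by (intro mult_left_mono nn_integral_shifted_powr_le) auto
  also have "\<dots> = ennreal (B * (\<gamma> powr (1 - p) / (p - 1)) * conv_const * K (t + \<gamma>) x)"
    using assms conv_const_pos by (simp add: ennreal_mult[symmetric] mult_ac)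
  finally show ?thesis .
qed

section \<open>Joint continuity of the linear and the Duhamel term\<close>

lemma G_tendsto:
  assumes "t' \<longlonglongrightarrow> t" "x' \<longlonglongrightarrow> x" "\<And>n. 0 < t' n" "0 < t"
  shows "(\<lambda>n. G (t' n) (x' n)) \<longlonglongrightarrow> G t x"
  using continuous_on_tendsto_compose[OF cont tendsto_Pair[OF assms(1,2)]] assms by auto

text \<open>Dominated convergence: for times above m the kernel is at most hi * m^(-\<theta>)
  everywhere, and the datum is integrable because the profile is.\<close>

lemma continuous_lin_term:
  assumes [measurable]: "V0 \<in> borel_measurable borel" and "0 < \<gamma>" "0 \<le> B"
    and V0: "\<And>y. 0 \<le> V0 y" "\<And>y. V0 y \<le> B * K \<gamma> y"
  shows "continuous_on ({0<..} \<times> UNIV) (\<lambda>(t, x). enn2real (lin_term V0 t x))"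
proof (rule continuous_on_halfspaceI)
  fix m b :: real assume m: "0 < m" "m < b"
  show "continuous_on ({m<..<b} \<times> UNIV) (\<lambda>(t, x). enn2real (lin_term V0 t x))"
    unfolding continuous_on_sequentially
  proof safe
    fix z :: "nat \<Rightarrow> real \<times> real" and t x :: real
    assume z: "\<forall>n. z n \<in> {m<..<b} \<times> UNIV" and t: "t \<in> {m<..<b}" and lim: "z \<longlonglongrightarrow> (t, x)"
    have l1: "(\<lambda>n. fst (z n)) \<longlonglongrightarrow> t" and l2: "(\<lambda>n. snd (z n)) \<longlonglongrightarrow> x"
      using tendsto_fst[OF lim] tendsto_snd[OF lim] by auto
    have zpos: "m < fst (z n)" "0 < fst (z n)" for n using z m by (auto simp: mem_Times_iff intro: less_trans)
    have bd: "G r w * V0 y \<le> hi * m powr (- \<theta>) * (B * K \<gamma> y)" if "m < r" for r w y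
    proof -
      have "G r w \<le> hi * r powr (- \<theta>)"
        using G_le[of r w] K_le[of r w] that m hi_pos by (smt (verit) mult_left_mono)
      also have "\<dots> \<le> hi * m powr (- \<theta>)"
        using that m hi_pos theta by (intro mult_left_mono powr_mono2') auto
      finally show ?thesis using V0 hi_pos by (intro mult_mono) auto
    qed
    have "(\<lambda>n. \<integral>\<^sup>+ y. ennreal (G (fst (z n)) (snd (z n) - y) * V0 y) \<partial>lborel)
        \<longlonglongrightarrow> (\<integral>\<^sup>+ y. ennreal (G t (x - y) * V0 y) \<partial>lborel)"
    proof (rule nn_integral_dominated_convergence)
      show "AE y in lborel. ennreal (G (fst (z n)) (snd (z n) - y) * V0 y)
          \<le> ennreal (hi * m powr (- \<theta>) * (B * K \<gamma> y))" for n
        using bd zpos by (intro AE_I2 ennreal_leI) auto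
      have "(\<integral>\<^sup>+ y. ennreal (hi * m powr (- \<theta>) * (B * K \<gamma> y)) \<partial>lborel)
          = (\<integral>\<^sup>+ y. ennreal (hi * m powr (- \<theta>) * B) * ennreal (K \<gamma> y) \<partial>lborel)"
        using hi_pos assms by (simp add: ennreal_mult[symmetric] mult.assoc)
      also have "\<dots> = ennreal (hi * m powr (- \<theta>) * B) * (\<integral>\<^sup>+ y. ennreal (K \<gamma> y) \<partial>lborel)"
        by (intro nn_integral_cmult) measurable
      also have "\<dots> < \<infinity>"
        using K_nn_integral_le[OF \<open>0 < \<gamma>\<close>] by (auto simp: ennreal_mult_less_top intro: le_less_trans)
      finally show "(\<integral>\<^sup>+ y. ennreal (hi * m powr (- \<theta>) * (B * K \<gamma> y)) \<partial>lborel) < \<infinity>" .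
      show "AE y in lborel. (\<lambda>n. ennreal (G (fst (z n)) (snd (z n) - y) * V0 y))
          \<longlonglongrightarrow> ennreal (G t (x - y) * V0 y)"
        using l1 l2 zpos t m by (intro AE_I2 tendsto_ennrealI tendsto_mult G_tendsto tendsto_intros) auto
    qed measurable
    moreover have "lin_term V0 t x < \<infinity>"
      using lin_term_le[of t \<gamma> B V0 x] t m assms by (auto intro: le_less_trans)
    ultimately show "((\<lambda>(t, x). enn2real (lin_term V0 t x)) \<circ> z) \<longlonglongrightarrow> enn2real (lin_term V0 t x)"
      by (auto simp: lin_term_def o_def case_prod_beta intro!: tendsto_enn2real)
  qed
qed

text \<open>The kernel is singular at \<open>s = t\<close>. Cutting this singularity off gives a Duhamel term to which
  dominated convergence applies, and the error is uniformly small.\<close>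

definition cutoff :: "nat \<Rightarrow> real \<Rightarrow> real" where
  "cutoff k r = max 0 (min 1 (real (Suc k) * r - 1))"

definition duhamel_cut :: "nat \<Rightarrow> (real \<Rightarrow> real \<Rightarrow> real) \<Rightarrow> real \<Rightarrow> real \<Rightarrow> ennreal" where
  "duhamel_cut k h t x = (\<integral>\<^sup>+ z. indicator {0<..<t} (fst z) *
      ennreal (cutoff k (t - fst z) * G (t - fst z) (x - snd z) * h (fst z) (snd z)) \<partial>(lborel \<Otimes>\<^sub>M lborel))"

lemma cutoff_measurable [measurable]: "cutoff k \<in> borel_measurable borel"
  unfolding cutoff_def by measurable

lemma cutoff_bounds: "0 \<le> cutoff k r" "cutoff k r \<le> 1"
  by (auto simp: cutoff_def)

lemma cutoff_eq_0: "r \<le> 1 / real (Suc k) \<Longrightarrow> cutoff k r = 0"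
  by (auto simp: cutoff_def field_simps max_def min_def)

lemma cutoff_eq_1: "2 / real (Suc k) \<le> r \<Longrightarrow> cutoff k r = 1"
  by (auto simp: cutoff_def field_simps max_def min_def)

lemma duhamel_pair:
  assumes [measurable]: "(\<lambda>(s, y). h s y) \<in> borel_measurable borel"
  shows "duhamel h t x = (\<integral>\<^sup>+ z. indicator {0<..<t} (fst z) *
      ennreal (G (t - fst z) (x - snd z) * h (fst z) (snd z)) \<partial>(lborel \<Otimes>\<^sub>M lborel))"
proof -
  have [measurable]: "(\<lambda>(s, y). h s y) \<in> borel_measurable (lborel \<Otimes>\<^sub>M lborel)"
    using assms by (simp add: lborel_prod)
  show ?thesis unfolding duhamel_def
    by (subst lborel_pair.nn_integral_snd[symmetric]) auto
qed

text \<open>Whenever the kernel is replaced by a bound in time alone, space integration falls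
  entirely on \<open>h\<close>, whose mass is controlled uniformly in time.\<close>

lemma nn_integral_slab_le:
  fixes h :: "real \<Rightarrow> real \<Rightarrow> real"
  assumes [measurable]: "(\<lambda>(s, y). h s y) \<in> borel_measurable borel" "f \<in> borel_measurable borel"
    and h: "\<And>s. 0 < s \<Longrightarrow> (\<integral>\<^sup>+ y. ennreal (h s y) \<partial>lborel) \<le> ennreal H"
    and f: "\<And>s. s \<le> 0 \<Longrightarrow> f s = 0"
  shows "(\<integral>\<^sup>+ z. f (fst z) * ennreal (h (fst z) (snd z)) \<partial>(lborel \<Otimes>\<^sub>M lborel))
     \<le> (\<integral>\<^sup>+ s. f s \<partial>lborel) * ennreal H"
proof -
  have [measurable]: "(\<lambda>(s, y). h s y) \<in> borel_measurable (lborel \<Otimes>\<^sub>M lborel)"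
    using assms by (simp add: lborel_prod)
  have "(\<integral>\<^sup>+ z. f (fst z) * ennreal (h (fst z) (snd z)) \<partial>(lborel \<Otimes>\<^sub>M lborel))
      = (\<integral>\<^sup>+ s. \<integral>\<^sup>+ y. f s * ennreal (h s y) \<partial>lborel \<partial>lborel)"
    by (subst lborel.nn_integral_fst[symmetric]) auto
  also have "\<dots> = (\<integral>\<^sup>+ s. f s * (\<integral>\<^sup>+ y. ennreal (h s y) \<partial>lborel) \<partial>lborel)"
    by (intro nn_integral_cong nn_integral_cmult) measurable
  also have "\<dots> \<le> (\<integral>\<^sup>+ s. f s * ennreal H \<partial>lborel)"
  proof (intro nn_integral_mono)
    show "f s * (\<integral>\<^sup>+ y. ennreal (h s y) \<partial>lborel) \<le> f s * ennreal H" for s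
      using h[of s] f[of s] by (cases "0 < s") (auto simp: not_less intro: mult_left_mono)
  qed
  also have "\<dots> = (\<integral>\<^sup>+ s. f s \<partial>lborel) * ennreal H"
    by (intro nn_integral_multc) measurable
  finally show ?thesis .
qed

lemma duhamel_cut_le_duhamel:
  assumes "(\<lambda>(s, y). h s y) \<in> borel_measurable borel" "\<And>s y. 0 \<le> h s y"
  shows "duhamel_cut k h t x \<le> duhamel h t x"
  unfolding duhamel_cut_def duhamel_pair[OF assms(1)]
proof (intro nn_integral_mono)
  fix z :: "real \<times> real"
  show "indicator {0<..<t} (fst z) * ennreal (cutoff k (t - fst z) * G (t - fst z) (x - snd z) * h (fst z) (snd z))
    \<le> indicator {0<..<t} (fst z) * ennreal (G (t - fst z) (x - snd z) * h (fst z) (snd z))"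
    using cutoff_bounds[of k "t - fst z"] G_nonneg[of "t - fst z" "x - snd z"] assms(2)[of "fst z" "snd z"]
    by (auto simp: indicator_def intro!: ennreal_leI mult_right_mono mult_left_le_one_le)
qed

text \<open>Cutting changes the integrand only for t - s < 2 / (k + 1). There the kernel is at most
  hi * (t - s)^(-\<theta>), so the error involves neither t nor x; this is the source of uniform
  convergence.\<close>

lemma duhamel_le_duhamel_cut:
  assumes meas_h [measurable]: "(\<lambda>(s, y). h s y) \<in> borel_measurable borel" and h_nn: "\<And>s y. 0 \<le> h s y"
    and h: "\<And>s. 0 < s \<Longrightarrow> (\<integral>\<^sup>+ y. ennreal (h s y) \<partial>lborel) \<le> ennreal H" and "0 \<le> H"
  shows "duhamel h t x \<le> duhamel_cut k h t x
     + ennreal (hi * H * ((2 / real (Suc k)) powr (1 - \<theta>) / (1 - \<theta>)))"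
proof -
  have [measurable]: "(\<lambda>(s, y). h s y) \<in> borel_measurable (lborel \<Otimes>\<^sub>M lborel)"
    using assms by (simp add: lborel_prod)
  define c where "c = 2 / real (Suc k)"
  define f where "f s = ennreal hi * (indicator {0<..<t} s * (indicator {t - c..t} s * ennreal ((t - s) powr (-\<theta>))))" for s
  have [measurable]: "f \<in> borel_measurable borel" unfolding f_def by measurable
  have pt: "indicator {0<..<t} s * ennreal (G (t - s) (x - y) * h s y)
      \<le> indicator {0<..<t} s * ennreal (cutoff k (t - s) * G (t - s) (x - y) * h s y) + f s * ennreal (h s y)" for s y
  proof (cases "s \<in> {0<..<t}")
    case s: True
    show ?thesis
    proof (cases "c \<le> t - s")
      case True
      then show ?thesis using cutoff_eq_1[of k "t - s"] by (simp add: c_def)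
    next
      case False
      have "G (t - s) (x - y) \<le> hi * (t - s) powr (-\<theta>)"
        using G_le[of "t - s" "x - y"] K_le[of "t - s" "x - y"] s hi_pos by (smt (verit) greaterThanLessThan_iff mult_left_mono)
      then have "ennreal (G (t - s) (x - y) * h s y) \<le> ennreal (hi * (t - s) powr (-\<theta>) * h s y)"
        using h_nn by (intro ennreal_leI mult_right_mono) auto
      also have "\<dots> = f s * ennreal (h s y)"
        using s False hi_pos h_nn by (auto simp: f_def ennreal_mult[symmetric] indicator_def)
      finally show ?thesis using s by (simp add: add_increasing)
    qed
  qed simp
  have "duhamel h t x \<le> (\<integral>\<^sup>+ z. indicator {0<..<t} (fst z) *
      ennreal (cutoff k (t - fst z) * G (t - fst z) (x - snd z) * h (fst z) (snd z)) +
      f (fst z) * ennreal (h (fst z) (snd z)) \<partial>(lborel \<Otimes>\<^sub>M lborel))"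
    unfolding duhamel_pair[OF meas_h] by (intro nn_integral_mono pt)
  also have "\<dots> = duhamel_cut k h t x + (\<integral>\<^sup>+ z. f (fst z) * ennreal (h (fst z) (snd z)) \<partial>(lborel \<Otimes>\<^sub>M lborel))"
    unfolding duhamel_cut_def by (intro nn_integral_add) measurable
  also have "(\<integral>\<^sup>+ z. f (fst z) * ennreal (h (fst z) (snd z)) \<partial>(lborel \<Otimes>\<^sub>M lborel))
      \<le> (\<integral>\<^sup>+ s. f s \<partial>lborel) * ennreal H"
    by (intro nn_integral_slab_le h) (auto simp: f_def)
  also have "(\<integral>\<^sup>+ s. f s \<partial>lborel) \<le> (\<integral>\<^sup>+ s. ennreal hi * (indicator {t - c..t} s * ennreal ((t - s) powr (-\<theta>))) \<partial>lborel)"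
    by (intro nn_integral_mono) (auto simp: f_def indicator_def)
  also have "\<dots> = ennreal hi * (\<integral>\<^sup>+ s. indicator {t - c..t} s * ennreal ((t - s) powr (-\<theta>)) \<partial>lborel)"
    by (intro nn_integral_cmult) measurable
  also have "\<dots> = ennreal hi * ennreal (c powr (1 - \<theta>) / (1 - \<theta>))"
    using theta by (subst nn_integral_singular_powr) (auto simp: c_def)
  also have "\<dots> * ennreal H = ennreal (hi * H * (c powr (1 - \<theta>) / (1 - \<theta>)))"
    using hi_pos theta \<open>0 \<le> H\<close> by (simp add: ennreal_mult[symmetric] mult_ac)
  finally show ?thesis by (simp add: add_left_mono mult_right_mono c_def)
qed

text \<open>The cutoff vanishes for t - s \<le> c = 1 / (k + 1), so the kernel is effectively
  bounded by hi * c^(-\<theta>), and this constant times \<open>h\<close> is integrable over the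
  slab 0 < s < b.\<close>

lemma continuous_duhamel_cut:
  assumes meas_h [measurable]: "(\<lambda>(s, y). h s y) \<in> borel_measurable borel" and h_nn: "\<And>s y. 0 \<le> h s y"
    and h: "\<And>s. 0 < s \<Longrightarrow> (\<integral>\<^sup>+ y. ennreal (h s y) \<partial>lborel) \<le> ennreal H"
    and fin: "\<And>t x. 0 < t \<Longrightarrow> duhamel_cut k h t x < \<infinity>"
  shows "continuous_on ({0<..} \<times> UNIV) (\<lambda>(t, x). enn2real (duhamel_cut k h t x))"
proof (rule continuous_on_halfspaceI)
  fix m b :: real assume m: "0 < m" "m < b"
  have [measurable]: "(\<lambda>(s, y). h s y) \<in> borel_measurable (lborel \<Otimes>\<^sub>M lborel)"
    using assms by (simp add: lborel_prod)
  show "continuous_on ({m<..<b} \<times> UNIV) (\<lambda>(t, x). enn2real (duhamel_cut k h t x))"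
    unfolding continuous_on_sequentially
  proof safe
    fix z :: "nat \<Rightarrow> real \<times> real" and t x :: real
    assume z: "\<forall>n. z n \<in> {m<..<b} \<times> UNIV" and t: "t \<in> {m<..<b}" and lim: "z \<longlonglongrightarrow> (t, x)"
    have l1: "(\<lambda>n. fst (z n)) \<longlonglongrightarrow> t" and l2: "(\<lambda>n. snd (z n)) \<longlonglongrightarrow> x"
      using tendsto_fst[OF lim] tendsto_snd[OF lim] by auto
    have zb: "fst (z n) < b" for n using z by (auto simp: mem_Times_iff)
    define c where "c = 1 / real (Suc k)"
    have c: "0 < c" by (simp add: c_def)
    have bd: "indicator {0<..<r} s * ennreal (cutoff k (r - s) * G (r - s) w * h s y)
       \<le> (indicator {0<..<b} s * ennreal (hi * c powr (-\<theta>))) * ennreal (h s y)" if "r < b" for r s w y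
    proof (cases "0 < s \<and> c < r - s")
      case True
      have "G (r - s) w \<le> hi * (r - s) powr (- \<theta>)"
        using G_le[of "r - s" w] K_le[of "r - s" w] c True hi_pos by (smt (verit) mult_left_mono)
      also have "\<dots> \<le> hi * c powr (- \<theta>)"
        using True c hi_pos theta by (intro mult_left_mono powr_mono2') auto
      finally have "cutoff k (r - s) * G (r - s) w \<le> 1 * (hi * c powr (-\<theta>))"
        using cutoff_bounds[of k "r - s"] G_nonneg[of "r - s" w] True c by (intro mult_mono) auto
      then have "cutoff k (r - s) * G (r - s) w * h s y \<le> (hi * c powr (-\<theta>)) * h s y"
        using h_nn by (intro mult_right_mono) auto
      then show ?thesis using True c that hi_pos h_nn by (auto simp: indicator_def ennreal_mult[symmetric] intro!: ennreal_leI)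
    next
      case False
      then show ?thesis using cutoff_eq_0[of "r - s" k] by (auto simp: indicator_def c_def)
    qed
    have "(\<lambda>n. duhamel_cut k h (fst (z n)) (snd (z n))) \<longlonglongrightarrow> duhamel_cut k h t x"
      unfolding duhamel_cut_def
    proof (rule nn_integral_dominated_convergence)
      let ?w = "\<lambda>p :: real \<times> real. (indicator {0<..<b} (fst p) * ennreal (hi * c powr (-\<theta>))) * ennreal (h (fst p) (snd p))"
      show "AE p in lborel \<Otimes>\<^sub>M lborel. indicator {0<..<fst (z n)} (fst p) *
          ennreal (cutoff k (fst (z n) - fst p) * G (fst (z n) - fst p) (snd (z n) - snd p) * h (fst p) (snd p)) \<le> ?w p" for n
        by (intro AE_I2 bd zb)
      have "(\<integral>\<^sup>+ p. ?w p \<partial>(lborel \<Otimes>\<^sub>M lborel)) \<le>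
         (\<integral>\<^sup>+ s. indicator {0<..<b} s * ennreal (hi * c powr (-\<theta>)) \<partial>lborel) * ennreal H"
        by (intro nn_integral_slab_le h) auto
      also have "\<dots> < \<infinity>"
        by (subst nn_integral_multc) (use m in \<open>auto simp: ennreal_mult_less_top\<close>)
      finally show "(\<integral>\<^sup>+ p. ?w p \<partial>(lborel \<Otimes>\<^sub>M lborel)) < \<infinity>" .
      have "(\<lambda>n. indicator {0<..<fst (z n)} s *
          ennreal (cutoff k (fst (z n) - s) * G (fst (z n) - s) (snd (z n) - y) * h s y))
          \<longlonglongrightarrow> indicator {0<..<t} s * ennreal (cutoff k (t - s) * G (t - s) (x - y) * h s y)" for s y
      proof (cases "0 < s \<and> s < t")
        case True
        have ev: "\<forall>\<^sub>F n in sequentially. s < fst (z n)"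
          using l1 True by (intro order_tendstoD) auto
        have "isCont (cutoff k) (t - s)" unfolding cutoff_def by (intro continuous_intros)
        then have "(\<lambda>n. cutoff k (fst (z n) - s)) \<longlonglongrightarrow> cutoff k (t - s)"
          by (rule isCont_tendsto_compose) (intro tendsto_intros l1)
        moreover have "(\<lambda>n. G (fst (z n) - s) (snd (z n) - y)) \<longlonglongrightarrow> G (t - s) (x - y)"
        proof -
          \<comment> \<open>\<open>G_tendsto\<close> asks for positive times at every index, but fst
            (z n) - s may be nonpositive for finitely many n; those values are replaced by the
            limit.\<close>
          define t' where "t' n = (if s < fst (z n) then fst (z n) - s else t - s)" for n
          have e: "\<forall>\<^sub>F n in sequentially. t' n = fst (z n) - s" using ev by eventually_elim (simp add: t'_def)
          have "(\<lambda>n. fst (z n) - s) \<longlonglongrightarrow> t - s" by (intro tendsto_intros l1)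
          then have t': "t' \<longlonglongrightarrow> t - s" using tendsto_cong[OF e] by simp
          have "(\<lambda>n. G (t' n) (snd (z n) - y)) \<longlonglongrightarrow> G (t - s) (x - y)"
            using True by (intro G_tendsto[OF t'] tendsto_intros l2) (auto simp: t'_def)
          moreover have "\<forall>\<^sub>F n in sequentially. G (t' n) (snd (z n) - y) = G (fst (z n) - s) (snd (z n) - y)"
            using e by eventually_elim simp
          ultimately show ?thesis by (rule Lim_transform_eventually)
        qed
        ultimately have "(\<lambda>n. ennreal (cutoff k (fst (z n) - s) * G (fst (z n) - s) (snd (z n) - y) * h s y))
          \<longlonglongrightarrow> ennreal (cutoff k (t - s) * G (t - s) (x - y) * h s y)"
          by (intro tendsto_ennrealI tendsto_intros)
        moreover have "\<forall>\<^sub>F n in sequentially. ennreal (cutoff k (fst (z n) - s) * G (fst (z n) - s) (snd (z n) - y) * h s y)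
          = indicator {0<..<fst (z n)} s * ennreal (cutoff k (fst (z n) - s) * G (fst (z n) - s) (snd (z n) - y) * h s y)"
          using ev by eventually_elim (use True in \<open>simp add: indicator_def\<close>)
        ultimately have "(\<lambda>n. indicator {0<..<fst (z n)} s *
          ennreal (cutoff k (fst (z n) - s) * G (fst (z n) - s) (snd (z n) - y) * h s y))
          \<longlonglongrightarrow> ennreal (cutoff k (t - s) * G (t - s) (x - y) * h s y)"
          by (rule Lim_transform_eventually)
        then show ?thesis using True by simp
      next
        \<comment> \<open>The time indicator jumps at s = t. No trouble arises there, since the
          cutoff already kills the integrand once fst (z n) - s < c.\<close>
        case False
        then have lim0: "indicator {0<..<t} s * ennreal (cutoff k (t - s) * G (t - s) (x - y) * h s y) = 0"
          by (auto simp: indicator_def)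
        have "\<forall>\<^sub>F n in sequentially. s \<le> 0 \<or> fst (z n) - s < c"
        proof (cases "0 < s")
          case True
          then have "t < s + c" using False c by auto
          then have "\<forall>\<^sub>F n in sequentially. fst (z n) < s + c" using l1 by (intro order_tendstoD)
          then show ?thesis by eventually_elim auto
        qed (auto simp: not_less)
        then have "\<forall>\<^sub>F n in sequentially. 0 = indicator {0<..<fst (z n)} s *
            ennreal (cutoff k (fst (z n) - s) * G (fst (z n) - s) (snd (z n) - y) * h s y)"
          by eventually_elim (auto simp: cutoff_eq_0 c_def indicator_def)
        then have "(\<lambda>n. indicator {0<..<fst (z n)} s *
            ennreal (cutoff k (fst (z n) - s) * G (fst (z n) - s) (snd (z n) - y) * h s y)) \<longlonglongrightarrow> 0"
          by (rule Lim_transform_eventually[OF tendsto_const])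
        then show ?thesis unfolding lim0 .
      qed
      then show "AE p in lborel \<Otimes>\<^sub>M lborel. (\<lambda>n. indicator {0<..<fst (z n)} (fst p) *
          ennreal (cutoff k (fst (z n) - fst p) * G (fst (z n) - fst p) (snd (z n) - snd p) * h (fst p) (snd p)))
          \<longlonglongrightarrow> indicator {0<..<t} (fst p) * ennreal (cutoff k (t - fst p) * G (t - fst p) (x - snd p) * h (fst p) (snd p))"
        by (intro AE_I2)
    qed measurable
    then show "((\<lambda>(t, x). enn2real (duhamel_cut k h t x)) \<circ> z) \<longlonglongrightarrow> enn2real (duhamel_cut k h t x)"
      using fin[of t x] t m by (auto simp: o_def case_prod_beta intro!: tendsto_enn2real)
  qed
qed

text \<open>Uniform limit of the cut terms; the error tends to 0 because its exponent 1 - \<theta>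
  is positive.\<close>

lemma continuous_duhamel:
  assumes meas_h: "(\<lambda>(s, y). h s y) \<in> borel_measurable borel" and h_nn: "\<And>s y. 0 \<le> h s y"
    and h: "\<And>s. 0 < s \<Longrightarrow> (\<integral>\<^sup>+ y. ennreal (h s y) \<partial>lborel) \<le> ennreal H" and "0 \<le> H"
    and fin: "\<And>t x. 0 < t \<Longrightarrow> duhamel h t x < \<infinity>"
  shows "continuous_on ({0<..} \<times> UNIV) (\<lambda>(t, x). enn2real (duhamel h t x))"
proof (rule uniform_limit_theorem)
  define e where "e k = hi * H * ((2 / real (Suc k)) powr (1 - \<theta>) / (1 - \<theta>))" for k
  have e_nn: "0 \<le> e k" for k using hi_pos theta \<open>0 \<le> H\<close> by (simp add: e_def)
  have "(\<lambda>k. 2 * inverse (real (Suc k))) \<longlonglongrightarrow> 2 * 0"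
    by (intro tendsto_intros LIMSEQ_inverse_real_of_nat)
  then have lim0: "(\<lambda>k. 2 / real (Suc k)) \<longlonglongrightarrow> 0" by (simp only: divide_inverse mult_zero_right)
  have lp: "(\<lambda>k. (2 / real (Suc k)) powr (1 - \<theta>)) \<longlonglongrightarrow> 0 powr (1 - \<theta>)"
    using theta by (intro tendsto_powr'[OF lim0 tendsto_const]) auto
  have "e \<longlonglongrightarrow> hi * H * (0 powr (1 - \<theta>) / (1 - \<theta>))"
    unfolding e_def using theta by (intro tendsto_mult tendsto_divide tendsto_const lp) auto
  then have e_lim: "e \<longlonglongrightarrow> 0" by simp
  have cut_fin: "duhamel_cut k h t x < \<infinity>" if "0 < t" for k t x
    using duhamel_cut_le_duhamel[OF meas_h h_nn] fin[OF that] by (rule le_less_trans)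
  show "\<forall>\<^sub>F k in sequentially. continuous_on ({0<..} \<times> UNIV) (\<lambda>(t, x). enn2real (duhamel_cut k h t x))"
    by (intro always_eventually allI continuous_duhamel_cut[OF meas_h h_nn h cut_fin]) auto
  show "uniform_limit ({0<..} \<times> UNIV) (\<lambda>k (t, x). enn2real (duhamel_cut k h t x))
     (\<lambda>(t, x). enn2real (duhamel h t x)) sequentially"
  proof (rule uniform_limitI)
    fix \<epsilon> :: real assume "0 < \<epsilon>"
    then have "\<forall>\<^sub>F k in sequentially. e k < \<epsilon>" using e_lim by (intro order_tendstoD) auto
    then show "\<forall>\<^sub>F k in sequentially. \<forall>z\<in>{0<..} \<times> UNIV.
        dist (case z of (t, x) \<Rightarrow> enn2real (duhamel_cut k h t x)) (case z of (t, x) \<Rightarrow> enn2real (duhamel h t x)) < \<epsilon>"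
    proof eventually_elim
      case (elim k)
      have "dist (enn2real (duhamel_cut k h t x)) (enn2real (duhamel h t x)) < \<epsilon>" if tpos: "0 < t" for t x
      proof -
        obtain u where u: "duhamel h t x = ennreal u" "0 \<le> u" using fin[OF tpos, of x] by (cases "duhamel h t x") auto
        obtain v where v: "duhamel_cut k h t x = ennreal v" "0 \<le> v"
          using cut_fin[OF tpos, of k x] by (cases "duhamel_cut k h t x") auto
        have "v \<le> u" using duhamel_cut_le_duhamel[OF meas_h h_nn, of k t x] u v by simp
        moreover have "u \<le> v + e k"
          using duhamel_le_duhamel_cut[OF meas_h h_nn h \<open>0 \<le> H\<close>, of t x k] u v e_nn[of k]
          unfolding e_def[symmetric] by (simp add: ennreal_plus[symmetric] del: ennreal_plus)
        ultimately show ?thesis using u v elim by (simp add: dist_real_def)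
      qed
      then show ?case by auto
    qed
  qed
qed simp

section \<open>Picard iteration\<close>

primrec picard :: "(real \<Rightarrow> real) \<Rightarrow> real \<Rightarrow> nat \<Rightarrow> real \<Rightarrow> real \<Rightarrow> real" where
  "picard V0 p 0 = (\<lambda>t x. 0)"
| "picard V0 p (Suc n) = (\<lambda>t x. if 0 < t
     then enn2real (lin_term V0 t x + duhamel (\<lambda>s y. picard V0 p n s y powr p) t x) else 0)"

lemma lin_term_measurable:
  assumes [measurable]: "V0 \<in> borel_measurable borel"
  shows "(\<lambda>z. lin_term V0 (fst z) (snd z)) \<in> borel_measurable (borel \<Otimes>\<^sub>M borel)"
  unfolding lin_term_def by measurable

lemma duhamel_measurable:
  assumes "(\<lambda>(s, y). h s y) \<in> borel_measurable borel"
  shows "(\<lambda>z. duhamel h (fst z) (snd z)) \<in> borel_measurable (borel \<Otimes>\<^sub>M borel)"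
proof -
  have [measurable]: "(\<lambda>(s, y). h s y) \<in> borel_measurable (borel \<Otimes>\<^sub>M borel)"
    using assms by (simp add: borel_prod)
  have [measurable]: "(\<lambda>z. indicator {0<..<f z} (g z) :: ennreal) \<in> borel_measurable M"
    if [measurable]: "f \<in> borel_measurable M" "g \<in> borel_measurable M"
    for f g :: "'z \<Rightarrow> real" and M
    unfolding indicator_def greaterThanLessThan_iff by measurable
  show ?thesis unfolding duhamel_def by measurable
qed

lemma picard_measurable:
  assumes "V0 \<in> borel_measurable borel"
  shows "(\<lambda>(s, y). picard V0 p n s y) \<in> borel_measurable borel"
proof (induction n)
  case (Suc n)
  note lin_term_measurable[OF assms, measurable]
  have "(\<lambda>(s, y). picard V0 p n s y powr p) \<in> borel_measurable borel"
    using Suc by (simp add: case_prod_beta')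
  note duhamel_measurable[OF this, measurable]
  have "(\<lambda>z. if 0 < fst z then enn2real (lin_term V0 (fst z) (snd z) +
      duhamel (\<lambda>s y. picard V0 p n s y powr p) (fst z) (snd z)) else 0) \<in> borel_measurable (borel \<Otimes>\<^sub>M borel)"
    by measurable
  then show ?case by (simp add: case_prod_beta' borel_prod)
qed simp

text \<open>One factor \<open>K\<close> is kept for the convolution in space; the remaining power
  \<eta> is spent on decay in time through K \<le> (s + \<gamma>)^(-\<theta>).\<close>

lemma powr_bound_K:
  assumes "0 \<le> v" "v \<le> C * K (s + \<gamma>) y" "0 < s" "0 < \<gamma>" "0 < C" "0 < \<eta>"
  shows "v powr (1 + \<eta>) \<le> C powr (1 + \<eta>) * (s + \<gamma>) powr (- (\<theta> * \<eta>)) * K (s + \<gamma>) y"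
proof -
  have "v powr (1 + \<eta>) \<le> (C * K (s + \<gamma>) y) powr (1 + \<eta>)"
    using assms by (intro powr_mono2) auto
  also have "\<dots> = C powr (1 + \<eta>) * (K (s + \<gamma>) y powr \<eta> * K (s + \<gamma>) y)"
    using assms K_nonneg[of "s + \<gamma>" y] by (simp add: powr_mult powr_add)
  also have "K (s + \<gamma>) y powr \<eta> \<le> ((s + \<gamma>) powr (- \<theta>)) powr \<eta>"
    using assms K_le[of "s + \<gamma>" y] by (intro powr_mono2) auto
  also have "\<dots> = (s + \<gamma>) powr (- (\<theta> * \<eta>))" by (simp add: powr_powr)
  finally show ?thesis using assms by (simp add: mult_left_mono mult_right_mono mult.assoc)
qed

lemma duhamel_mono:
  assumes "\<And>s y. h s y \<le> h' s y"
  shows "duhamel h t x \<le> duhamel h' t x"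
  unfolding duhamel_def
  by (intro nn_integral_mono) (auto simp: indicator_def G_nonneg intro!: ennreal_leI mult_left_mono assms)

lemma duhamel_tendsto:
  assumes meas: "\<And>n. (\<lambda>(s, y). h n s y) \<in> borel_measurable borel"
    and mono: "\<And>n s y. h n s y \<le> h (Suc n) s y"
    and lim: "\<And>s y. (\<lambda>n. h n s y) \<longlonglongrightarrow> h' s y"
  shows "(\<lambda>n. duhamel (h n) t x) \<longlonglongrightarrow> duhamel h' t x"
proof -
  have meas': "(\<lambda>(s, y). h' s y) \<in> borel_measurable borel"
    using borel_measurable_LIMSEQ_real[of borel "\<lambda>n z. h n (fst z) (snd z)" "\<lambda>z. h' (fst z) (snd z)"] meas lim
    by (auto simp: case_prod_beta')
  have [measurable]: "(\<lambda>(s, y). h n s y) \<in> borel_measurable (lborel \<Otimes>\<^sub>M lborel)"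
      "(\<lambda>(s, y). h' s y) \<in> borel_measurable (lborel \<Otimes>\<^sub>M lborel)" for n
    using meas meas' by (auto simp: lborel_prod)
  show ?thesis
    unfolding duhamel_pair[OF meas] duhamel_pair[OF meas']
  proof (rule nn_integral_LIMSEQ)
    show "incseq (\<lambda>n z. indicator {0<..<t} (fst z) * ennreal (G (t - fst z) (x - snd z) * h n (fst z) (snd z)))"
      using mono by (intro incseq_SucI le_funI) (auto simp: indicator_def G_nonneg intro!: ennreal_leI mult_left_mono)
    show "(\<lambda>n. indicator {0<..<t} (fst z) * ennreal (G (t - fst z) (x - snd z) * h n (fst z) (snd z)))
       \<longlonglongrightarrow> indicator {0<..<t} (fst z) * ennreal (G (t - fst z) (x - snd z) * h' (fst z) (snd z))" for z
      by (cases "fst z \<in> {0<..<t}") (auto intro!: tendsto_ennrealI tendsto_intros lim)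
  qed measurable
qed

theorem mild_solution_exists:
  assumes "0 < \<eta>" "1 < \<theta> * \<eta>" "0 < \<gamma>"
  shows "\<exists>\<delta>0>0. \<forall>\<delta>. 0 < \<delta> \<and> \<delta> < \<delta>0 \<longrightarrow>
    (\<forall>V0. V0 \<in> borel_measurable borel \<and> (\<forall>x. 0 \<le> V0 x \<and> V0 x \<le> \<delta> * G \<gamma> x) \<longrightarrow>
      (\<exists>V C. (\<lambda>(t, x). V t x) \<in> borel_measurable borel \<and> (\<forall>t>0. \<forall>x. 0 \<le> V t x) \<and>
         (\<forall>t>0. \<forall>x. ennreal (V t x) = lin_term V0 t x + duhamel (\<lambda>s y. V s y powr (1 + \<eta>)) t x) \<and>
         (\<forall>t>0. \<forall>x. V t x \<le> C * G (t + \<gamma>) x) \<and>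
         continuous_on ({0<..} \<times> UNIV) (\<lambda>(t, x). V t x)))"
proof -
  define J where "J = \<gamma> powr (1 - \<theta> * \<eta>) / (\<theta> * \<eta> - 1)"
  have J: "0 < J" using assms by (simp add: J_def)
  \<comment> \<open>Solves C^(1 + \<eta>) * J * conv_const = C / 2: the Duhamel term may use half of
    the barrier C * K, the linear term the other half.\<close>
  define C where "C = (1 / (2 * conv_const * J)) powr (1 / \<eta>)"
  have C: "0 < C" using J conv_const_pos by (simp add: C_def)
  have C_eq: "C powr (1 + \<eta>) * J * conv_const = C / 2"
  proof -
    have "C powr \<eta> = 1 / (2 * conv_const * J)"
      using J conv_const_pos assms by (simp add: C_def powr_powr)
    then show ?thesis using J conv_const_pos C by (simp add: powr_add)
  qed
  \<comment> \<open>Below this threshold the linear term stays within its half: \<delta> * hi *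
    conv_const \<le> C / 2.\<close>
  define \<delta>0 where "\<delta>0 = C / (2 * hi * conv_const)"
  have \<delta>0: "0 < \<delta>0" using C hi_pos conv_const_pos by (simp add: \<delta>0_def)
  show ?thesis
  proof (intro exI[of _ \<delta>0] conjI \<delta>0 allI impI)
    fix \<delta> and V0 :: "real \<Rightarrow> real"
    assume \<delta>: "0 < \<delta> \<and> \<delta> < \<delta>0"
      and V0: "V0 \<in> borel_measurable borel \<and> (\<forall>x. 0 \<le> V0 x \<and> V0 x \<le> \<delta> * G \<gamma> x)"
    then have V0m: "V0 \<in> borel_measurable borel" and V0_nn: "\<And>x. 0 \<le> V0 x" by auto
    have V0_le: "V0 y \<le> (\<delta> * hi) * K \<gamma> y" for y
    proof -
      have "V0 y \<le> \<delta> * G \<gamma> y" using V0 by blast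
      also have "\<dots> \<le> \<delta> * (hi * K \<gamma> y)" using \<delta> G_le[of \<gamma> y] assms by (intro mult_left_mono) auto
      finally show ?thesis by simp
    qed
    have dh: "\<delta> * hi * conv_const \<le> C / 2"
      using \<delta> hi_pos conv_const_pos by (simp add: \<delta>0_def field_simps)
    define p where "p = 1 + \<eta>"
    define v where "v = picard V0 p"
    define h where "h n s y = v n s y powr p" for n s y
    have v_Suc: "v (Suc n) t x = (if 0 < t then enn2real (lin_term V0 t x + duhamel (h n) t x) else 0)" for n t x
      by (simp add: v_def h_def[abs_def])
    have v_nn: "0 \<le> v n t x" for n t x by (cases n) (auto simp: v_def)
    \<comment> \<open>The value 0 at nonpositive times lets monotonicity and convergence of the
      iterates hold for all real t, without case distinctions in the integrands.\<close>
    have v_le0: "v n t x = 0" if "t \<le> 0" for n t x using that by (cases n) (auto simp: v_def)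
    have v_meas: "(\<lambda>(s, y). v n s y) \<in> borel_measurable borel" for n
      unfolding v_def by (rule picard_measurable[OF V0m])
    then have h_meas: "(\<lambda>(s, y). h n s y) \<in> borel_measurable borel" for n
      unfolding h_def by (simp add: case_prod_beta')
    have lin: "lin_term V0 t x \<le> ennreal (C / 2 * K (t + \<gamma>) x)" if "0 < t" for t x
    proof -
      have "lin_term V0 t x \<le> ennreal (\<delta> * hi * conv_const * K (t + \<gamma>) x)"
        using lin_term_le[OF that \<open>0 < \<gamma>\<close> _ V0_le] \<delta> hi_pos by auto
      also have "\<dots> \<le> ennreal (C / 2 * K (t + \<gamma>) x)"
        by (intro ennreal_leI mult_right_mono dh) simp
      finally show ?thesis .
    qed
    have duh: "duhamel f t x \<le> ennreal (C / 2 * K (t + \<gamma>) x)"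
      if "0 < t" "(\<lambda>(s, y). f s y) \<in> borel_measurable borel"
        "\<And>s y. 0 < s \<Longrightarrow> f s y \<le> C powr p * (s + \<gamma>) powr (- (\<theta> * \<eta>)) * K (s + \<gamma>) y" for f t x
    proof -
      have "duhamel f t x \<le> ennreal (C powr p * J * conv_const * K (t + \<gamma>) x)"
        unfolding J_def
        by (rule duhamel_le[OF that(2) \<open>0 < \<gamma>\<close> \<open>1 < \<theta> * \<eta>\<close> _ that(1) that(3)]) simp_all
      also have "C powr p * J * conv_const = C / 2" using C_eq by (simp add: p_def)
      finally show ?thesis .
    qed
    have sum_le: "lin_term V0 t x + duhamel f t x \<le> ennreal (C * K (t + \<gamma>) x)"
      if "0 < t" "(\<lambda>(s, y). f s y) \<in> borel_measurable borel"
        "\<And>s y. 0 < s \<Longrightarrow> f s y \<le> C powr p * (s + \<gamma>) powr (- (\<theta> * \<eta>)) * K (s + \<gamma>) y" for f t x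
    proof -
      have "lin_term V0 t x + duhamel f t x \<le> ennreal (C / 2 * K (t + \<gamma>) x) + ennreal (C / 2 * K (t + \<gamma>) x)"
        using that by (intro add_mono lin duh)
      also have "\<dots> = ennreal (C * K (t + \<gamma>) x)"
        using C by (subst ennreal_plus[symmetric]) (auto simp: field_simps)
      finally show ?thesis .
    qed
    have hb: "f powr p \<le> C powr p * (s + \<gamma>) powr (- (\<theta> * \<eta>)) * K (s + \<gamma>) y"
      if "0 < s" "0 \<le> f" "f \<le> C * K (s + \<gamma>) y" for f s y
      unfolding p_def using powr_bound_K[OF that(2,3,1) \<open>0 < \<gamma>\<close> C \<open>0 < \<eta>\<close>] .
    have v_le: "v n t x \<le> C * K (t + \<gamma>) x" if "0 < t" for n t x
      using that
    proof (induction n arbitrary: t x)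
      case (Suc n)
      have "lin_term V0 t x + duhamel (h n) t x \<le> ennreal (C * K (t + \<gamma>) x)"
        by (intro sum_le Suc.prems h_meas) (auto simp: h_def intro!: hb v_nn Suc.IH)
      then show ?case
        using Suc.prems C by (simp add: v_Suc enn2real_leI)
    qed (use C in \<open>simp add: v_def\<close>)
    \<comment> \<open>The barrier excludes the value \<infinity>, which \<open>enn2real\<close> in
      the iteration would send to 0.\<close>
    have v_eq: "ennreal (v (Suc n) t x) = lin_term V0 t x + duhamel (h n) t x" if "0 < t" for n t x
    proof -
      have "lin_term V0 t x + duhamel (h n) t x \<le> ennreal (C * K (t + \<gamma>) x)"
        by (intro sum_le that h_meas) (auto simp: h_def intro!: hb v_nn v_le)
      also have "\<dots> < top" by simp
      finally show ?thesis using that by (simp add: v_Suc)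
    qed
    have p: "0 < p" using assms by (simp add: p_def)
    have v_mono: "v n t x \<le> v (Suc n) t x" for n t x
    proof (induction n arbitrary: t x)
      case 0
      then show ?case using v_nn[of "Suc 0"] by (simp add: v_def)
    next
      case (Suc n)
      show ?case
      proof (cases "0 < t")
        case True
        have "h n s y \<le> h (Suc n) s y" for s y
          unfolding h_def using Suc.IH v_nn p by (intro powr_mono2) auto
        then have "ennreal (v (Suc n) t x) \<le> ennreal (v (Suc (Suc n)) t x)"
          unfolding v_eq[OF True] by (intro add_left_mono duhamel_mono)
        then show ?thesis using v_nn by simp
      qed (simp add: v_le0)
    qed
    define V where "V t x = (SUP n. v n t x)" for t x
    have V_lim: "(\<lambda>n. v n t x) \<longlonglongrightarrow> V t x" for t x
      unfolding V_def
    proof (rule LIMSEQ_incseq_SUP)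
      show "incseq (\<lambda>n. v n t x)" by (intro incseq_SucI v_mono)
      show "bdd_above (range (\<lambda>n. v n t x))"
        using v_le[of t _ x] v_le0[of t _ x]
        by (intro bdd_aboveI2[where M="max 0 (C * K (t + \<gamma>) x)"]) (cases "0 < t", auto simp: le_max_iff_disj not_less)
    qed
    have V_nn: "0 \<le> V t x" for t x by (rule LIMSEQ_le_const[OF V_lim]) (use v_nn in auto)
    have V_le: "V t x \<le> C * K (t + \<gamma>) x" if "0 < t" for t x
      by (rule LIMSEQ_le_const2[OF V_lim]) (use v_le[OF that] in auto)
    have V_meas: "(\<lambda>(t, x). V t x) \<in> borel_measurable borel"
      using borel_measurable_LIMSEQ_real[of borel "\<lambda>n z. v n (fst z) (snd z)" "\<lambda>z. V (fst z) (snd z)"]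
        v_meas V_lim by (auto simp: case_prod_beta')
    define H where "H s y = V s y powr p" for s y
    have H_meas: "(\<lambda>(t, x). H t x) \<in> borel_measurable borel"
      unfolding H_def using V_meas by (simp add: case_prod_beta')
    have H_lim: "(\<lambda>n. h n s y) \<longlonglongrightarrow> H s y" for s y
      unfolding h_def H_def using p v_nn by (intro tendsto_powr' V_lim tendsto_const) auto
    have V_eq: "ennreal (V t x) = lin_term V0 t x + duhamel H t x" if "0 < t" for t x
    proof (rule LIMSEQ_unique)
      show "(\<lambda>n. ennreal (v (Suc n) t x)) \<longlonglongrightarrow> ennreal (V t x)"
        by (intro tendsto_ennrealI LIMSEQ_Suc V_lim)
      have "h n s y \<le> h (Suc n) s y" for n s y
        unfolding h_def using v_mono v_nn p by (intro powr_mono2) auto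
      then show "(\<lambda>n. ennreal (v (Suc n) t x)) \<longlonglongrightarrow> lin_term V0 t x + duhamel H t x"
        unfolding v_eq[OF that] by (intro tendsto_add tendsto_const duhamel_tendsto h_meas H_lim)
    qed
    have H_le: "H s y \<le> C powr p * (s + \<gamma>) powr (- (\<theta> * \<eta>)) * K (s + \<gamma>) y" if "0 < s" for s y
      unfolding H_def by (intro hb that V_nn V_le)
    have H_nn: "0 \<le> H s y" for s y by (simp add: H_def)
    \<comment> \<open>The shift by \<gamma> keeps the time factor bounded down to s = 0, so the mass
      of the nonlinearity is bounded uniformly in s, as the continuity of the Duhamel term
      demands.\<close>
    have H_int: "(\<integral>\<^sup>+ y. ennreal (H s y) \<partial>lborel) \<le> ennreal (C powr p * \<gamma> powr (- (\<theta> * \<eta>)) * (2 / a))"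
      if s: "0 < s" for s
    proof -
      have "H s y \<le> C powr p * \<gamma> powr (- (\<theta> * \<eta>)) * K (s + \<gamma>) y" for y
      proof -
        have "(s + \<gamma>) powr (- (\<theta> * \<eta>)) \<le> \<gamma> powr (- (\<theta> * \<eta>))"
          using s assms by (intro powr_mono2') auto
        then show ?thesis
          using H_le[OF s, of y] by (smt (verit, best) K_nonneg mult_left_mono mult_right_mono powr_ge_zero)
      qed
      then have "(\<integral>\<^sup>+ y. ennreal (H s y) \<partial>lborel)
          \<le> (\<integral>\<^sup>+ y. ennreal (C powr p * \<gamma> powr (- (\<theta> * \<eta>))) * ennreal (K (s + \<gamma>) y) \<partial>lborel)"
        by (intro nn_integral_mono) (auto simp: ennreal_mult[symmetric])
      also have "\<dots> = ennreal (C powr p * \<gamma> powr (- (\<theta> * \<eta>))) * (\<integral>\<^sup>+ y. ennreal (K (s + \<gamma>) y) \<partial>lborel)"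
        by (intro nn_integral_cmult) measurable
      also have "\<dots> \<le> ennreal (C powr p * \<gamma> powr (- (\<theta> * \<eta>))) * ennreal (2 / a)"
        using s assms by (intro mult_left_mono K_nn_integral_le) auto
      also have "\<dots> = ennreal (C powr p * \<gamma> powr (- (\<theta> * \<eta>)) * (2 / a))"
        using a_pos by (simp add: ennreal_mult[symmetric])
      finally show ?thesis .
    qed
    have fin: "lin_term V0 t x < \<infinity>" "duhamel H t x < \<infinity>" if t: "0 < t" for t x
      using lin[OF t, of x] duh[OF t H_meas H_le, of x] by (auto intro: le_less_trans)
    have "continuous_on ({0<..} \<times> UNIV) (\<lambda>z. (case z of (t, x) \<Rightarrow> enn2real (lin_term V0 t x)) +
        (case z of (t, x) \<Rightarrow> enn2real (duhamel H t x)))"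
      using \<delta> hi_pos a_pos
      by (intro continuous_on_add continuous_lin_term[OF V0m \<open>0 < \<gamma>\<close> _ V0_nn V0_le]
          continuous_duhamel[OF H_meas H_nn H_int] fin(2)) auto
    moreover have "V t x = enn2real (lin_term V0 t x) + enn2real (duhamel H t x)" if "0 < t" for t x
      using V_eq[OF that, of x] fin[OF that, of x] V_nn[of t x]
      by (metis enn2real_ennreal enn2real_plus infinity_ennreal_def)
    ultimately have V_cont: "continuous_on ({0<..} \<times> UNIV) (\<lambda>(t, x). V t x)"
      by (subst continuous_on_cong[OF refl]) auto
    have "V t x \<le> (C / lo) * G (t + \<gamma>) x" if "0 < t" for t x
    proof -
      have "lo * K (t + \<gamma>) x \<le> G (t + \<gamma>) x" using lower[of "t + \<gamma>" x] that assms by (simp add: K_def)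
      then have "C * K (t + \<gamma>) x \<le> (C / lo) * G (t + \<gamma>) x" using C lo_pos by (simp add: field_simps)
      then show ?thesis using V_le[OF that, of x] by linarith
    qed
    with V_meas V_cont V_nn V_eq show "\<exists>V C. (\<lambda>(t, x). V t x) \<in> borel_measurable borel \<and> (\<forall>t>0. \<forall>x. 0 \<le> V t x) \<and>
         (\<forall>t>0. \<forall>x. ennreal (V t x) = lin_term V0 t x + duhamel (\<lambda>s y. V s y powr (1 + \<eta>)) t x) \<and>
         (\<forall>t>0. \<forall>x. V t x \<le> C * G (t + \<gamma>) x) \<and>
         continuous_on ({0<..} \<times> UNIV) (\<lambda>(t, x). V t x)"
      unfolding H_def p_def by (intro exI[of _ V] exI[of _ "C / lo"]) auto
  qed
qed

end

section \<open>Cosine transforms\<close>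

text \<open>Used in both directions: it turns an even characteristic function into 2 pi times its
  density, and a jump density into the transform of its symmetrization. Hence no normalizing
  factor.\<close>

definition cos_transform :: "(real \<Rightarrow> real) \<Rightarrow> real \<Rightarrow> real" where
  "cos_transform \<phi> x = (\<integral>\<xi>. cos (\<xi> * x) * \<phi> \<xi> \<partial>lborel)"

lemma integrable_cos_mult:
  fixes \<phi> :: "real \<Rightarrow> real"
  assumes "integrable lborel \<phi>"
  shows "integrable lborel (\<lambda>\<xi>. cos (\<xi> * x) * \<phi> \<xi>)"
proof (rule Bochner_Integration.integrable_bound[OF assms])
  note borel_measurable_integrable[OF assms, measurable]
  show "(\<lambda>\<xi>. cos (\<xi> * x) * \<phi> \<xi>) \<in> borel_measurable lborel" by measurable
qed (auto simp: abs_mult intro!: mult_left_le_one_le)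

lemma abs_cos_transform_le:
  assumes "integrable lborel \<phi>"
  shows "\<bar>cos_transform \<phi> x\<bar> \<le> (\<integral>\<xi>. \<bar>\<phi> \<xi>\<bar> \<partial>lborel)"
  unfolding cos_transform_def
  by (intro integral_abs_bound_integral integrable_cos_mult assms integrable_abs)
     (auto simp: abs_mult intro!: mult_left_le_one_le)

lemma cos_transform_minus: "cos_transform \<phi> (- x) = cos_transform \<phi> x"
  by (simp add: cos_transform_def)

lemma continuous_cos_transform:
  assumes "integrable lborel \<phi>"
  shows "continuous_on UNIV (cos_transform \<phi>)"
  unfolding continuous_on_sequentially
proof safe
  fix z :: "nat \<Rightarrow> real" and x :: real assume z: "z \<longlonglongrightarrow> x"
  note borel_measurable_integrable[OF assms, measurable]
  show "(cos_transform \<phi> \<circ> z) \<longlonglongrightarrow> cos_transform \<phi> x"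
    unfolding cos_transform_def o_def
  proof (rule integral_dominated_convergence[where w="\<lambda>\<xi>. \<bar>\<phi> \<xi>\<bar>"])
    show "AE \<xi> in lborel. (\<lambda>n. cos (\<xi> * z n) * \<phi> \<xi>) \<longlonglongrightarrow> cos (\<xi> * x) * \<phi> \<xi>"
      using z by (intro AE_I2 tendsto_intros)
  qed (use assms in \<open>auto simp: abs_mult intro!: mult_left_le_one_le\<close>)
qed

lemma cos_transform_measurable:
  assumes "integrable lborel \<phi>"
  shows "cos_transform \<phi> \<in> borel_measurable borel"
  using continuous_cos_transform[OF assms] by (rule borel_measurable_continuous_onI)

lemma cos_transform_tendsto:
  assumes "\<And>\<xi>. (\<lambda>n. \<phi> n \<xi>) \<longlonglongrightarrow> \<psi> \<xi>" "integrable lborel w" "\<And>n \<xi>. \<bar>\<phi> n \<xi>\<bar> \<le> w \<xi>"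
    and [measurable]: "\<And>n. \<phi> n \<in> borel_measurable borel" "\<psi> \<in> borel_measurable borel"
  shows "(\<lambda>n. cos_transform (\<phi> n) x) \<longlonglongrightarrow> cos_transform \<psi> x"
  unfolding cos_transform_def
proof (rule integral_dominated_convergence[where w=w])
  show "AE \<xi> in lborel. (\<lambda>n. cos (\<xi> * x) * \<phi> n \<xi>) \<longlonglongrightarrow> cos (\<xi> * x) * \<psi> \<xi>"
    using assms by (intro AE_I2 tendsto_intros) auto
  show "AE \<xi> in lborel. norm (cos (\<xi> * x) * \<phi> n \<xi>) \<le> w \<xi>" for n
  proof (intro AE_I2)
    fix \<xi>
    have "\<bar>cos (\<xi> * x)\<bar> * \<bar>\<phi> n \<xi>\<bar> \<le> 1 * \<bar>\<phi> n \<xi>\<bar>" by (intro mult_right_mono) auto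
    then show "norm (cos (\<xi> * x) * \<phi> n \<xi>) \<le> w \<xi>" using assms(3)[of n \<xi>] by (simp add: abs_mult)
  qed
qed (use assms in auto)

lemma integrable_mult_bounded:
  fixes \<phi> f :: "real \<Rightarrow> real"
  assumes "integrable lborel \<phi>" "f \<in> borel_measurable borel" "\<And>x. \<bar>f x\<bar> \<le> B"
  shows "integrable lborel (\<lambda>x. \<phi> x * f x)"
proof (rule Bochner_Integration.integrable_bound)
  show "integrable lborel (\<lambda>x. B * \<bar>\<phi> x\<bar>)" using assms(1) by (intro integrable_mult_right integrable_abs)
  note borel_measurable_integrable[OF assms(1), measurable]
  show "(\<lambda>x. \<phi> x * f x) \<in> borel_measurable lborel" using assms(2) by measurable
  have "\<bar>\<phi> x\<bar> * \<bar>f x\<bar> \<le> B * \<bar>\<phi> x\<bar>" for x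
    using mult_right_mono[OF assms(3)[of x], of "\<bar>\<phi> x\<bar>"] by (simp add: mult.commute)
  moreover have "0 \<le> B" using assms(3)[of 0] by linarith
  ultimately show "AE x in lborel. norm (\<phi> x * f x) \<le> norm (B * \<bar>\<phi> x\<bar>)"
    by (auto simp: abs_mult)
qed

text \<open>Fubini and cos A cos B = (cos (A + B) + cos (A - B)) / 2. Averaging over x + y and x - y
  is convolution with the symmetrized \<open>n\<close>; only the integrability of \<open>n\<close>
  itself enters, not that of its transform.\<close>

lemma cos_transform_mult:
  assumes \<phi>: "integrable lborel \<phi>" and n: "integrable lborel n"
  shows "cos_transform (\<lambda>\<xi>. \<phi> \<xi> * cos_transform n \<xi>) x =
    (\<integral>y. n y * ((cos_transform \<phi> (x + y) + cos_transform \<phi> (x - y)) / 2) \<partial>lborel)"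
proof -
  note borel_measurable_integrable[OF \<phi>, measurable] borel_measurable_integrable[OF n, measurable]
  have "integrable (lborel \<Otimes>\<^sub>M lborel) (\<lambda>(\<xi>, y). \<phi> \<xi> * n y)"
  proof (rule lborel_pair.Fubini_integrable)
    show "integrable lborel (\<lambda>\<xi>. \<integral>y. norm (case (\<xi>, y) of (\<xi>, y) \<Rightarrow> \<phi> \<xi> * n y) \<partial>lborel)"
      using \<phi> n by (simp add: abs_mult)
    show "AE \<xi> in lborel. integrable lborel (\<lambda>y. case (\<xi>, y) of (\<xi>, y) \<Rightarrow> \<phi> \<xi> * n y)"
      using n by simp
  qed simp
  then have int: "integrable (lborel \<Otimes>\<^sub>M lborel) (\<lambda>(\<xi>, y). cos (\<xi> * x) * (\<phi> \<xi> * (cos (y * \<xi>) * n y)))"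
  proof (rule Bochner_Integration.integrable_bound)
    have "\<bar>cos (\<xi> * x)\<bar> * (\<bar>\<phi> \<xi>\<bar> * (\<bar>cos (y * \<xi>)\<bar> * \<bar>n y\<bar>)) \<le> 1 * (\<bar>\<phi> \<xi>\<bar> * (1 * \<bar>n y\<bar>))" for \<xi> y
      by (intro mult_mono) auto
    then show "AE z in lborel \<Otimes>\<^sub>M lborel. norm (case z of (\<xi>, y) \<Rightarrow> cos (\<xi> * x) * (\<phi> \<xi> * (cos (y * \<xi>) * n y)))
       \<le> norm (case z of (\<xi>, y) \<Rightarrow> \<phi> \<xi> * n y)"
      by (auto simp: abs_mult)
  qed simp
  have "cos_transform (\<lambda>\<xi>. \<phi> \<xi> * cos_transform n \<xi>) x
     = (\<integral>\<xi>. (\<integral>y. cos (\<xi> * x) * (\<phi> \<xi> * (cos (y * \<xi>) * n y)) \<partial>lborel) \<partial>lborel)"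
    unfolding cos_transform_def by simp
  also have "\<dots> = (\<integral>y. (\<integral>\<xi>. cos (\<xi> * x) * (\<phi> \<xi> * (cos (y * \<xi>) * n y)) \<partial>lborel) \<partial>lborel)"
    by (rule lborel_pair.Fubini_integral[OF int, symmetric])
  also have "\<dots> = (\<integral>y. n y * ((cos_transform \<phi> (x + y) + cos_transform \<phi> (x - y)) / 2) \<partial>lborel)"
  proof (intro Bochner_Integration.integral_cong refl)
    fix y
    have "(\<integral>\<xi>. cos (\<xi> * x) * (\<phi> \<xi> * (cos (y * \<xi>) * n y)) \<partial>lborel)
       = (\<integral>\<xi>. n y / 2 * (cos (\<xi> * (x + y)) * \<phi> \<xi> + cos (\<xi> * (x - y)) * \<phi> \<xi>) \<partial>lborel)"
      by (intro Bochner_Integration.integral_cong refl)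
         (simp add: algebra_simps cos_add cos_diff)
    also have "\<dots> = n y / 2 * (cos_transform \<phi> (x + y) + cos_transform \<phi> (x - y))"
      unfolding cos_transform_def
      by (subst integral_mult_right_zero, subst Bochner_Integration.integral_add)
         (auto intro!: integrable_cos_mult \<phi>)
    finally show "(\<integral>\<xi>. cos (\<xi> * x) * (\<phi> \<xi> * (cos (y * \<xi>) * n y)) \<partial>lborel)
       = n y * ((cos_transform \<phi> (x + y) + cos_transform \<phi> (x - y)) / 2)" by simp
  qed
  finally show ?thesis .
qed

lemma integrable_mult_cos_transform:
  assumes "integrable lborel \<phi>" "integrable lborel n"
  shows "integrable lborel (\<lambda>\<xi>. \<phi> \<xi> * cos_transform n \<xi>)"
  using integrable_mult_bounded[OF assms(1) cos_transform_measurable[OF assms(2)] abs_cos_transform_le[OF assms(2)]] .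

lemma cos_transform_mult_nonneg:
  assumes "integrable lborel \<phi>" "integrable lborel n" "\<And>y. 0 \<le> n y" "\<And>x. 0 \<le> cos_transform \<phi> x"
  shows "0 \<le> cos_transform (\<lambda>\<xi>. \<phi> \<xi> * cos_transform n \<xi>) x"
  unfolding cos_transform_mult[OF assms(1,2)] using assms(3,4) by (intro Bochner_Integration.integral_nonneg) auto

text \<open>The compound Poisson expansion: all terms of the exponential series have nonnegative
  transform, so the transform dominates that of the linear term.\<close>

lemma cos_transform_exp_ge:
  assumes \<phi>: "integrable lborel \<phi>" and n: "integrable lborel n" and n_nn: "\<And>y. 0 \<le> n y"
    and P: "\<And>x. 0 \<le> cos_transform \<phi> x"
  shows "cos_transform (\<lambda>\<xi>. \<phi> \<xi> * cos_transform n \<xi>) x \<le>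
    cos_transform (\<lambda>\<xi>. \<phi> \<xi> * exp (cos_transform n \<xi>)) x"
proof -
  define N where "N = (\<integral>y. \<bar>n y\<bar> \<partial>lborel)"
  have nb: "\<bar>cos_transform n \<xi>\<bar> \<le> N" for \<xi> unfolding N_def by (rule abs_cos_transform_le[OF n])
  note borel_measurable_integrable[OF \<phi>, measurable] cos_transform_measurable[OF n, measurable]
  have pow: "integrable lborel (\<lambda>\<xi>. \<phi> \<xi> * cos_transform n \<xi> ^ k) \<and>
      (\<forall>x. 0 \<le> cos_transform (\<lambda>\<xi>. \<phi> \<xi> * cos_transform n \<xi> ^ k) x)" for k
  proof (induction k)
    case (Suc k)
    then show ?case
      using integrable_mult_cos_transform[OF conjunct1[OF Suc] n]
        cos_transform_mult_nonneg[OF conjunct1[OF Suc] n n_nn]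
      by (simp add: mult_ac)
  qed (use \<phi> P in simp)
  define S where "S m \<xi> = (\<Sum>k<m. cos_transform n \<xi> ^ k /\<^sub>R fact k)" for m \<xi>
  have S_lim: "(\<lambda>m. S m \<xi>) \<longlonglongrightarrow> exp (cos_transform n \<xi>)" for \<xi>
    using exp_converges[of "cos_transform n \<xi>"] unfolding S_def sums_def by simp
  have S_bd: "\<bar>S m \<xi>\<bar> \<le> exp N" for m \<xi>
  proof -
    have "\<bar>S m \<xi>\<bar> \<le> (\<Sum>k<m. \<bar>cos_transform n \<xi> ^ k /\<^sub>R fact k\<bar>)" unfolding S_def by (rule sum_abs)
    also have "\<dots> = (\<Sum>k<m. \<bar>cos_transform n \<xi>\<bar> ^ k /\<^sub>R fact k)" by (simp add: abs_mult power_abs)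
    also have "\<dots> \<le> exp \<bar>cos_transform n \<xi>\<bar>"
      unfolding exp_def by (intro sum_le_suminf summable_exp_generic) auto
    also have "\<dots> \<le> exp N" using nb by simp
    finally show ?thesis .
  qed
  have [measurable]: "S m \<in> borel_measurable borel" for m unfolding S_def by measurable
  have "(\<lambda>m. cos_transform (\<lambda>\<xi>. \<phi> \<xi> * S m \<xi>) x) \<longlonglongrightarrow> cos_transform (\<lambda>\<xi>. \<phi> \<xi> * exp (cos_transform n \<xi>)) x"
  proof (rule cos_transform_tendsto[where w="\<lambda>\<xi>. \<bar>\<phi> \<xi>\<bar> * exp N"])
    show "(\<lambda>m. \<phi> \<xi> * S m \<xi>) \<longlonglongrightarrow> \<phi> \<xi> * exp (cos_transform n \<xi>)" for \<xi>
      by (intro tendsto_intros S_lim)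
    show "integrable lborel (\<lambda>\<xi>. \<bar>\<phi> \<xi>\<bar> * exp N)" using \<phi> by auto
    show "\<bar>\<phi> \<xi> * S m \<xi>\<bar> \<le> \<bar>\<phi> \<xi>\<bar> * exp N" for m \<xi>
      using S_bd by (auto simp: abs_mult intro: mult_left_mono)
  qed auto
  moreover have "cos_transform (\<lambda>\<xi>. \<phi> \<xi> * cos_transform n \<xi>) x \<le> cos_transform (\<lambda>\<xi>. \<phi> \<xi> * S m \<xi>) x"
    if m: "2 \<le> m" for m
  proof -
    let ?T = "\<lambda>k. cos_transform (\<lambda>\<xi>. \<phi> \<xi> * cos_transform n \<xi> ^ k) x / fact k"
    have "cos_transform (\<lambda>\<xi>. \<phi> \<xi> * S m \<xi>) x
       = (\<integral>\<xi>. (\<Sum>k<m. (cos (\<xi> * x) * (\<phi> \<xi> * cos_transform n \<xi> ^ k)) / fact k) \<partial>lborel)"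
      unfolding S_def cos_transform_def[of "\<lambda>\<xi>. \<phi> \<xi> * _ \<xi>"]
      by (intro Bochner_Integration.integral_cong refl) (simp add: sum_distrib_left divide_inverse mult_ac)
    also have "\<dots> = (\<Sum>k<m. ?T k)"
      unfolding cos_transform_def[of "\<lambda>\<xi>. \<phi> \<xi> * cos_transform n \<xi> ^ _"]
      using pow by (subst Bochner_Integration.integral_sum) (auto intro!: integrable_cos_mult)
    \<comment> \<open>Only the term k = 1 is kept; m \<ge> 2 guarantees that the partial sum
      contains it.\<close>
    also have "\<dots> \<ge> (\<Sum>k\<in>{1}. ?T k)"
      using m pow by (intro sum_mono2) auto
    finally show ?thesis by simp
  qed
  ultimately show ?thesis by (intro LIMSEQ_le_const) auto
qed

lemma integral_eq_2_half_line:
  fixes f :: "real \<Rightarrow> real"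
  assumes int: "integrable lborel f" and even: "\<And>x. f (- x) = f x"
  shows "(\<integral>x. f x \<partial>lborel) = 2 * (LINT x:{0..}|lborel. f x)"
proof -
  note borel_measurable_integrable[OF int, measurable]
  have i: "integrable lborel (\<lambda>x. indicator {0..} x * f x)" "integrable lborel (\<lambda>x. indicator {..0} x * f x)"
    using int by (auto intro!: integrable_real_mult_indicator simp: mult.commute[of "indicator _ _"])
  have "AE x in lborel. x \<noteq> (0::real)" by (rule AE_lborel_singleton)
  then have "(\<integral>x. f x \<partial>lborel) = (\<integral>x. indicator {0..} x * f x + indicator {..0} x * f x \<partial>lborel)"
    by (intro integral_cong_AE) (auto elim!: eventually_mono simp: indicator_def)
  also have "\<dots> = (\<integral>x. indicator {0..} x * f x \<partial>lborel) + (\<integral>x. indicator {..0} x * f x \<partial>lborel)"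
    using i by (rule Bochner_Integration.integral_add)
  also have "(\<integral>x. indicator {..0} x * f x \<partial>lborel) = (\<integral>x. indicator {0..} x * f x \<partial>lborel)"
    by (subst lborel_integral_real_affine[where c="-1" and t=0])
       (auto intro!: Bochner_Integration.integral_cong simp: even indicator_def)
  finally show ?thesis by (simp add: set_lebesgue_integral_def)
qed

text \<open>Leads to compact intervals, where the fundamental theorem of calculus applies.\<close>

lemma cos_transform_limit:
  assumes int: "integrable lborel \<phi>" and even: "\<And>x. \<phi> (- x) = \<phi> x"
  shows "((\<lambda>N. 2 * integral {0..N} (\<lambda>\<xi>. cos (\<xi> * x) * \<phi> \<xi>)) \<longlongrightarrow> cos_transform \<phi> x) at_top"
proof -
  let ?f = "\<lambda>\<xi>. cos (\<xi> * x) * \<phi> \<xi>"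
  have i: "set_integrable lborel {0..} ?f" "set_integrable lborel {0..N} ?f" for N
    using integrable_cos_mult[OF int] unfolding set_integrable_def by (auto intro!: integrable_mult_indicator simp del: real_scaleR_def)
  have "((\<lambda>N. LINT \<xi>:{0..N}|lborel. ?f \<xi>) \<longlongrightarrow> (LINT \<xi>:{0..}|lborel. ?f \<xi>)) at_top"
    using i(1) by (intro tendsto_set_lebesgue_integral_at_top) auto
  then have "((\<lambda>N. integral {0..N} ?f) \<longlongrightarrow> (LINT \<xi>:{0..}|lborel. ?f \<xi>)) at_top"
    using set_borel_integral_eq_integral(2)[OF i(2)] by simp
  moreover have "cos_transform \<phi> x = 2 * (LINT \<xi>:{0..}|lborel. ?f \<xi>)"
    unfolding cos_transform_def
    by (rule integral_eq_2_half_line[OF integrable_cos_mult[OF int]]) (simp add: even)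
  ultimately show ?thesis by (auto intro: tendsto_intros)
qed

lemma integrable_exp_abs:
  fixes \<epsilon> :: real assumes "0 < \<epsilon>"
  shows "integrable lborel (\<lambda>\<xi>. exp (- (\<epsilon> * \<bar>\<xi>\<bar>)))"
proof (rule integrableI_nonneg)
  let ?f = "\<lambda>\<xi>. exp (- (\<epsilon> * \<xi>))"
  have half: "(\<integral>\<^sup>+ x. ennreal (?f x) * indicator {0..} x \<partial>lborel) = ennreal (0 - (- (?f 0 / \<epsilon>)))"
  proof (rule nn_integral_FTC_atLeast)
    show "((\<lambda>x. - (?f x / \<epsilon>)) has_real_derivative ?f x) (at x)" for x
      using assms by (auto intro!: derivative_eq_intros)
    have "filterlim (\<lambda>x. \<epsilon> * x) at_top at_top"
      using assms by (intro filterlim_tendsto_pos_mult_at_top[OF tendsto_const] filterlim_ident)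
    then have "filterlim (\<lambda>x. - (\<epsilon> * x)) at_bot at_top" by (simp add: filterlim_uminus_at_bot)
    then have "(?f \<longlongrightarrow> 0) at_top" by (rule filterlim_compose[OF exp_at_bot])
    then have "((\<lambda>x. - (?f x / \<epsilon>)) \<longlongrightarrow> - (0 / \<epsilon>)) at_top" using assms by (intro tendsto_intros) auto
    then show "((\<lambda>x. - (?f x / \<epsilon>)) \<longlongrightarrow> 0) at_top" by simp
  qed auto
  have half': "(\<integral>\<^sup>+ x. ennreal (?f (-x)) * indicator {0..} (-x) \<partial>lborel) = ennreal (0 - (- (?f 0 / \<epsilon>)))"
    using half nn_integral_real_affine[of "\<lambda>x. ennreal (?f x) * indicator {0..} x" "-1" 0] by simp
  have "(\<integral>\<^sup>+ x. ennreal (exp (- (\<epsilon> * \<bar>x\<bar>))) \<partial>lborel) \<le>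
      (\<integral>\<^sup>+ x. ennreal (?f x) * indicator {0..} x + ennreal (?f (-x)) * indicator {0..} (-x) \<partial>lborel)"
    by (intro nn_integral_mono) (auto simp: indicator_def abs_if)
  also have "\<dots> < \<infinity>"
    by (subst nn_integral_add) (use half half' in auto)
  finally show "(\<integral>\<^sup>+ x. ennreal (exp (- (\<epsilon> * \<bar>x\<bar>))) \<partial>lborel) < \<infinity>" .
qed auto

text \<open>An explicit antiderivative gives 2 \<epsilon> / (\<epsilon>^2 + x^2), the Cauchy density
  up to a factor. It will regularize symbols that are not integrable without losing the sign of the
  transform.\<close>

lemma cos_transform_exp_abs_nonneg:
  fixes \<epsilon> :: real assumes \<epsilon>: "0 < \<epsilon>"
  shows "0 \<le> cos_transform (\<lambda>\<xi>. exp (- (\<epsilon> * \<bar>\<xi>\<bar>))) x"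
proof -
  define D where "D = \<epsilon>\<^sup>2 + x\<^sup>2"
  have D: "0 < D" using \<epsilon> by (simp add: D_def add_pos_nonneg)
  define F where "F \<xi> = inverse D * (exp (- (\<epsilon> * \<xi>)) * (x * sin (\<xi> * x) - \<epsilon> * cos (\<xi> * x)))" for \<xi>
  have F_deriv: "(F has_real_derivative cos (\<xi> * x) * exp (- (\<epsilon> * \<xi>))) (at \<xi>)" for \<xi>
  proof -
    have "(F has_real_derivative inverse D * (exp (- (\<epsilon> * \<xi>)) * (cos (\<xi> * x) * (\<epsilon>\<^sup>2 + x\<^sup>2)))) (at \<xi>)"
      unfolding F_def using D by (auto intro!: derivative_eq_intros simp: algebra_simps power2_eq_square)
    moreover have "inverse D * (exp (- (\<epsilon> * \<xi>)) * (cos (\<xi> * x) * (\<epsilon>\<^sup>2 + x\<^sup>2))) = cos (\<xi> * x) * exp (- (\<epsilon> * \<xi>))"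
      using D unfolding D_def[symmetric] by (simp add: field_simps)
    ultimately show ?thesis by simp
  qed
  have I: "integral {0..N} (\<lambda>\<xi>. cos (\<xi> * x) * exp (- (\<epsilon> * \<bar>\<xi>\<bar>))) = F N - F 0" if "0 \<le> N" for N
  proof (rule integral_unique, rule has_integral_eq)
    show "((\<lambda>\<xi>. cos (\<xi> * x) * exp (- (\<epsilon> * \<xi>))) has_integral F N - F 0) {0..N}"
      using that F_deriv
      by (intro fundamental_theorem_of_calculus)
         (auto simp: has_real_derivative_iff_has_vector_derivative[symmetric] intro: has_field_derivative_at_within)
  qed auto
  have "filterlim (\<lambda>x. \<epsilon> * x) at_top at_top"
    using \<epsilon> by (intro filterlim_tendsto_pos_mult_at_top[OF tendsto_const] filterlim_ident)
  then have "filterlim (\<lambda>x. - (\<epsilon> * x)) at_bot at_top" by (simp add: filterlim_uminus_at_bot)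
  then have "((\<lambda>N. exp (- (\<epsilon> * N))) \<longlongrightarrow> 0) at_top" by (rule filterlim_compose[OF exp_at_bot])
  then have z: "((\<lambda>N. exp (- (\<epsilon> * N)) * ((\<bar>x\<bar> + \<epsilon>) / D)) \<longlongrightarrow> 0) at_top" by (intro tendsto_mult_left_zero)
  have F0: "(F \<longlongrightarrow> 0) at_top"
  proof (rule Lim_null_comparison[OF always_eventually z], rule allI)
    fix N
    have "\<bar>x * sin (N * x)\<bar> \<le> \<bar>x\<bar>" "\<bar>\<epsilon> * cos (N * x)\<bar> \<le> \<epsilon>"
      using \<epsilon> by (auto simp: abs_mult intro!: mult_left_le)
    then have "\<bar>x * sin (N * x) - \<epsilon> * cos (N * x)\<bar> \<le> \<bar>x\<bar> + \<epsilon>" by linarith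
    then show "norm (F N) \<le> exp (- (\<epsilon> * N)) * ((\<bar>x\<bar> + \<epsilon>) / D)"
      using D by (simp add: F_def abs_mult divide_right_mono divide_inverse)
  qed
  have "((\<lambda>N. 2 * (F N - F 0)) \<longlongrightarrow> 2 * (0 - F 0)) at_top" by (intro tendsto_intros F0)
  moreover have "\<forall>\<^sub>F N in at_top. 2 * integral {0..N} (\<lambda>\<xi>. cos (\<xi> * x) * exp (- (\<epsilon> * \<bar>\<xi>\<bar>))) = 2 * (F N - F 0)"
    using eventually_ge_at_top[of 0] by eventually_elim (simp add: I)
  ultimately have "((\<lambda>N. 2 * integral {0..N} (\<lambda>\<xi>. cos (\<xi> * x) * exp (- (\<epsilon> * \<bar>\<xi>\<bar>)))) \<longlongrightarrow> 2 * (0 - F 0)) at_top"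
    by (simp add: tendsto_cong)
  then have "cos_transform (\<lambda>\<xi>. exp (- (\<epsilon> * \<bar>\<xi>\<bar>))) x = 2 * (0 - F 0)"
    using cos_transform_limit[OF integrable_exp_abs[OF \<epsilon>]] by (intro tendsto_unique[OF trivial_limit_at_top_linorder]) auto
  also have "\<dots> \<ge> 0" using \<epsilon> D by (simp add: F_def)
  finally show ?thesis .
qed

section \<open>Upper bound for the stable density\<close>

definition stable_char :: "real \<Rightarrow> real \<Rightarrow> real" where
  "stable_char \<alpha> \<xi> = exp (- (\<bar>\<xi>\<bar> powr \<alpha>))"

lemma stable_char_minus: "stable_char \<alpha> (- \<xi>) = stable_char \<alpha> \<xi>"
  by (simp add: stable_char_def)

lemma stable_char_measurable [measurable]: "stable_char \<alpha> \<in> borel_measurable borel"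
  unfolding stable_char_def by measurable

lemma integrable_stable_char:
  assumes "1 \<le> \<alpha>"
  shows "integrable lborel (stable_char \<alpha>)"
proof (rule Bochner_Integration.integrable_bound)
  show "integrable lborel (\<lambda>\<xi>::real. exp 1 * exp (- (1 * \<bar>\<xi>\<bar>)))"
    using integrable_exp_abs[of 1] by (intro integrable_mult_right) simp
  have "stable_char \<alpha> \<xi> \<le> exp 1 * exp (- (1 * \<bar>\<xi>\<bar>))" for \<xi>
  proof -
    have "\<bar>\<xi>\<bar> \<le> 1 + \<bar>\<xi>\<bar> powr \<alpha>"
    proof (cases "1 \<le> \<bar>\<xi>\<bar>")
      case True
      then have "\<bar>\<xi>\<bar> powr 1 \<le> \<bar>\<xi>\<bar> powr \<alpha>" using assms by (intro powr_mono) auto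
      then show ?thesis using True by simp
    qed (use powr_ge_zero[of "\<bar>\<xi>\<bar>" \<alpha>] in linarith)
    then show ?thesis unfolding stable_char_def exp_add[symmetric] by simp
  qed
  then show "AE \<xi> in lborel. norm (stable_char \<alpha> \<xi>) \<le> norm (exp 1 * exp (- (1 * \<bar>\<xi>\<bar>)))"
    by (auto simp: stable_char_def)
qed simp

lemma mult_exp_minus_le:
  fixes y :: real assumes "0 \<le> y"
  shows "y * exp (- y) \<le> 1" "y\<^sup>2 * exp (- y) \<le> 2"
proof -
  have "1 + y + y\<^sup>2 / 2 \<le> exp y" using exp_lower_Taylor_quadratic[OF assms] .
  then have "y \<le> exp y" "y\<^sup>2 \<le> 2 * exp y" using assms zero_le_power2[of y] by linarith+
  then show "y * exp (- y) \<le> 1" "y\<^sup>2 * exp (- y) \<le> 2" by (auto simp: exp_minus field_simps)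
qed

section \<open>Derivatives of the characteristic function on the half line\<close>

context
  fixes \<alpha> :: real
  assumes \<alpha>: "1 < \<alpha>" "\<alpha> < 2"
begin

definition char_d0 :: "real \<Rightarrow> real" where "char_d0 \<xi> = exp (- (\<xi> powr \<alpha>))"
definition char_d1 :: "real \<Rightarrow> real" where "char_d1 \<xi> = - \<alpha> * \<xi> powr (\<alpha> - 1) * char_d0 \<xi>"
definition char_d2 :: "real \<Rightarrow> real" where
  "char_d2 \<xi> = (\<alpha>\<^sup>2 * (\<xi> powr (\<alpha> - 1))\<^sup>2 - \<alpha> * (\<alpha> - 1) * \<xi> powr (\<alpha> - 2)) * char_d0 \<xi>"
definition char_d3 :: "real \<Rightarrow> real" where
  "char_d3 \<xi> = (- \<alpha> * (\<alpha> - 1) * (\<alpha> - 2) * \<xi> powr (\<alpha> - 3)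
    + 3 * \<alpha>\<^sup>2 * (\<alpha> - 1) * (\<xi> powr (\<alpha> - 1) * \<xi> powr (\<alpha> - 2))
    - \<alpha> ^ 3 * (\<xi> powr (\<alpha> - 1)) ^ 3) * char_d0 \<xi>"

lemma char_derivs:
  assumes "0 < \<xi>"
  shows "(char_d0 has_real_derivative char_d1 \<xi>) (at \<xi>)" "(char_d1 has_real_derivative char_d2 \<xi>) (at \<xi>)"
    "(char_d2 has_real_derivative char_d3 \<xi>) (at \<xi>)"
proof -
  show 0: "(char_d0 has_real_derivative char_d1 \<xi>) (at \<xi>)"
    unfolding char_d0_def[abs_def] char_d1_def using assms
    by (auto intro!: derivative_eq_intros simp: char_d0_def)
  have p: "((\<lambda>\<xi>. \<xi> powr r) has_real_derivative r * \<xi> powr (r - 1)) (at \<xi>)" for r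
    using assms by (auto intro!: derivative_eq_intros)
  have e: "\<alpha> - 1 - 1 = \<alpha> - 2" "\<alpha> - 2 - 1 = \<alpha> - 3" by auto
  note p1 = p[of "\<alpha> - 1", unfolded e] and p2 = p[of "\<alpha> - 2", unfolded e]
  show "(char_d1 has_real_derivative char_d2 \<xi>) (at \<xi>)"
    unfolding char_d1_def[abs_def] char_d2_def
    by (rule DERIV_cong, (rule 0 p1 derivative_intros)+)
       (simp add: char_d1_def algebra_simps power2_eq_square)
  show "(char_d2 has_real_derivative char_d3 \<xi>) (at \<xi>)"
    unfolding char_d2_def[abs_def] char_d3_def
    by (rule DERIV_cong, (rule 0 p1 p2 derivative_intros)+)
       (simp add: char_d1_def algebra_simps power2_eq_square power3_eq_cube)
qed

text \<open>After the singular power of \<xi> is factored out, what remains is a polynomial in y =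
  \<xi>^\<alpha> times exp (- y), with coefficients bounded through \<alpha> < 2: 6 = 4 + 2 and 30 =
  2 + 12 + 16. Near 0 the first bound is integrable, the second is not.\<close>

lemma char_deriv_bounds:
  assumes "0 < \<xi>"
  shows "\<bar>char_d2 \<xi>\<bar> \<le> 6 * \<xi> powr (\<alpha> - 2)" "\<bar>char_d3 \<xi>\<bar> \<le> 30 * \<xi> powr (\<alpha> - 3)"
proof -
  define y where "y = \<xi> powr \<alpha>"
  have y: "0 \<le> y" "y * exp (- y) \<le> 1" "y\<^sup>2 * exp (- y) \<le> 2" "exp (- y) \<le> 1"
    using mult_exp_minus_le[of y] by (auto simp: y_def)
  have p1: "\<xi> powr (\<alpha> - 1) = \<xi> powr (\<alpha> - 3) * \<xi>\<^sup>2" "\<xi> powr (\<alpha> - 2) = \<xi> powr (\<alpha> - 3) * \<xi>"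
     "y = \<xi> powr (\<alpha> - 3) * \<xi> ^ 3"
    using assms by (simp_all add: y_def powr_diff power2_eq_square field_simps powr_numeral power3_eq_cube)
  define z where "z = \<xi> powr (\<alpha> - 3)"
  have z: "0 \<le> z" by (simp add: z_def)
  have e2: "char_d2 \<xi> = \<xi> powr (\<alpha> - 2) * (\<alpha>\<^sup>2 * (y * exp (- y)) - \<alpha> * (\<alpha> - 1) * exp (- y))"
    unfolding char_d2_def char_d0_def y_def[symmetric] p1 by (simp add: algebra_simps power2_eq_square power3_eq_cube)
  have e3: "char_d3 \<xi> = \<xi> powr (\<alpha> - 3) * (\<alpha> * (\<alpha> - 1) * (2 - \<alpha>) * exp (- y)
       + 3 * \<alpha>\<^sup>2 * (\<alpha> - 1) * (y * exp (- y)) - \<alpha> ^ 3 * (y\<^sup>2 * exp (- y)))"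
    unfolding char_d3_def char_d0_def y_def[symmetric] p1 z_def[symmetric]
    by (simp add: algebra_simps power2_eq_square power3_eq_cube)
  have a2: "\<alpha>\<^sup>2 \<le> 4" "\<alpha> ^ 3 \<le> 8" "0 \<le> \<alpha>\<^sup>2" "0 \<le> \<alpha> ^ 3"
    using \<alpha> power_mono[of \<alpha> 2 2] power_mono[of \<alpha> 2 3] by auto
  have a11: "\<alpha> * (\<alpha> - 1) \<le> 2 * 1" using \<alpha> by (intro mult_mono) auto
  have t1: "0 \<le> \<alpha>\<^sup>2 * (y * exp (- y))" "\<alpha>\<^sup>2 * (y * exp (- y)) \<le> 4 * 1"
    using mult_mono[OF a2(1) y(2)] y by auto
  have t2: "0 \<le> \<alpha> * (\<alpha> - 1) * exp (- y)" "\<alpha> * (\<alpha> - 1) * exp (- y) \<le> (2 * 1) * 1"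
    using \<alpha> mult_mono[OF a11 y(4)] by simp_all
  have "\<bar>\<alpha>\<^sup>2 * (y * exp (- y)) - \<alpha> * (\<alpha> - 1) * exp (- y)\<bar> \<le> 6" using t1 t2 by linarith
  then show "\<bar>char_d2 \<xi>\<bar> \<le> 6 * \<xi> powr (\<alpha> - 2)"
    unfolding e2 abs_mult mult.commute[of 6 "\<xi> powr (\<alpha> - 2)"] by (rule mult_mono[rotated]) auto
  have t3: "0 \<le> \<alpha> * (\<alpha> - 1) * (2 - \<alpha>) * exp (- y)" "\<alpha> * (\<alpha> - 1) * (2 - \<alpha>) * exp (- y) \<le> (2 * 1) * 1 * 1"
    using \<alpha> mult_mono[OF mult_mono[OF a11, of "2 - \<alpha>" 1] y(4)] by simp_all
  have t4: "0 \<le> 3 * \<alpha>\<^sup>2 * (\<alpha> - 1) * (y * exp (- y))"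
    using y \<alpha> by simp
  have t4': "3 * \<alpha>\<^sup>2 * (\<alpha> - 1) * (y * exp (- y)) \<le> (3 * 4) * 1 * 1"
    by (intro mult_mono) (use y \<alpha> a2 in auto)
  have t5: "0 \<le> \<alpha> ^ 3 * (y\<^sup>2 * exp (- y))" "\<alpha> ^ 3 * (y\<^sup>2 * exp (- y)) \<le> 8 * 2"
    using mult_mono[OF a2(2) y(3)] y a2 by auto
  have "\<bar>\<alpha> * (\<alpha> - 1) * (2 - \<alpha>) * exp (- y)
       + 3 * \<alpha>\<^sup>2 * (\<alpha> - 1) * (y * exp (- y)) - \<alpha> ^ 3 * (y\<^sup>2 * exp (- y))\<bar> \<le> 30" using t3 t4 t4' t5 by linarith
  then show "\<bar>char_d3 \<xi>\<bar> \<le> 30 * \<xi> powr (\<alpha> - 3)"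
    unfolding e3 abs_mult mult.commute[of 30 "\<xi> powr (\<alpha> - 3)"] by (rule mult_mono[rotated]) auto
qed

lemma char_derivs_tendsto_0: "(char_d0 \<longlongrightarrow> 0) at_top" "(char_d1 \<longlongrightarrow> 0) at_top" "(char_d2 \<longlongrightarrow> 0) at_top"
proof -
  have y: "filterlim (\<lambda>\<xi>. \<xi> powr \<alpha>) at_top at_top"
  proof (rule filterlim_at_top_mono[OF filterlim_ident])
    show "\<forall>\<^sub>F \<xi> in at_top. \<xi> \<le> \<xi> powr \<alpha>"
      using eventually_ge_at_top[of 1]
    proof eventually_elim
      case (elim \<xi>)
      then have "\<xi> powr 1 \<le> \<xi> powr \<alpha>" using \<alpha> by (intro powr_mono) auto
      then show ?case using elim by simp
    qed
  qed
  show char_d0: "(char_d0 \<longlongrightarrow> 0) at_top"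
    unfolding char_d0_def[abs_def] using y
    by (intro filterlim_compose[OF exp_at_bot]) (simp add: filterlim_uminus_at_bot)
  have z: "((\<lambda>\<xi>. r * \<xi> powr p) \<longlongrightarrow> r * 0) at_top" if "p < 0" for p r :: real
    using that by (intro tendsto_intros tendsto_neg_powr filterlim_ident)
  have b1: "\<bar>char_d1 \<xi>\<bar> \<le> 2 * \<xi> powr (- 1)" if "0 < \<xi>" for \<xi>
  proof -
    define y where "y = \<xi> powr \<alpha>"
    have "\<bar>char_d1 \<xi>\<bar> = \<alpha> * (\<xi> powr (- 1) * (y * exp (- y)))"
      using that \<alpha> by (simp add: char_d1_def char_d0_def y_def powr_diff powr_minus abs_mult field_simps)
    also have "\<dots> \<le> 2 * (\<xi> powr (- 1) * 1)"
      using \<alpha> mult_exp_minus_le[of y] by (intro mult_mono mult_left_mono) (auto simp: y_def)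
    finally show ?thesis by simp
  qed
  show "(char_d1 \<longlongrightarrow> 0) at_top"
  proof (rule Lim_null_comparison)
    show "\<forall>\<^sub>F \<xi> in at_top. norm (char_d1 \<xi>) \<le> 2 * \<xi> powr (- 1)"
      unfolding real_norm_def by (rule eventually_mono[OF eventually_gt_at_top b1])
  qed (use z[of "-1" 2] in simp)
  show "(char_d2 \<longlongrightarrow> 0) at_top"
  proof (rule Lim_null_comparison)
    show "\<forall>\<^sub>F \<xi> in at_top. norm (char_d2 \<xi>) \<le> 6 * \<xi> powr (\<alpha> - 2)"
      unfolding real_norm_def by (rule eventually_mono[OF eventually_gt_at_top char_deriv_bounds(1)])
  qed (use z[of "\<alpha> - 2" 6] \<alpha> in simp)
qed

text \<open>The first antiderivative integrates by parts twice and is used on \<open>[0, 1/x]\<close>; the second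
  one integrates by parts three times and is used on \<open>[1/x, \<infinity>)\<close>, away from the singularity of the
  third derivative of the characteristic function.\<close>

lemma stable_integral_bound:
  assumes x: "0 < x" and N: "1 / x \<le> N"
  shows "\<bar>integral {0..N} (\<lambda>\<xi>. cos (\<xi> * x) * char_d0 \<xi>)\<bar> \<le>
    (6 + 6 / (\<alpha> - 1) + 30 / (2 - \<alpha>)) * x powr (-1 - \<alpha>) +
    (\<bar>char_d0 N\<bar> / x + \<bar>char_d1 N\<bar> / x\<^sup>2 + \<bar>char_d2 N\<bar> / x ^ 3)"
proof -
  \<comment> \<open>The cut is placed where the phase \<xi> * x has size one; both remainders then
    scale like x^(-1 - \<alpha>), as \<open>hp\<close> records.\<close>
  define h where "h = 1 / x"
  have h: "0 < h" "h \<le> N" using x N by (auto simp: h_def)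
  define F where "F \<xi> = sin (\<xi> * x) / x * char_d0 \<xi> + cos (\<xi> * x) / x\<^sup>2 * char_d1 \<xi>" for \<xi>
  define H where "H \<xi> = F \<xi> - sin (\<xi> * x) / x ^ 3 * char_d2 \<xi>" for \<xi>
  have trig: "((\<lambda>\<xi>. sin (\<xi> * x) / c) has_real_derivative cos (\<xi> * x) * x / c) (at \<xi>)"
    "((\<lambda>\<xi>. cos (\<xi> * x) / c) has_real_derivative - sin (\<xi> * x) * x / c) (at \<xi>)" for \<xi> c
    by (cases "c = 0"; auto intro!: derivative_eq_intros)+
  have F_deriv: "(F has_real_derivative cos (\<xi> * x) * char_d0 \<xi> + cos (\<xi> * x) / x\<^sup>2 * char_d2 \<xi>) (at \<xi>)" if "0 < \<xi>" for \<xi>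
    unfolding F_def[abs_def]
    by (rule DERIV_cong, (rule trig char_derivs[OF that] DERIV_add DERIV_mult)+)
       (use x in \<open>simp add: field_simps power2_eq_square\<close>)
  have H_deriv: "(H has_real_derivative cos (\<xi> * x) * char_d0 \<xi> - sin (\<xi> * x) / x ^ 3 * char_d3 \<xi>) (at \<xi>)" if "0 < \<xi>" for \<xi>
    unfolding H_def[abs_def]
    by (rule DERIV_cong, (rule trig char_derivs[OF that] F_deriv[OF that] DERIV_diff DERIV_mult)+)
       (use x in \<open>simp add: field_simps power2_eq_square power3_eq_cube\<close>)
  have cont_d0: "continuous_on {0..b} char_d0" for b
    unfolding char_d0_def[abs_def] using \<alpha> by (intro continuous_intros continuous_on_powr') auto
  have cont_d1: "continuous_on {0..b} char_d1" for b
    unfolding char_d1_def[abs_def] using \<alpha> by (intro continuous_intros continuous_on_powr' cont_d0) auto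
  have cd0: "(\<lambda>\<xi>. cos (\<xi> * x) * char_d0 \<xi>) integrable_on {0..b}" for b
    by (intro integrable_continuous_interval continuous_intros cont_d0)
  have F_cont: "continuous_on {0..b} F" for b
    unfolding F_def[abs_def] using x by (intro continuous_intros cont_d0 cont_d1) auto
  have F_int: "((\<lambda>\<xi>. cos (\<xi> * x) * char_d0 \<xi> + cos (\<xi> * x) / x\<^sup>2 * char_d2 \<xi>) has_integral F h - F 0) {0..h}"
    using h F_deriv F_cont
    by (intro fundamental_theorem_of_calculus_interior)
       (auto simp: has_real_derivative_iff_has_vector_derivative[symmetric])
  have H_cont: "continuous_on {h..N} H"
    using h by (intro continuous_at_imp_continuous_on ballI DERIV_isCont[OF H_deriv]) auto
  have H_int: "((\<lambda>\<xi>. cos (\<xi> * x) * char_d0 \<xi> - sin (\<xi> * x) / x ^ 3 * char_d3 \<xi>) has_integral H N - H h) {h..N}"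
    using h H_deriv H_cont
    by (intro fundamental_theorem_of_calculus_interior)
       (auto simp: has_real_derivative_iff_has_vector_derivative[symmetric])
  \<comment> \<open>No boundary term at the origin: the sine vanishes, and so does the first
    derivative, which extends continuously by 0 because \<alpha> > 1.\<close>
  have F0: "F 0 = 0" using \<alpha> by (simp add: F_def char_d1_def)
  let ?r1 = "\<lambda>\<xi>. cos (\<xi> * x) / x\<^sup>2 * char_d2 \<xi>" and ?r2 = "\<lambda>\<xi>. sin (\<xi> * x) / x ^ 3 * char_d3 \<xi>"
  have r1: "(?r1 has_integral F h - F 0 - integral {0..h} (\<lambda>\<xi>. cos (\<xi> * x) * char_d0 \<xi>)) {0..h}"
    using has_integral_diff[OF F_int integrable_integral[OF cd0]] by simp
  have cdh: "(\<lambda>\<xi>. cos (\<xi> * x) * char_d0 \<xi>) integrable_on {h..N}"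
    using h by (intro integrable_continuous_interval continuous_intros continuous_on_subset[OF cont_d0[of N]]) auto
  have r2: "(?r2 has_integral integral {h..N} (\<lambda>\<xi>. cos (\<xi> * x) * char_d0 \<xi>) - (H N - H h)) {h..N}"
    using has_integral_diff[OF integrable_integral[OF cdh] H_int] by simp
  have i1: "((\<lambda>\<xi>. 6 / x\<^sup>2 * \<xi> powr (\<alpha> - 2)) has_integral 6 / x\<^sup>2 * (h powr (\<alpha> - 2 + 1) / (\<alpha> - 2 + 1))) {0..h}"
    using \<alpha> h by (intro has_integral_mult_right has_integral_powr_from_0) auto
  have b1: "\<bar>integral {0..h} ?r1\<bar> \<le> 6 / x\<^sup>2 * (h powr (\<alpha> - 1) / (\<alpha> - 1))"
  proof -
    have "norm (integral {0..h} ?r1) \<le> integral {0..h} (\<lambda>\<xi>. 6 / x\<^sup>2 * \<xi> powr (\<alpha> - 2))"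
    proof (intro Henstock_Kurzweil_Integration.integral_norm_bound_integral)
      fix \<xi> assume "\<xi> \<in> {0..h}"
      have "\<bar>cos (\<xi> * x)\<bar> * \<bar>char_d2 \<xi>\<bar> \<le> 1 * (6 * \<xi> powr (\<alpha> - 2))"
      \<comment> \<open>At the singular point both sides are 0, since
        \<open>0 powr r = 0\<close>.\<close>
      proof (cases "\<xi> = 0")
        case False
        then show ?thesis using \<open>\<xi> \<in> {0..h}\<close> char_deriv_bounds(1)[of \<xi>] by (intro mult_mono) auto
      qed (use \<alpha> in \<open>simp add: char_d2_def\<close>)
      then show "norm (?r1 \<xi>) \<le> 6 / x\<^sup>2 * \<xi> powr (\<alpha> - 2)"
        using x by (simp add: abs_mult divide_right_mono)
    qed (use r1 i1 in \<open>auto intro: has_integral_integrable\<close>)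
    then show ?thesis using integral_unique[OF i1] by simp
  qed
  have i2: "((\<lambda>\<xi>. 30 / x ^ 3 * \<xi> powr (\<alpha> - 3)) has_integral
      (30 / x ^ 3 * (N powr (\<alpha> - 2) / (\<alpha> - 2)) - 30 / x ^ 3 * (h powr (\<alpha> - 2) / (\<alpha> - 2)))) {h..N}"
  proof (intro fundamental_theorem_of_calculus h)
    fix \<xi> assume "\<xi> \<in> {h..N}"
    then have \<xi>: "0 < \<xi>" using h by auto
    have "((\<lambda>\<xi>. 30 / x ^ 3 * (\<xi> powr (\<alpha> - 2) / (\<alpha> - 2))) has_real_derivative
        30 / x ^ 3 * ((\<alpha> - 2) * \<xi> powr (\<alpha> - 2 - 1) / (\<alpha> - 2))) (at \<xi>)"
      using \<xi> \<alpha> by (intro DERIV_cmult DERIV_cdivide has_real_derivative_powr)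
    then have "((\<lambda>\<xi>. 30 / x ^ 3 * (\<xi> powr (\<alpha> - 2) / (\<alpha> - 2))) has_real_derivative
        30 / x ^ 3 * \<xi> powr (\<alpha> - 3)) (at \<xi>)" using \<alpha> by simp
    then show "((\<lambda>\<xi>. 30 / x ^ 3 * (\<xi> powr (\<alpha> - 2) / (\<alpha> - 2))) has_vector_derivative
        30 / x ^ 3 * \<xi> powr (\<alpha> - 3)) (at \<xi> within {h..N})"
      by (simp add: has_real_derivative_iff_has_vector_derivative has_vector_derivative_at_within)
  qed
  have b2: "\<bar>integral {h..N} ?r2\<bar> \<le> 30 / x ^ 3 * (h powr (\<alpha> - 2) / (2 - \<alpha>))"
  proof -
    have "norm (integral {h..N} ?r2) \<le> integral {h..N} (\<lambda>\<xi>. 30 / x ^ 3 * \<xi> powr (\<alpha> - 3))"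
    proof (intro Henstock_Kurzweil_Integration.integral_norm_bound_integral)
      fix \<xi> assume "\<xi> \<in> {h..N}"
      then have "\<bar>sin (\<xi> * x)\<bar> * \<bar>char_d3 \<xi>\<bar> \<le> 1 * (30 * \<xi> powr (\<alpha> - 3))"
        using h char_deriv_bounds(2)[of \<xi>] by (intro mult_mono) auto
      then show "norm (?r2 \<xi>) \<le> 30 / x ^ 3 * \<xi> powr (\<alpha> - 3)"
        using x by (simp add: abs_mult divide_right_mono)
    qed (use r2 i2 in \<open>auto intro: has_integral_integrable\<close>)
    also have "\<dots> = 30 / x ^ 3 * ((h powr (\<alpha> - 2) - N powr (\<alpha> - 2)) / (2 - \<alpha>))"
      using integral_unique[OF i2] \<alpha> x by (simp add: divide_simps) (simp add: algebra_simps)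
    also have "\<dots> \<le> 30 / x ^ 3 * (h powr (\<alpha> - 2) / (2 - \<alpha>))"
      using \<alpha> x by (intro mult_left_mono divide_right_mono) auto
    finally show ?thesis by simp
  qed
  have split: "integral {0..N} (\<lambda>\<xi>. cos (\<xi> * x) * char_d0 \<xi>) =
      integral {0..h} (\<lambda>\<xi>. cos (\<xi> * x) * char_d0 \<xi>) + integral {h..N} (\<lambda>\<xi>. cos (\<xi> * x) * char_d0 \<xi>)"
    using h cd0 by (intro Henstock_Kurzweil_Integration.integral_combine[symmetric]) auto
  have eq: "integral {0..N} (\<lambda>\<xi>. cos (\<xi> * x) * char_d0 \<xi>) =
      (F h - H h) + H N - integral {0..h} ?r1 + integral {h..N} ?r2"
    unfolding split using integral_unique[OF r1] integral_unique[OF r2] F0 by linarith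
  \<comment> \<open>The two antiderivatives differ at h by the third boundary term, which has the
    same order as the remainders.\<close>
  have b3: "\<bar>F h - H h\<bar> \<le> 6 / x ^ 3 * h powr (\<alpha> - 2)"
  proof -
    have "\<bar>sin (h * x)\<bar> * \<bar>char_d2 h\<bar> \<le> 1 * (6 * h powr (\<alpha> - 2))"
      using char_deriv_bounds(1)[OF h(1)] by (intro mult_mono) auto
    then show ?thesis using x by (simp add: H_def abs_mult divide_right_mono)
  qed
  have b4: "\<bar>H N\<bar> \<le> \<bar>char_d0 N\<bar> / x + \<bar>char_d1 N\<bar> / x\<^sup>2 + \<bar>char_d2 N\<bar> / x ^ 3"
  proof -
    have "\<bar>sin (N * x) / x * char_d0 N\<bar> \<le> \<bar>char_d0 N\<bar> / x" "\<bar>cos (N * x) / x\<^sup>2 * char_d1 N\<bar> \<le> \<bar>char_d1 N\<bar> / x\<^sup>2"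
      "\<bar>sin (N * x) / x ^ 3 * char_d2 N\<bar> \<le> \<bar>char_d2 N\<bar> / x ^ 3"
      using x by (auto simp: abs_mult intro!: divide_right_mono mult_left_le_one_le)
    then show ?thesis unfolding H_def F_def by linarith
  qed
  have hp: "h powr (\<alpha> - 1) / x\<^sup>2 = x powr (-1 - \<alpha>)" "h powr (\<alpha> - 2) / x ^ 3 = x powr (-1 - \<alpha>)"
    using x by (simp_all add: h_def powr_divide powr_diff powr_minus field_simps power2_eq_square power3_eq_cube powr_numeral)
  have "6 / x\<^sup>2 * (P / (\<alpha> - 1)) = 6 / (\<alpha> - 1) * (P / x\<^sup>2)"
     "30 / x ^ 3 * (P / (2 - \<alpha>)) = 30 / (2 - \<alpha>) * (P / x ^ 3)"
     "6 / x ^ 3 * P = 6 * (P / x ^ 3)" for P by simp_all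
  note b123 = b1[unfolded this hp] b2[unfolded this hp] b3[unfolded this hp]
  show ?thesis using b123 b4 unfolding eq distrib_right by linarith
qed

text \<open>The boundary terms disappear as N tends to infinity; the factor 2 accounts for the
  negative half line.\<close>

lemma stable_tail_upper:
  assumes x: "0 < x"
  shows "\<bar>cos_transform (stable_char \<alpha>) x\<bar> \<le> 2 * (6 + 6 / (\<alpha> - 1) + 30 / (2 - \<alpha>)) * x powr (-1 - \<alpha>)"
proof (rule tendsto_le[OF trivial_limit_at_top_linorder])
  let ?c = "(6 + 6 / (\<alpha> - 1) + 30 / (2 - \<alpha>)) * x powr (-1 - \<alpha>)"
  show "((\<lambda>N. \<bar>2 * integral {0..N} (\<lambda>\<xi>. cos (\<xi> * x) * stable_char \<alpha> \<xi>)\<bar>) \<longlongrightarrow> \<bar>cos_transform (stable_char \<alpha>) x\<bar>) at_top"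
    using \<alpha> by (intro tendsto_rabs cos_transform_limit integrable_stable_char stable_char_minus) auto
  have "((\<lambda>N. 2 * (?c + (\<bar>char_d0 N\<bar> / x + \<bar>char_d1 N\<bar> / x\<^sup>2 + \<bar>char_d2 N\<bar> / x ^ 3))) \<longlongrightarrow>
      2 * (?c + (\<bar>0\<bar> / x + \<bar>0\<bar> / x\<^sup>2 + \<bar>0\<bar> / x ^ 3))) at_top"
    using x by (intro tendsto_intros char_derivs_tendsto_0) auto
  then show "((\<lambda>N. 2 * (?c + (\<bar>char_d0 N\<bar> / x + \<bar>char_d1 N\<bar> / x\<^sup>2 + \<bar>char_d2 N\<bar> / x ^ 3))) \<longlongrightarrow>
      2 * (6 + 6 / (\<alpha> - 1) + 30 / (2 - \<alpha>)) * x powr (-1 - \<alpha>)) at_top"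
    by (simp only: abs_zero div_0 add_0_right mult.assoc)
  have "integral {0..N} (\<lambda>\<xi>. cos (\<xi> * x) * stable_char \<alpha> \<xi>) = integral {0..N} (\<lambda>\<xi>. cos (\<xi> * x) * char_d0 \<xi>)" for N
    by (intro Henstock_Kurzweil_Integration.integral_cong) (auto simp: stable_char_def char_d0_def)
  then have "\<bar>2 * integral {0..N} (\<lambda>\<xi>. cos (\<xi> * x) * stable_char \<alpha> \<xi>)\<bar> \<le>
      2 * (?c + (\<bar>char_d0 N\<bar> / x + \<bar>char_d1 N\<bar> / x\<^sup>2 + \<bar>char_d2 N\<bar> / x ^ 3))" if "1 / x \<le> N" for N
    unfolding abs_mult abs_numeral by (simp only: mult_left_mono stable_integral_bound[OF x that] zero_le_numeral)
  then show "\<forall>\<^sub>F N in at_top. \<bar>2 * integral {0..N} (\<lambda>\<xi>. cos (\<xi> * x) * stable_char \<alpha> \<xi>)\<bar> \<le>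
      2 * (?c + (\<bar>char_d0 N\<bar> / x + \<bar>char_d1 N\<bar> / x\<^sup>2 + \<bar>char_d2 N\<bar> / x ^ 3))"
    by (rule eventually_mono[OF eventually_ge_at_top])
qed

end

section \<open>Lower bound for the stable density\<close>

lemma integrable_powr_near_0:
  fixes p c :: real
  assumes "-1 < p" "0 \<le> c"
  shows "integrable lborel (\<lambda>y. indicator {0..c} y * y powr p)"
proof (rule integrableI_nonneg)
  have "(\<integral>\<^sup>+ y. ennreal (indicator {0..c} y * y powr p) \<partial>lborel) = (\<integral>\<^sup>+ y. ennreal (y powr p) * indicator {0..c} y \<partial>lborel)"
    by (intro nn_integral_cong) (auto simp: indicator_def)
  also have "\<dots> = ennreal (c powr (p + 1) / (p + 1))"
    by (intro nn_integral_has_integral_lebesgue' has_integral_powr_from_0 assms) auto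
  finally show "(\<integral>\<^sup>+ y. ennreal (indicator {0..c} y * y powr p) \<partial>lborel) < \<infinity>" by simp
qed auto

lemma integrable_powr_tail:
  fixes p c :: real
  assumes "p < -1" "0 < c"
  shows "integrable lborel (\<lambda>y. indicator {c..} y * y powr p)"
proof (rule integrableI_nonneg)
  have "(\<integral>\<^sup>+ y. ennreal (indicator {c..} y * y powr p) \<partial>lborel) = (\<integral>\<^sup>+ y. ennreal (y powr p) * indicator {c..} y \<partial>lborel)"
    by (intro nn_integral_cong) (auto simp: indicator_def)
  also have "\<dots> = ennreal (- (c powr (p + 1)) / (p + 1))"
    by (intro nn_integral_has_integral_lebesgue' has_integral_powr_to_inf assms) auto
  finally show "(\<integral>\<^sup>+ y. ennreal (indicator {c..} y * y powr p) \<partial>lborel) < \<infinity>" by simp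
qed auto

lemma one_minus_cos_le: "1 - cos y \<le> y\<^sup>2 / 2" for y :: real
proof -
  have "1 - cos y = 2 * (sin (y / 2))\<^sup>2" using cos_double_sin[of "y / 2"] by simp
  also have "\<bar>sin (y / 2)\<bar>\<^sup>2 \<le> \<bar>y / 2\<bar>\<^sup>2" by (intro power_mono abs_sin_x_le_abs_x) auto
  then have "2 * (sin (y / 2))\<^sup>2 \<le> y\<^sup>2 / 2" by (simp add: power_divide)
  finally show ?thesis .
qed

text \<open>The right side is the exponent of the compound Poisson law with jump density
  \<open>n\<close>. Writing it as a difference of transforms makes the exponential series
  available.\<close>

lemma cos_transform_compensator:
  assumes n: "integrable lborel n"
  shows "cos_transform n 0 - cos_transform n \<xi> = (\<integral>y. (1 - cos (y * \<xi>)) * n y \<partial>lborel)"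
proof -
  have "(\<integral>y. (1 - cos (y * \<xi>)) * n y \<partial>lborel) = (\<integral>y. n y - cos (y * \<xi>) * n y \<partial>lborel)"
    by (simp add: algebra_simps)
  also have "\<dots> = (\<integral>y. n y \<partial>lborel) - (\<integral>y. cos (y * \<xi>) * n y \<partial>lborel)"
    by (intro Bochner_Integration.integral_diff n integrable_cos_mult)
  finally show ?thesis by (simp add: cos_transform_def)
qed

section \<open>Levy measure of the stable law\<close>

context
  fixes \<alpha> :: real
  assumes \<alpha>: "1 < \<alpha>" "\<alpha> < 2"
begin

text \<open>Integrand of the Levy-Khintchine exponent. As 1 - cos is even, both signs of jumps can
  be folded onto y > 0.\<close>

definition levy :: "real \<Rightarrow> real \<Rightarrow> real" where
  "levy \<xi> y = (1 - cos (y * \<xi>)) * y powr (-1 - \<alpha>)"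

lemma levy_measurable [measurable]: "levy \<xi> \<in> borel_measurable borel"
  unfolding levy_def by measurable

lemma levy_nonneg: "0 \<le> levy \<xi> y"
  by (simp add: levy_def)

text \<open>Near 0 the bound 1 - cos z \<le> z^2 / 2 leaves y^(1 - \<alpha>), integrable for
  \<alpha> < 2; for large y the bound 1 - cos z \<le> 2 suffices.\<close>

lemma integrable_levy: "integrable lborel (\<lambda>y. indicator {0<..} y * levy \<xi> y)"
proof (rule Bochner_Integration.integrable_bound)
  let ?w = "\<lambda>y. \<xi>\<^sup>2 / 2 * (indicator {0..1} y * y powr (1 - \<alpha>)) + 2 * (indicator {1..} y * y powr (-1 - \<alpha>))"
  show "integrable lborel ?w"
    using \<alpha> by (intro Bochner_Integration.integrable_add integrable_mult_right integrable_powr_near_0 integrable_powr_tail) auto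
  have "indicator {0<..} y * levy \<xi> y \<le> ?w y" for y
  proof (cases "0 < y")
    case True
    have "levy \<xi> y \<le> (y * \<xi>)\<^sup>2 / 2 * y powr (-1 - \<alpha>)"
      unfolding levy_def by (intro mult_right_mono one_minus_cos_le) auto
    also have "\<dots> = \<xi>\<^sup>2 / 2 * y powr (1 - \<alpha>)"
      using True by (simp add: powr_diff powr_minus power2_eq_square field_simps)
    finally have 1: "levy \<xi> y \<le> \<xi>\<^sup>2 / 2 * y powr (1 - \<alpha>)" .
    have "1 - cos (y * \<xi>) \<le> 2" using cos_ge_minus_one[of "y * \<xi>"] by linarith
    then have 2: "levy \<xi> y \<le> 2 * y powr (-1 - \<alpha>)"
      unfolding levy_def by (intro mult_right_mono) auto
    show ?thesis
    proof (cases "y \<le> 1")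
      case True
      then show ?thesis using 1 \<open>0 < y\<close> by (auto simp: indicator_def intro: order_trans)
    next
      case False
      then show ?thesis using 2 \<open>0 < y\<close> by (auto simp: indicator_def)
    qed
  qed (auto simp: indicator_def)
  then show "AE y in lborel. norm (indicator {0<..} y * levy \<xi> y) \<le> norm (?w y)"
    using levy_nonneg by (auto simp: abs_mult intro!: AE_I2 order_trans[OF _ abs_ge_self])
qed simp

definition levy_const :: real where
  "levy_const = (\<integral>y. indicator {0<..} y * levy 1 y \<partial>lborel)"

lemma levy_const_pos: "0 < levy_const"
proof -
  \<comment> \<open>A lower bound of the integrand on [1, 2], an interval inside [0, pi] on which
    both the cosine and the power decrease.\<close>
  define c where "c = (1 - cos 1) * 2 powr (-1 - \<alpha>)"
  have "cos 1 < cos (0::real)" by (rule cos_monotone_0_pi) (use pi_gt3 in auto)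
  then have c: "0 < c" by (simp add: c_def)
  have "indicator {1..2} y * c \<le> indicator {0<..} y * levy 1 y" for y
  proof (cases "y \<in> {1..2}")
    case True
    then have "cos y \<le> cos 1" by (intro cos_monotone_0_pi_le) (use pi_gt3 in auto)
    then have "c \<le> levy 1 y"
      unfolding c_def levy_def using True \<alpha> by (intro mult_mono powr_mono2') auto
    then show ?thesis using True by simp
  qed (auto simp: levy_nonneg)
  then have "(\<integral>y. indicator {1..2::real} y * c \<partial>lborel) \<le> levy_const"
    unfolding levy_const_def by (intro Bochner_Integration.integral_mono integrable_levy) auto
  then show ?thesis using c by simp
qed

text \<open>Substituting |\<xi>| * y shows that the exponent is homogeneous of degree \<alpha>. This
  is the Levy-Khintchine formula for |\<xi>|^\<alpha>.\<close>

lemma levy_scaling: "(\<integral>y. indicator {0<..} y * levy \<xi> y \<partial>lborel) = levy_const * \<bar>\<xi>\<bar> powr \<alpha>"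
proof (cases "\<xi> = 0")
  case True
  then show ?thesis by (simp add: levy_def)
next
  case False
  define r where "r = \<bar>\<xi>\<bar>"
  have r: "0 < r" using False by (simp add: r_def)
  have "levy_const = r * (\<integral>y. indicator {0<..} (r * y) * levy 1 (r * y) \<partial>lborel)"
    unfolding levy_const_def using r
    by (subst lborel_integral_real_affine[where c=r and t=0]) auto
  also have "(\<integral>y. indicator {0<..} (r * y) * levy 1 (r * y) \<partial>lborel)
      = (\<integral>y. r powr (-1 - \<alpha>) * (indicator {0<..} y * levy \<xi> y) \<partial>lborel)"
  proof (intro Bochner_Integration.integral_cong refl)
    fix y
    have "cos (r * y) = cos (y * \<xi>)" by (auto simp: r_def abs_if mult.commute)
    then show "indicator {0<..} (r * y) * levy 1 (r * y) = r powr (-1 - \<alpha>) * (indicator {0<..} y * levy \<xi> y)"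
      using r by (auto simp: indicator_def levy_def powr_mult zero_less_mult_iff)
  qed
  finally have "levy_const = r powr (- \<alpha>) * (\<integral>y. indicator {0<..} y * levy \<xi> y \<partial>lborel)"
    using r by (simp add: powr_diff powr_minus field_simps)
  then show ?thesis using r by (simp add: r_def[symmetric] powr_minus field_simps)
qed

text \<open>Division by \<open>levy_const\<close> normalizes the full exponent to exactly
  |\<xi>|^\<alpha>. For h > 0 the total mass is finite, so these jumps form a compound Poisson
  process.\<close>

definition big_jumps :: "real \<Rightarrow> real \<Rightarrow> real" where
  "big_jumps h y = indicator {h<..} y * y powr (-1 - \<alpha>) / levy_const"

definition small_char :: "real \<Rightarrow> real \<Rightarrow> real" where
  "small_char h \<xi> = exp (- ((\<integral>y. indicator {0<..h} y * levy \<xi> y \<partial>lborel) / levy_const))"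

lemma big_jumps_nonneg: "0 \<le> big_jumps h y"
  using levy_const_pos by (simp add: big_jumps_def)

lemma integrable_big_jumps:
  assumes "0 < h" shows "integrable lborel (big_jumps h)"
proof (rule Bochner_Integration.integrable_bound)
  show "integrable lborel (\<lambda>y. indicator {h..} y * y powr (-1 - \<alpha>) / levy_const)"
    using assms \<alpha> by (intro Bochner_Integration.integrable_divide integrable_powr_tail) auto
  show "big_jumps h \<in> borel_measurable lborel" unfolding big_jumps_def by measurable
  show "AE y in lborel. norm (big_jumps h y) \<le> norm (indicator {h..} y * y powr (-1 - \<alpha>) / levy_const)"
    by (auto simp: big_jumps_def indicator_def)
qed

lemma integrable_levy_subset:
  assumes [measurable]: "S \<in> sets borel" and "S \<subseteq> {0<..}"
  shows "integrable lborel (\<lambda>y. indicator S y * levy \<xi> y)"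
proof (rule Bochner_Integration.integrable_bound[OF integrable_levy])
  show "AE y in lborel. norm (indicator S y * levy \<xi> y) \<le> norm (indicator {0<..} y * levy \<xi> y)"
    using assms by (auto simp: indicator_def intro!: AE_I2)
qed simp

lemma big_jumps_compensator:
  assumes "0 < h"
  shows "cos_transform (big_jumps h) 0 - cos_transform (big_jumps h) \<xi> =
    (\<integral>y. indicator {h<..} y * levy \<xi> y \<partial>lborel) / levy_const"
  unfolding cos_transform_compensator[OF integrable_big_jumps[OF assms]]
  by (subst integral_divide_zero[symmetric])
     (auto intro!: Bochner_Integration.integral_cong simp: big_jumps_def levy_def)

text \<open>The jumps of size at most \<open>h\<close> and those above are independent.\<close>

lemma stable_char_factor:
  assumes h: "0 < h"
  shows "stable_char \<alpha> \<xi> =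
    exp (- cos_transform (big_jumps h) 0) * (small_char h \<xi> * exp (cos_transform (big_jumps h) \<xi>))"
proof -
  have "(\<integral>y. indicator {0<..} y * levy \<xi> y \<partial>lborel) =
      (\<integral>y. indicator {0<..h} y * levy \<xi> y + indicator {h<..} y * levy \<xi> y \<partial>lborel)"
    using h by (intro Bochner_Integration.integral_cong refl) (auto simp: indicator_def)
  also have "\<dots> = (\<integral>y. indicator {0<..h} y * levy \<xi> y \<partial>lborel) + (\<integral>y. indicator {h<..} y * levy \<xi> y \<partial>lborel)"
    using h by (intro Bochner_Integration.integral_add integrable_levy_subset) auto
  finally have "\<bar>\<xi>\<bar> powr \<alpha> = (\<integral>y. indicator {0<..h} y * levy \<xi> y \<partial>lborel) / levy_const +
      (cos_transform (big_jumps h) 0 - cos_transform (big_jumps h) \<xi>)"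
    unfolding big_jumps_compensator[OF h] levy_scaling using levy_const_pos by (simp add: field_simps)
  then show ?thesis
    unfolding stable_char_def small_char_def exp_add[symmetric] by simp
qed

lemma small_char_measurable [measurable]: "small_char h \<in> borel_measurable borel"
  unfolding small_char_def levy_def by measurable

text \<open>Removing the big jumps can only lower the nonnegative exponent.\<close>

lemma small_char_ge: "0 < h \<Longrightarrow> stable_char \<alpha> \<xi> \<le> small_char h \<xi>"
proof -
  assume h: "0 < h"
  have "0 \<le> (\<integral>y. indicator {h<..} y * levy \<xi> y \<partial>lborel) / levy_const"
    using levy_const_pos by (intro divide_nonneg_pos Bochner_Integration.integral_nonneg) (auto simp: levy_nonneg)
  then have "cos_transform (big_jumps h) \<xi> - cos_transform (big_jumps h) 0 \<le> 0"
    using big_jumps_compensator[OF h, of \<xi>] by linarith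
  then have "exp (- cos_transform (big_jumps h) 0) * exp (cos_transform (big_jumps h) \<xi>) \<le> 1"
    unfolding exp_add[symmetric] by simp
  then show ?thesis unfolding stable_char_factor[OF h, of \<xi>]
    by (simp add: small_char_def mult.left_commute[of "exp (- cos_transform (big_jumps h) 0)"])
qed

text \<open>The big-jump factor is bounded below by exp (- 2 * mass), as each of its two transform
  values is at most the mass. Dividing by it thus costs only a constant against the integrable
  \<open>stable_char\<close>.\<close>

lemma integrable_small_char:
  assumes h: "0 < h" shows "integrable lborel (small_char h)"
proof (rule Bochner_Integration.integrable_bound)
  let ?\<Lambda> = "\<integral>y. \<bar>big_jumps h y\<bar> \<partial>lborel"
  show "integrable lborel (\<lambda>\<xi>. exp (2 * ?\<Lambda>) * stable_char \<alpha> \<xi>)"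
    using \<alpha> by (intro integrable_mult_right integrable_stable_char) auto
  have "small_char h \<xi> \<le> exp (2 * ?\<Lambda>) * stable_char \<alpha> \<xi>" for \<xi>
  proof -
    have "\<bar>cos_transform (big_jumps h) 0\<bar> \<le> ?\<Lambda>" "\<bar>cos_transform (big_jumps h) \<xi>\<bar> \<le> ?\<Lambda>"
      by (intro abs_cos_transform_le integrable_big_jumps h)+
    then have "0 \<le> 2 * ?\<Lambda> - cos_transform (big_jumps h) 0 + cos_transform (big_jumps h) \<xi>"
      by linarith
    then have "1 \<le> exp (2 * ?\<Lambda>) * (exp (- cos_transform (big_jumps h) 0) * exp (cos_transform (big_jumps h) \<xi>))"
      unfolding exp_add[symmetric] by simp
    then have "small_char h \<xi> * 1 \<le> small_char h \<xi> * (exp (2 * ?\<Lambda>) *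
        (exp (- cos_transform (big_jumps h) 0) * exp (cos_transform (big_jumps h) \<xi>)))"
      by (intro mult_left_mono) (auto simp: small_char_def)
    then show ?thesis unfolding stable_char_factor[OF h, of \<xi>] by (simp add: mult_ac)
  qed
  then show "AE \<xi> in lborel. norm (small_char h \<xi>) \<le> norm (exp (2 * ?\<Lambda>) * stable_char \<alpha> \<xi>)"
    by (auto simp: small_char_def stable_char_def)
qed simp

text \<open>The small jumps have infinite mass, so the exponential series cannot be applied to them
  directly. Jumps below e are discarded first, which leaves a compound Poisson symbol
  \<open>psi e\<close>; being bounded away from 0 it is not integrable, so it is multiplied by exp
  (- \<epsilon> |\<xi>|), whose transform is nonnegative. The limit e to 0 is dominated by this
  factor, the limit \<epsilon> to 0 by \<open>small_char h\<close> itself.\<close>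

lemma small_char_transform_nonneg:
  assumes h: "0 < h"
  shows "0 \<le> cos_transform (small_char h) x"
proof -
  define mid where "mid e y = indicator {e<..h} y * y powr (-1 - \<alpha>) / levy_const" for e y
  define psi where "psi e \<xi> = exp (- ((\<integral>y. indicator {e<..h} y * levy \<xi> y \<partial>lborel) / levy_const))" for e \<xi>
  have mid_nn: "0 \<le> mid e y" for e y using levy_const_pos by (simp add: mid_def)
  have [measurable]: "psi e \<in> borel_measurable borel" for e unfolding psi_def levy_def by measurable
  have mid_int: "integrable lborel (mid e)" if "0 < e" for e
  proof (rule Bochner_Integration.integrable_bound[OF integrable_big_jumps[OF that]])
    show "mid e \<in> borel_measurable lborel" unfolding mid_def by measurable
    show "AE y in lborel. norm (mid e y) \<le> norm (big_jumps e y)"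
      by (auto simp: mid_def big_jumps_def indicator_def)
  qed
  have psi_eq: "psi e \<xi> = exp (- cos_transform (mid e) 0) * exp (cos_transform (mid e) \<xi>)" if "0 < e" for e \<xi>
  proof -
    have "cos_transform (mid e) 0 - cos_transform (mid e) \<xi> = (\<integral>y. indicator {e<..h} y * levy \<xi> y \<partial>lborel) / levy_const"
      unfolding cos_transform_compensator[OF mid_int[OF that]]
      by (subst integral_divide_zero[symmetric])
         (auto intro!: Bochner_Integration.integral_cong simp: mid_def levy_def)
    then show ?thesis unfolding psi_def exp_add[symmetric] by simp
  qed
  have psi_le: "psi e \<xi> \<le> 1" for e \<xi>
    using levy_const_pos unfolding psi_def
    by (auto intro!: divide_nonneg_pos Bochner_Integration.integral_nonneg simp: levy_nonneg)
  let ?E = "\<lambda>\<epsilon> \<xi>. exp (- (\<epsilon> * \<bar>\<xi>\<bar>)) :: real"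
  have 1: "0 \<le> cos_transform (\<lambda>\<xi>. ?E \<epsilon> \<xi> * psi e \<xi>) x" if \<epsilon>: "0 < \<epsilon>" and e: "0 < e" for \<epsilon> e
  proof -
    have "0 \<le> cos_transform (\<lambda>\<xi>. ?E \<epsilon> \<xi> * cos_transform (mid e) \<xi>) x"
      by (intro cos_transform_mult_nonneg integrable_exp_abs mid_int mid_nn cos_transform_exp_abs_nonneg \<epsilon> e)
    also have "\<dots> \<le> cos_transform (\<lambda>\<xi>. ?E \<epsilon> \<xi> * exp (cos_transform (mid e) \<xi>)) x"
      by (intro cos_transform_exp_ge integrable_exp_abs mid_int mid_nn cos_transform_exp_abs_nonneg \<epsilon> e)
    finally have "0 \<le> exp (- cos_transform (mid e) 0) * cos_transform (\<lambda>\<xi>. ?E \<epsilon> \<xi> * exp (cos_transform (mid e) \<xi>)) x"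
      by simp
    also have "\<dots> = cos_transform (\<lambda>\<xi>. ?E \<epsilon> \<xi> * psi e \<xi>) x"
      unfolding cos_transform_def psi_eq[OF e] integral_mult_right_zero[symmetric]
      by (intro Bochner_Integration.integral_cong) (auto simp: mult_ac)
    finally show ?thesis .
  qed
  have e_lim: "(\<lambda>k. inverse (real (Suc k))) \<longlonglongrightarrow> 0" by (rule LIMSEQ_inverse_real_of_nat)
  have psi_lim: "(\<lambda>k. psi (inverse (real (Suc k))) \<xi>) \<longlonglongrightarrow> small_char h \<xi>" for \<xi>
  proof -
    have "(\<lambda>k. \<integral>y. indicator {inverse (real (Suc k))<..h} y * levy \<xi> y \<partial>lborel)
        \<longlonglongrightarrow> (\<integral>y. indicator {0<..h} y * levy \<xi> y \<partial>lborel)"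
    proof (rule integral_dominated_convergence[where w="\<lambda>y. indicator {0<..} y * levy \<xi> y"])
      have "(\<lambda>k. indicator {inverse (real (Suc k))<..h} y * levy \<xi> y) \<longlonglongrightarrow> indicator {0<..h} y * levy \<xi> y" for y
      proof (cases "0 < y")
        case True
        then have "\<forall>\<^sub>F k in sequentially. inverse (real (Suc k)) < y" using e_lim by (intro order_tendstoD)
        then have "\<forall>\<^sub>F k in sequentially. indicator {0<..h} y * levy \<xi> y = indicator {inverse (real (Suc k))<..h} y * levy \<xi> y"
          by eventually_elim (use True in \<open>auto simp: indicator_def\<close>)
        then show ?thesis by (rule Lim_transform_eventually[OF tendsto_const])
      next
        case False
        then have "\<not> inverse (real (Suc k)) < y" for k
          using inverse_positive_iff_positive[of "real (Suc k)"] by (smt (verit) of_nat_0_less_iff zero_less_Suc)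
        then show ?thesis using False by (auto simp: indicator_def)
      qed
      then show "AE y in lborel. (\<lambda>k. indicator {inverse (real (Suc k))<..h} y * levy \<xi> y) \<longlonglongrightarrow> indicator {0<..h} y * levy \<xi> y"
        by (intro AE_I2)
      show "AE y in lborel. norm (indicator {inverse (real (Suc k))<..h} y * levy \<xi> y) \<le> indicator {0<..} y * levy \<xi> y" for k
        by (intro AE_I2) (auto simp: indicator_def levy_nonneg intro: less_trans[rotated])
    qed (auto intro: integrable_levy)
    then show ?thesis unfolding psi_def small_char_def using levy_const_pos by (intro tendsto_intros) auto
  qed
  have 2: "0 \<le> cos_transform (\<lambda>\<xi>. ?E \<epsilon> \<xi> * small_char h \<xi>) x" if \<epsilon>: "0 < \<epsilon>" for \<epsilon>
  proof (rule LIMSEQ_le_const)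
    show "(\<lambda>k. cos_transform (\<lambda>\<xi>. ?E \<epsilon> \<xi> * psi (inverse (real (Suc k))) \<xi>) x)
        \<longlonglongrightarrow> cos_transform (\<lambda>\<xi>. ?E \<epsilon> \<xi> * small_char h \<xi>) x"
    proof (rule cos_transform_tendsto[OF _ integrable_exp_abs[OF \<epsilon>]])
      show "\<bar>?E \<epsilon> \<xi> * psi (inverse (real (Suc k))) \<xi>\<bar> \<le> ?E \<epsilon> \<xi>" for k \<xi>
        using psi_le by (simp add: abs_mult) (simp add: psi_def)
      show "(\<lambda>k. ?E \<epsilon> \<xi> * psi (inverse (real (Suc k))) \<xi>) \<longlonglongrightarrow> ?E \<epsilon> \<xi> * small_char h \<xi>" for \<xi>
        by (intro tendsto_mult tendsto_const psi_lim)
    qed auto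
    show "\<exists>N. \<forall>k\<ge>N. 0 \<le> cos_transform (\<lambda>\<xi>. ?E \<epsilon> \<xi> * psi (inverse (real (Suc k))) \<xi>) x"
      using 1[OF \<epsilon>] by auto
  qed
  show ?thesis
  proof (rule LIMSEQ_le_const)
    show "(\<lambda>k. cos_transform (\<lambda>\<xi>. ?E (inverse (real (Suc k))) \<xi> * small_char h \<xi>) x)
        \<longlonglongrightarrow> cos_transform (small_char h) x"
    proof (rule cos_transform_tendsto[OF _ integrable_small_char[OF h]])
      have "(\<lambda>k. ?E (inverse (real (Suc k))) \<xi> * small_char h \<xi>) \<longlonglongrightarrow> exp (- (0 * \<bar>\<xi>\<bar>)) * small_char h \<xi>" for \<xi>
        by (intro tendsto_intros e_lim)
      then show "(\<lambda>k. ?E (inverse (real (Suc k))) \<xi> * small_char h \<xi>) \<longlonglongrightarrow> small_char h \<xi>" for \<xi>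
        by simp
      show "\<bar>?E (inverse (real (Suc k))) \<xi> * small_char h \<xi>\<bar> \<le> small_char h \<xi>" for k \<xi>
        by (simp add: abs_mult small_char_def)
    qed auto
    show "\<exists>N. \<forall>k\<ge>N. 0 \<le> cos_transform (\<lambda>\<xi>. ?E (inverse (real (Suc k))) \<xi> * small_char h \<xi>) x"
      using 2 by auto
  qed
qed

text \<open>At 0 the transform is the integral of \<phi>, which is at least exp (-1) by restriction
  to [0, 1]; continuity does the rest.\<close>

lemma cos_transform_pos_near_0:
  assumes int: "integrable lborel \<phi>" and ge: "\<And>\<xi>. stable_char \<alpha> \<xi> \<le> \<phi> \<xi>"
  shows "\<exists>r m. 0 < r \<and> 0 < m \<and> (\<forall>x. \<bar>x\<bar> \<le> r \<longrightarrow> m \<le> cos_transform \<phi> x)"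
proof -
  have "indicator {0..1} \<xi> * exp (-1) \<le> stable_char \<alpha> \<xi>" for \<xi>
    using \<alpha> powr_mono2[of \<alpha> \<xi> 1] by (auto simp: indicator_def stable_char_def)
  then have "(\<integral>\<xi>. indicator {0..1::real} \<xi> * exp (-1) \<partial>lborel) \<le> (\<integral>\<xi>. \<phi> \<xi> \<partial>lborel)"
    using ge int by (intro Bochner_Integration.integral_mono) (auto intro: order_trans)
  then have pos: "exp (-1) \<le> cos_transform \<phi> 0" by (simp add: cos_transform_def)
  define m where "m = cos_transform \<phi> 0 / 2"
  have m: "0 < m" "m < cos_transform \<phi> 0" using pos exp_gt_zero[of "-1::real"] unfolding m_def by linarith+
  have "isCont (cos_transform \<phi>) 0"
    using continuous_cos_transform[OF int] by (simp add: continuous_on_eq_continuous_at)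
  then have "cos_transform \<phi> \<midarrow>0\<rightarrow> cos_transform \<phi> 0" by (simp add: isCont_def)
  then have "\<forall>\<^sub>F x in at 0. m < cos_transform \<phi> x" using m by (intro order_tendstoD)
  then obtain d where d: "0 < d" "\<And>x. x \<noteq> 0 \<Longrightarrow> dist x 0 < d \<Longrightarrow> m < cos_transform \<phi> x"
    unfolding eventually_at by auto
  have "m \<le> cos_transform \<phi> x" if "\<bar>x\<bar> \<le> d / 2" for x
    using d(1) d(2)[of x] that m by (cases "x = 0") (auto intro: less_imp_le)
  then show ?thesis using m d(1) by (intro exI[of _ "d / 2"] exI[of _ m]) auto
qed

text \<open>For large x, a single jump y in [x - r, x] has density at least x^(-1 - \<alpha>) /
  levy_const, and the small jumps only have to bridge the distance x - y \<le> r, where their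
  transform is at least m. For |x| \<le> r0 a constant bound suffices.\<close>

lemma stable_lower:
  "\<exists>c>0. \<forall>x. c * (1 + \<bar>x\<bar>) powr (-1 - \<alpha>) \<le> cos_transform (stable_char \<alpha>) x"
proof -
  obtain r0 m0 where r0: "0 < r0" "0 < m0" "\<And>x. \<bar>x\<bar> \<le> r0 \<Longrightarrow> m0 \<le> cos_transform (stable_char \<alpha>) x"
    using cos_transform_pos_near_0[OF integrable_stable_char[of \<alpha>] order_refl] \<alpha> by auto
  \<comment> \<open>With x \<ge> r0 = 2 * h and r < h, every y in the window [x - r, x] exceeds h
    and hence counts as a big jump.\<close>
  define h where "h = r0 / 2"
  have h: "0 < h" using r0 by (simp add: h_def)
  obtain r1 m where r1: "0 < r1" "0 < m" "\<And>x. \<bar>x\<bar> \<le> r1 \<Longrightarrow> m \<le> cos_transform (small_char h) x"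
    using cos_transform_pos_near_0[OF integrable_small_char[OF h] small_char_ge[OF h]] by auto
  define r where "r = min r1 h / 2"
  have r: "0 < r" "r < h" "r \<le> r1" using r1 h by (auto simp: r_def)
  define \<Lambda> where "\<Lambda> = cos_transform (big_jumps h) 0"
  \<comment> \<open>exp (- \<Lambda>) is the compound Poisson normalization, r the length of the
    window and m the lower bound of the small-jump transform; the 2 comes from averaging over x + y
    and x - y.\<close>
  define c1 where "c1 = exp (- \<Lambda>) * (r * m / (2 * levy_const))"
  have c1: "0 < c1" using r r1 levy_const_pos by (simp add: c1_def)
  have tail: "c1 * x powr (-1 - \<alpha>) \<le> cos_transform (stable_char \<alpha>) x" if x: "r0 \<le> x" for x
  proof -
    let ?s = "cos_transform (small_char h)"
    note nn = small_char_transform_nonneg[OF h]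
    have i: "integrable lborel (\<lambda>y. big_jumps h y * ((?s (x + y) + ?s (x - y)) / 2))"
    proof (rule integrable_mult_bounded[OF integrable_big_jumps[OF h]])
      have [measurable]: "?s \<in> borel_measurable borel"
        by (rule cos_transform_measurable[OF integrable_small_char[OF h]])
      show "(\<lambda>y. (?s (x + y) + ?s (x - y)) / 2) \<in> borel_measurable borel" by measurable
      show "\<bar>(?s (x + y) + ?s (x - y)) / 2\<bar> \<le> (\<integral>\<xi>. \<bar>small_char h \<xi>\<bar> \<partial>lborel)" for y
      proof -
        have avg: "\<bar>(a + b) / 2\<bar> \<le> B" if "\<bar>a\<bar> \<le> B" "\<bar>b\<bar> \<le> B" for a b B :: real
          using that by (auto simp: abs_le_iff)
        show ?thesis
          by (intro avg abs_cos_transform_le integrable_small_char h)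
      qed
    qed
    have "indicator {x - r..x} y * (x powr (-1 - \<alpha>) / levy_const * (m / 2)) \<le>
        big_jumps h y * ((?s (x + y) + ?s (x - y)) / 2)" for y
    proof (cases "y \<in> {x - r..x}")
      case True
      then have y: "h < y" "0 < y" "\<bar>x - y\<bar> \<le> r1" using x r h by (auto simp: h_def)
      have "x powr (-1 - \<alpha>) / levy_const \<le> y powr (-1 - \<alpha>) / levy_const"
        using y True \<alpha> levy_const_pos by (intro divide_right_mono powr_mono2') auto
      also have "\<dots> = big_jumps h y" using y by (simp add: big_jumps_def)
      finally have "x powr (-1 - \<alpha>) / levy_const \<le> big_jumps h y" .
      \<comment> \<open>Only x - y is near 0. The term at x + y is dropped, which requires the
        nonnegativity of the small-jump transform on the whole line.\<close>
      moreover have "m / 2 \<le> (?s (x + y) + ?s (x - y)) / 2"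
        using nn[of "x + y"] r1(3)[OF y(3)] by simp
      ultimately have "x powr (-1 - \<alpha>) / levy_const * (m / 2) \<le> big_jumps h y * ((?s (x + y) + ?s (x - y)) / 2)"
        using r1 big_jumps_nonneg by (intro mult_mono) auto
      then show ?thesis using True by (simp only: indicator_simps mult_1)
    qed (use nn big_jumps_nonneg in \<open>auto intro!: mult_nonneg_nonneg add_nonneg_nonneg\<close>)
    then have "(\<integral>y. indicator {x - r..x} y * (x powr (-1 - \<alpha>) / levy_const * (m / 2)) \<partial>lborel)
        \<le> cos_transform (\<lambda>\<xi>. small_char h \<xi> * cos_transform (big_jumps h) \<xi>) x"
      unfolding cos_transform_mult[OF integrable_small_char[OF h] integrable_big_jumps[OF h]]
      using r by (intro Bochner_Integration.integral_mono i integrable_mult_left integrable_real_indicator) auto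
    also have "\<dots> \<le> cos_transform (\<lambda>\<xi>. small_char h \<xi> * exp (cos_transform (big_jumps h) \<xi>)) x"
      by (intro cos_transform_exp_ge integrable_small_char integrable_big_jumps big_jumps_nonneg nn h)
    finally have "exp (- \<Lambda>) * (r * (x powr (-1 - \<alpha>) / levy_const * (m / 2))) \<le>
        exp (- \<Lambda>) * cos_transform (\<lambda>\<xi>. small_char h \<xi> * exp (cos_transform (big_jumps h) \<xi>)) x"
      using r by (intro mult_left_mono) auto
    also have "\<dots> = cos_transform (stable_char \<alpha>) x"
      unfolding cos_transform_def[of _ x] \<Lambda>_def integral_mult_right_zero[symmetric]
      by (intro Bochner_Integration.integral_cong) (auto simp: mult_ac stable_char_factor[OF h])
    finally show ?thesis by (simp add: c1_def mult_ac)
  qed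
  define c where "c = min m0 c1"
  have c: "0 < c" using r0 c1 by (simp add: c_def)
  have pos: "c * (1 + x) powr (-1 - \<alpha>) \<le> cos_transform (stable_char \<alpha>) x" if x: "0 \<le> x" for x
  proof (cases "x \<le> r0")
    case True
    have "(1 + x) powr (-1 - \<alpha>) \<le> 1 powr (-1 - \<alpha>)" using x \<alpha> by (intro powr_mono2') auto
    then have "c * (1 + x) powr (-1 - \<alpha>) \<le> m0 * 1"
      using r0 c by (intro mult_mono) (auto simp: c_def)
    then show ?thesis using r0(3)[of x] True x by simp
  next
    case False
    have "(1 + x) powr (-1 - \<alpha>) \<le> x powr (-1 - \<alpha>)" using False r0 \<alpha> by (intro powr_mono2') auto
    then have "c * (1 + x) powr (-1 - \<alpha>) \<le> c1 * x powr (-1 - \<alpha>)"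
      using c1 c by (intro mult_mono) (auto simp: c_def)
    then show ?thesis using tail[of x] False by simp
  qed
  have "c * (1 + \<bar>x\<bar>) powr (-1 - \<alpha>) \<le> cos_transform (stable_char \<alpha>) x" for x
    using pos[of "\<bar>x\<bar>"] cos_transform_minus[of "stable_char \<alpha>" x] by (cases "0 \<le> x") (auto simp: abs_if)
  then show ?thesis using c by blast
qed

end

section \<open>The fractional heat kernel on the line\<close>

lemma stable_two_sided:
  assumes \<alpha>: "1 < \<alpha>" "\<alpha> < 2"
  shows "\<exists>c C. 0 < c \<and> 0 < C \<and> (\<forall>x. c * stable_profile \<alpha> 1 x \<le> cos_transform (stable_char \<alpha>) x \<and>
    cos_transform (stable_char \<alpha>) x \<le> C * stable_profile \<alpha> 1 x)"
proof -
  have stable_profile: "stable_profile \<alpha> 1 x = (1 + \<bar>x\<bar>) powr (-1 - \<alpha>)" for x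
    by (simp add: stable_profile_def powr_diff powr_add powr_minus divide_simps)
  obtain c where c: "0 < c" "\<And>x. c * stable_profile \<alpha> 1 x \<le> cos_transform (stable_char \<alpha>) x"
    using stable_lower[OF \<alpha>] unfolding stable_profile by blast
  define I where "I = (\<integral>\<xi>. \<bar>stable_char \<alpha> \<xi>\<bar> \<partial>lborel)"
  define M where "M = 2 * (6 + 6 / (\<alpha> - 1) + 30 / (2 - \<alpha>))"
  have IM: "0 \<le> I" "0 < M" using \<alpha> by (auto simp: I_def M_def intro!: add_pos_pos)
  \<comment> \<open>The power of 2 compares (1 + |x|)^(-1 - \<alpha>) with 1 for |x| \<le> 1 and
    with |x|^(-1 - \<alpha>) for |x| > 1.\<close>
  define C where "C = (I + M) * 2 powr (1 + \<alpha>)"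
  have "cos_transform (stable_char \<alpha>) x \<le> C * stable_profile \<alpha> 1 x" for x
  proof (cases "\<bar>x\<bar> \<le> 1")
    case True
    have "cos_transform (stable_char \<alpha>) x \<le> I"
      using abs_cos_transform_le[OF integrable_stable_char, of \<alpha> x] \<alpha> by (simp add: I_def)
    also have "\<dots> \<le> (I + M) * 1" using IM by simp
    also have "1 \<le> 2 powr (1 + \<alpha>) * stable_profile \<alpha> 1 x"
    proof -
      have "(2::real) powr (-1 - \<alpha>) \<le> (1 + \<bar>x\<bar>) powr (-1 - \<alpha>)"
        using True \<alpha> by (intro powr_mono2') auto
      then have "2 powr (1 + \<alpha>) * 2 powr (-1 - \<alpha>) \<le> 2 powr (1 + \<alpha>) * stable_profile \<alpha> 1 x"
        unfolding stable_profile by (intro mult_left_mono) auto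
      then show ?thesis by (simp add: powr_add[symmetric])
    qed
    finally show ?thesis using IM by (simp add: C_def mult.assoc mult_left_mono)
  next
    case False
    have "cos_transform (stable_char \<alpha>) x = cos_transform (stable_char \<alpha>) \<bar>x\<bar>"
      using cos_transform_minus[of "stable_char \<alpha>" x] by (auto simp: abs_if)
    also have "\<dots> \<le> M * \<bar>x\<bar> powr (-1 - \<alpha>)"
      unfolding M_def by (rule order_trans[OF abs_ge_self stable_tail_upper[OF \<alpha>]]) (use False in auto)
    also have "\<dots> \<le> (I + M) * (2 powr (1 + \<alpha>) * stable_profile \<alpha> 1 x)"
    proof (intro mult_mono)
      have "\<bar>x\<bar> powr (-1 - \<alpha>) = 2 powr (1 + \<alpha>) * (2 * \<bar>x\<bar>) powr (-1 - \<alpha>)"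
        using False by (simp add: powr_mult powr_add[symmetric] mult.assoc[symmetric])
      also have "\<dots> \<le> 2 powr (1 + \<alpha>) * stable_profile \<alpha> 1 x"
        unfolding stable_profile using False \<alpha> by (intro mult_left_mono powr_mono2') auto
      finally show "\<bar>x\<bar> powr (-1 - \<alpha>) \<le> 2 powr (1 + \<alpha>) * stable_profile \<alpha> 1 x" .
    qed (use IM in auto)
    finally show ?thesis by (simp add: C_def mult.assoc)
  qed
  moreover have "0 < C" using IM by (simp add: C_def)
  ultimately show ?thesis using c by blast
qed

definition stable_line :: "real \<Rightarrow> real \<Rightarrow> real \<Rightarrow> real" where
  "stable_line \<alpha> t x = 1 / (2 * pi) * (\<integral>\<xi>. cos (\<xi> * x) * exp (- (t * \<bar>\<xi>\<bar> powr \<alpha>)) \<partial>lborel)"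

lemma stable_line_measurable [measurable]:
  assumes [measurable]: "f \<in> borel_measurable M" "h \<in> borel_measurable M"
  shows "(\<lambda>z. stable_line \<alpha> (f z) (h z)) \<in> borel_measurable M"
  unfolding stable_line_def by measurable

text \<open>Writing time as \<open>T powr \<alpha>\<close> makes T the length scale and avoids
  roots.\<close>

lemma stable_line_scaling:
  assumes "0 < T" "0 < \<alpha>"
  shows "stable_line \<alpha> (T powr \<alpha>) x = 1 / (2 * pi * T) * cos_transform (stable_char \<alpha>) (x / T)"
proof -
  have "cos_transform (stable_char \<alpha>) (x / T) = T * (\<integral>\<xi>. cos ((T * \<xi>) * (x / T)) * stable_char \<alpha> (T * \<xi>) \<partial>lborel)"
    unfolding cos_transform_def using assms by (subst lborel_integral_real_affine[where c=T and t=0]) auto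
  also have "(\<integral>\<xi>. cos ((T * \<xi>) * (x / T)) * stable_char \<alpha> (T * \<xi>) \<partial>lborel)
      = (\<integral>\<xi>. cos (\<xi> * x) * exp (- (T powr \<alpha> * \<bar>\<xi>\<bar> powr \<alpha>)) \<partial>lborel)"
    using assms by (intro Bochner_Integration.integral_cong) (auto simp: stable_char_def abs_mult powr_mult)
  finally show ?thesis using assms by (simp add: stable_line_def)
qed

lemma stable_profile_scaling: "0 < T \<Longrightarrow> 0 < \<alpha> \<Longrightarrow> stable_profile \<alpha> T x = stable_profile \<alpha> 1 (x / T) / T"
proof -
  assume T: "0 < T" "0 < \<alpha>"
  have "(T + \<bar>x\<bar>) powr (1 + \<alpha>) = (T * (1 + \<bar>x / T\<bar>)) powr (1 + \<alpha>)"
    using T by (simp add: distrib_left)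
  also have "\<dots> = T * T powr \<alpha> * (1 + \<bar>x / T\<bar>) powr (1 + \<alpha>)" using T by (simp add: powr_mult powr_add)
  finally show ?thesis using T by (simp add: stable_profile_def)
qed

section \<open>Moments of the subordinator from its Laplace transform\<close>

lemma subordinator_transform:
  assumes g: "subordinator_density \<beta> g" and s: "0 \<le> s"
  shows "integrable lborel (\<lambda>u. exp (- (s * u)) * g u)"
    "(\<integral>u. exp (- (s * u)) * g u \<partial>lborel) = exp (- (s powr \<beta>))"
proof -
  have [measurable]: "g \<in> borel_measurable borel" and nn: "\<And>u. 0 \<le> g u"
    and "(\<integral>\<^sup>+ u. ennreal (exp (- (s * u)) * g u) \<partial>lborel) = ennreal (exp (- (s powr \<beta>)))"
    using g s by (auto simp: subordinator_density_def)
  then have "has_bochner_integral lborel (\<lambda>u. exp (- (s * u)) * g u) (exp (- (s powr \<beta>)))"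
    by (intro has_bochner_integral_nn_integral) auto
  then show "integrable lborel (\<lambda>u. exp (- (s * u)) * g u)"
    "(\<integral>u. exp (- (s * u)) * g u \<partial>lborel) = exp (- (s powr \<beta>))"
    by (auto simp: has_bochner_integral_iff)
qed

text \<open>Up to constants, \<open>u\<^sup>-\<^sup>\<beta>\<close> is bounded for small \<open>u\<close> by \<open>\<Sum>k. 2\<^sup>k\<^sup>\<beta> exp (-2\<^sup>k u)\<close>, and \<open>u\<^sup>\<theta>\<close> for
  large \<open>u\<close> by \<open>\<Sum>k. 2\<^sup>k\<^sup>\<theta> (1 - exp (-2\<^sup>-\<^sup>k u))\<close>. The expectations of the terms are read off the Laplace
  transform and decay geometrically.\<close>

lemma dyadic_bracket:
  fixes v :: real assumes "1 \<le> v"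
  obtains k where "2 ^ k \<le> v" "v < 2 ^ Suc k"
proof -
  define n where "n = (LEAST n. v < 2 ^ n)"
  have ex: "\<exists>n. v < 2 ^ n" by (intro real_arch_pow) simp
  have n: "v < 2 ^ n" unfolding n_def by (rule LeastI_ex[OF ex])
  then obtain k where k: "n = Suc k" using assms by (cases n) auto
  have "\<not> v < 2 ^ k" using not_less_Least[of k "\<lambda>n. v < 2 ^ n"] k by (simp add: n_def)
  then show thesis using that[of k] n k by simp
qed

text \<open>It is enough that at each point one term of the series dominates f; which one may depend
  on the point.\<close>

lemma integrable_dyadic_sum:
  fixes f :: "real \<Rightarrow> real" and F :: "nat \<Rightarrow> real \<Rightarrow> real"
  assumes [measurable]: "f \<in> borel_measurable borel" "\<And>k. F k \<in> borel_measurable borel"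
    and f: "\<And>u. 0 \<le> f u" and F: "\<And>k u. 0 \<le> F k u"
    and dom: "\<And>u. 0 < f u \<Longrightarrow> \<exists>k. f u \<le> F k u"
    and int: "\<And>k. integrable lborel (F k)" "\<And>k. (\<integral>u. F k u \<partial>lborel) \<le> B * r ^ k"
    and r: "0 \<le> r" "r < 1"
  shows "integrable lborel f"
proof (rule integrableI_nonneg)
  have "(\<integral>\<^sup>+ u. ennreal (f u) \<partial>lborel) \<le> (\<integral>\<^sup>+ u. (\<Sum>k. ennreal (F k u)) \<partial>lborel)"
  proof (intro nn_integral_mono)
    fix u
    show "ennreal (f u) \<le> (\<Sum>k. ennreal (F k u))"
    proof (cases "0 < f u")
      case True
      then obtain k where "f u \<le> F k u" using dom by blast
      then have "ennreal (f u) \<le> (\<Sum>k\<in>{k}. ennreal (F k u))" by (simp add: ennreal_leI)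
      also have "\<dots> \<le> (\<Sum>k. ennreal (F k u))" by (intro sum_le_suminf) auto
      finally show ?thesis .
    qed (simp add: ennreal_neg)
  qed
  also have "\<dots> = (\<Sum>k. \<integral>\<^sup>+ u. ennreal (F k u) \<partial>lborel)" by (intro nn_integral_suminf) auto
  also have "\<dots> \<le> (\<Sum>k. ennreal (B * r ^ k))"
    using int F by (intro suminf_le) (auto simp: nn_integral_eq_integral intro: ennreal_leI)
  also have "\<dots> < \<infinity>"
  proof -
    have "0 \<le> B"
      using order_trans[OF Bochner_Integration.integral_nonneg[OF F] int(2)[of 0]] by simp
    moreover have "summable (\<lambda>k. B * r ^ k)" using r by (intro summable_mult summable_geometric) auto
    ultimately have "(\<Sum>k. ennreal (B * r ^ k)) \<noteq> top"
      using r by (intro ennreal_suminf_neq_top) auto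
    then show ?thesis by (simp add: top.not_eq_extremum)
  qed
  finally show "(\<integral>\<^sup>+ u. ennreal (f u) \<partial>lborel) < \<infinity>" .
qed (use f in auto)

lemma subordinator_negative_moment:
  assumes g: "subordinator_density \<beta> g" and \<beta>: "0 < \<beta>"
  shows "integrable lborel (\<lambda>u. u powr (- \<beta>) * g u)"
proof -
  have [measurable]: "g \<in> borel_measurable borel" and nn: "\<And>u. 0 \<le> g u" and g0: "\<And>u. u \<le> 0 \<Longrightarrow> g u = 0"
    using g by (auto simp: subordinator_density_def)
  let ?K = "2 powr \<beta> * exp 1"
  define F where "F k u = ?K * (2 ^ k) powr \<beta> * (exp (- (2 ^ k * u)) * g u)" for k :: nat and u :: real
  have [measurable]: "F k \<in> borel_measurable borel" for k unfolding F_def by measurable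
  have near: "integrable lborel (\<lambda>u. indicator {..1} u * (u powr (- \<beta>) * g u))"
  proof (rule integrable_dyadic_sum[where F=F and B="2 * ?K" and r="2 powr (- \<beta>)"])
    show "\<exists>k. indicator {..1} u * (u powr (- \<beta>) * g u) \<le> F k u"
      if "0 < indicator {..1} u * (u powr (- \<beta>) * g u)" for u
    proof -
      have u: "0 < u" "u \<le> 1"
        using that g0[of u] by (cases "u \<le> 1"; cases "0 < u"; simp)+
      obtain k where k: "2 ^ k \<le> 1 / u" "1 / u < 2 ^ Suc k" using dyadic_bracket[of "1 / u"] u by auto
      have "u powr (- \<beta>) = (1 / u) powr \<beta>" using u by (simp add: powr_minus powr_divide field_simps)
      also have "\<dots> \<le> (2 * 2 ^ k) powr \<beta>" using k u \<beta> by (intro powr_mono2) auto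
      also have "\<dots> = 2 powr \<beta> * (2 ^ k) powr \<beta> * 1" by (simp add: powr_mult)
      \<comment> \<open>2^k \<le> 1 / u makes the exponent nonnegative; this explains the factor exp
        1 in \<open>?K\<close>.\<close>
      also have "\<dots> \<le> 2 powr \<beta> * (2 ^ k) powr \<beta> * exp (1 - 2 ^ k * u)"
        using k u by (intro mult_left_mono) (auto simp: field_simps)
      also have "\<dots> = ?K * (2 ^ k) powr \<beta> * exp (- (2 ^ k * u))" by (simp add: exp_diff exp_minus field_simps)
      finally have "u powr (- \<beta>) * g u \<le> ?K * (2 ^ k) powr \<beta> * exp (- (2 ^ k * u)) * g u"
        by (intro mult_right_mono nn)
      then show ?thesis using u by (intro exI[of _ k]) (simp add: F_def mult.assoc)
    qed
    show "integrable lborel (F k)" for k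
      unfolding F_def by (intro integrable_mult_right subordinator_transform[OF g]) simp
    show "(\<integral>u. F k u \<partial>lborel) \<le> 2 * ?K * (2 powr (- \<beta>)) ^ k" for k
    proof -
      \<comment> \<open>The Laplace transform at 2^k is exp (- y). From y^2 * exp (- y) \<le> 2 the
        weighted term is at most 2 / y = 2 * 2^(-k \<beta>).\<close>
      define y :: real where "y = (2 ^ k) powr \<beta>"
      have y: "0 < y" by (simp add: y_def)
      have "(\<integral>u. F k u \<partial>lborel) = ?K * (y * exp (- y))"
        unfolding F_def by (simp add: subordinator_transform(2)[OF g] y_def)
      also have "y * exp (- y) \<le> 2 / y"
        using mult_exp_minus_le(2)[of y] y by (simp add: field_simps power2_eq_square)
      also have "?K * (2 / y) = 2 * ?K * (2 powr (- \<beta>)) ^ k"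
        by (simp add: y_def powr_realpow[symmetric] powr_powr powr_minus field_simps)
      finally show ?thesis by simp
    qed
    show "2 powr (- \<beta>) < (1::real)" using \<beta> by (simp add: powr_less_one)
  qed (auto simp: F_def nn)
  have "integrable lborel g" using subordinator_transform(1)[OF g, of 0] by simp
  then have "integrable lborel (\<lambda>u. indicator {..1} u * (u powr (- \<beta>) * g u) + g u)"
    using near by (rule Bochner_Integration.integrable_add[rotated])
  then show ?thesis
  proof (rule Bochner_Integration.integrable_bound)
    have "u powr (- \<beta>) * g u \<le> indicator {..1} u * (u powr (- \<beta>) * g u) + g u" for u
    proof (cases "u \<le> 1")
      case False
      then have "u powr (- \<beta>) \<le> 1 powr (- \<beta>)" using \<beta> by (intro powr_mono2') auto
      then have "u powr (- \<beta>) * g u \<le> 1 * g u" using nn by (intro mult_right_mono) auto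
      then show ?thesis using False by simp
    qed (simp add: nn)
    then show "AE u in lborel. norm (u powr (- \<beta>) * g u) \<le> norm (indicator {..1} u * (u powr (- \<beta>) * g u) + g u)"
      using nn by (auto intro!: AE_I2 order_trans[OF _ abs_ge_self])
  qed simp
qed

text \<open>Applied with \<theta> = \<beta> / \<alpha>, which lies below \<beta> because \<alpha> >
  1; here the condition d < \<alpha> enters.\<close>

lemma subordinator_positive_moment:
  assumes g: "subordinator_density \<beta> g" and \<theta>: "0 < \<theta>" "\<theta> < \<beta>"
  shows "integrable lborel (\<lambda>u. u powr \<theta> * g u)"
proof -
  have [measurable]: "g \<in> borel_measurable borel" and nn: "\<And>u. 0 \<le> g u" and g0: "\<And>u. u \<le> 0 \<Longrightarrow> g u = 0"
    using g by (auto simp: subordinator_density_def)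
  \<comment> \<open>At s = 0 the transform gives total mass 1, since
    \<open>0 powr \<beta> = 0\<close>.\<close>
  have gi: "integrable lborel g" "(\<integral>u. g u \<partial>lborel) = 1" using subordinator_transform[OF g, of 0] by auto
  \<comment> \<open>Lower bound of 1 - exp (- 2^(-k) u) for u \<ge> 2^k.\<close>
  define q :: real where "q = 1 - exp (-1)"
  have q: "0 < q" by (simp add: q_def)
  let ?K = "2 powr \<theta> / q"
  define F where "F k u = ?K * (2 ^ k) powr \<theta> * (g u - exp (- (inverse (2 ^ k) * u)) * g u)" for k :: nat and u :: real
  have Fnn: "0 \<le> g u - exp (- (inverse (2 ^ k) * u)) * g u" for k u
  proof (cases "0 \<le> u")
    case True
    then have "exp (- (inverse (2 ^ k) * u)) * g u \<le> 1 * g u" by (intro mult_right_mono nn) auto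
    then show ?thesis by simp
  qed (simp add: g0)
  have [measurable]: "F k \<in> borel_measurable borel" for k unfolding F_def by measurable
  have far: "integrable lborel (\<lambda>u. indicator {1..} u * (u powr \<theta> * g u))"
  proof (rule integrable_dyadic_sum[where F=F and B="?K" and r="2 powr (\<theta> - \<beta>)"])
    show "\<exists>k. indicator {1..} u * (u powr \<theta> * g u) \<le> F k u"
      if "0 < indicator {1..} u * (u powr \<theta> * g u)" for u
    proof -
      have u: "1 \<le> u" using that by (cases "1 \<le> u") auto
      obtain k where k: "2 ^ k \<le> u" "u < 2 ^ Suc k" using dyadic_bracket[OF u] by auto
      have "u powr \<theta> \<le> (2 * 2 ^ k) powr \<theta>" using k u \<theta> by (intro powr_mono2) auto
      also have "\<dots> = ?K * (2 ^ k) powr \<theta> * q" using q by (simp add: powr_mult)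
      also have "\<dots> \<le> ?K * (2 ^ k) powr \<theta> * (1 - exp (- (inverse (2 ^ k) * u)))"
        using k q unfolding q_def by (intro mult_left_mono) (auto simp: field_simps)
      finally have "u powr \<theta> * g u \<le> ?K * (2 ^ k) powr \<theta> * (1 - exp (- (inverse (2 ^ k) * u))) * g u"
        by (intro mult_right_mono nn)
      also have "\<dots> = F k u"
        by (simp only: F_def mult.assoc left_diff_distrib mult_1_left)
      finally show ?thesis using u by (intro exI[of _ k]) simp
    qed
    show "integrable lborel (F k)" for k
      unfolding F_def
      by (intro integrable_mult_right Bochner_Integration.integrable_diff subordinator_transform[OF g] gi) simp
    show "(\<integral>u. F k u \<partial>lborel) \<le> ?K * (2 powr (\<theta> - \<beta>)) ^ k" for k
    proof -
      \<comment> \<open>1 - exp (- y) \<le> y = 2^(-k \<beta>) meets the weight 2^(k \<theta>), so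
        the ratio 2^(\<theta> - \<beta>) is below 1 exactly because \<theta> < \<beta>.\<close>
      define y :: real where "y = inverse (2 ^ k) powr \<beta>"
      have "(\<integral>u. F k u \<partial>lborel) = ?K * ((2 ^ k) powr \<theta> * (1 - exp (- y)))"
        unfolding F_def
        by (subst integral_mult_right_zero, subst Bochner_Integration.integral_diff)
           (auto simp: subordinator_transform[OF g] gi y_def)
      also have "\<dots> \<le> ?K * ((2 ^ k) powr \<theta> * y)"
        using exp_ge_add_one_self[of "- y"] q by (intro mult_left_mono) auto
      also have "(2 ^ k) powr \<theta> * y = (2 powr (\<theta> - \<beta>)) ^ k"
        by (simp add: y_def powr_realpow[symmetric] powr_powr powr_minus[symmetric] powr_add[symmetric] algebra_simps)
      finally show ?thesis by (simp add: mult.assoc)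
    qed
    show "2 powr (\<theta> - \<beta>) < (1::real)" using \<theta> by (simp add: powr_less_one)
  qed (use Fnn q in \<open>auto simp: F_def nn\<close>)
  have "integrable lborel (\<lambda>u. indicator {1..} u * (u powr \<theta> * g u) + g u)"
    using far gi(1) by (rule Bochner_Integration.integrable_add)
  then show ?thesis
  proof (rule Bochner_Integration.integrable_bound)
    have "u powr \<theta> * g u \<le> indicator {1..} u * (u powr \<theta> * g u) + g u" for u
    proof (cases "0 \<le> u \<and> u < 1")
      case True
      then have "u powr \<theta> \<le> 1 powr \<theta>" using \<theta> by (intro powr_mono2) auto
      then have "u powr \<theta> * g u \<le> 1 * g u" using nn by (intro mult_right_mono) auto
      then show ?thesis using True by simp
    qed (use g0[of u] in \<open>auto simp: nn\<close>)
    then show "AE u in lborel. norm (u powr \<theta> * g u) \<le> norm (indicator {1..} u * (u powr \<theta> * g u) + g u)"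
      using nn by (auto intro!: AE_I2 order_trans[OF _ abs_ge_self])
  qed simp
qed

section \<open>Averaging the stable kernel over the subordinator\<close>

definition frac_kernel_line :: "real \<Rightarrow> real \<Rightarrow> (real \<Rightarrow> real) \<Rightarrow> real \<Rightarrow> real \<Rightarrow> real" where
  "frac_kernel_line \<alpha> \<beta> g t x =
     (\<integral>u. indicator {0<..} u * (stable_line \<alpha> ((t / u) powr \<beta>) x * g u) \<partial>lborel)"

text \<open>At operational time (t / u)^\<beta> the length scale is w * t^\<theta> with w =
  u^(-\<theta>). The dilation bounds separate u from (t, x): w^\<alpha> = u^(-\<beta>) and 1 / w =
  u^\<theta> combine into the weights \<open>U\<close> and \<open>L\<close>, whose integrals against
  \<open>g\<close> become the constants.\<close>

lemma frac_kernel_line_bounds: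
  assumes \<alpha>: "1 < \<alpha>" "\<alpha> < 2" and \<beta>: "0 < \<beta>" "\<beta> < 1" and g: "subordinator_density \<beta> g"
  shows "\<exists>lo hi. heat_kernel_bounds (frac_kernel_line \<alpha> \<beta> g) \<alpha> (\<beta> / \<alpha>) lo hi"
proof -
  have g_meas [measurable]: "g \<in> borel_measurable borel" and nn: "\<And>u. 0 \<le> g u" and g0: "\<And>u. u \<le> 0 \<Longrightarrow> g u = 0"
    using g by (auto simp: subordinator_density_def)
  obtain c C where c: "0 < c" "\<And>x. c * stable_profile \<alpha> 1 x \<le> cos_transform (stable_char \<alpha>) x"
    and C: "0 < C" "\<And>x. cos_transform (stable_char \<alpha>) x \<le> C * stable_profile \<alpha> 1 x"
    using stable_two_sided[OF \<alpha>] by blast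
  define \<theta> where "\<theta> = \<beta> / \<alpha>"
  have \<theta>: "0 < \<theta>" "\<theta> < \<beta>" "\<theta> < 1" using \<alpha> \<beta> by (auto simp: \<theta>_def field_simps intro: less_trans)
  have \<theta>\<alpha>: "\<theta> * \<alpha> = \<beta>" using \<alpha> by (simp add: \<theta>_def)
  let ?P = "\<lambda>t u x. stable_line \<alpha> ((t / u) powr \<beta>) x"
  let ?w = "\<lambda>u. u powr (- \<theta>)"
  have P_eq: "?P t u x = 1 / (2 * pi * (?w u * t powr \<theta>)) * cos_transform (stable_char \<alpha>) (x / (?w u * t powr \<theta>))"
    if "0 < t" "0 < u" for t u x
  proof -
    have "(t / u) powr \<beta> = (?w u * t powr \<theta>) powr \<alpha>"
    proof -
      have "?w u * t powr \<theta> = (t / u) powr \<theta>"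
        using that by (simp add: powr_divide powr_minus field_simps)
      then show ?thesis by (simp add: powr_powr \<theta>\<alpha>)
    qed
    then show ?thesis using stable_line_scaling[of "?w u * t powr \<theta>" \<alpha> x] that \<alpha> by simp
  qed
  define U where "U u = u powr (- \<beta>) + u powr \<theta>" for u :: real
  define L where "L u = min (u powr (- \<beta>)) (u powr \<theta>)" for u :: real
  have wU: "?w u powr \<alpha> + 1 / ?w u = U u" "min (?w u powr \<alpha>) (1 / ?w u) = L u" if "0 < u" for u
  proof -
    have "?w u powr \<alpha> = u powr (- \<beta>)" by (simp add: powr_powr \<theta>\<alpha>)
    moreover have "1 / ?w u = u powr \<theta>" by (simp add: powr_minus divide_inverse)
    ultimately show "?w u powr \<alpha> + 1 / ?w u = U u" "min (?w u powr \<alpha>) (1 / ?w u) = L u"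
      by (simp_all only: U_def L_def)
  qed
  have P_upper: "?P t u x \<le> C / (2 * pi) * U u * stable_profile \<alpha> (t powr \<theta>) x" if tu: "0 < t" "0 < u" for t u x
  proof -
    have "?P t u x \<le> 1 / (2 * pi * (?w u * t powr \<theta>)) * (C * stable_profile \<alpha> 1 (x / (?w u * t powr \<theta>)))"
      unfolding P_eq[OF tu] using tu by (intro mult_left_mono C) auto
    also have "\<dots> = C / (2 * pi) * stable_profile \<alpha> (?w u * t powr \<theta>) x"
      using tu \<alpha> stable_profile_scaling[of "?w u * t powr \<theta>" \<alpha> x] by simp
    also have "\<dots> \<le> C / (2 * pi) * (U u * stable_profile \<alpha> (t powr \<theta>) x)"
      unfolding wU(1)[OF tu(2), symmetric] using C tu \<alpha> by (intro mult_left_mono stable_profile_dilate_upper) auto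
    finally show ?thesis by simp
  qed
  have P_lower: "c / (2 * pi) * L u * stable_profile \<alpha> (t powr \<theta>) x \<le> ?P t u x" if tu: "0 < t" "0 < u" for t u x
  proof -
    have "c / (2 * pi) * (L u * stable_profile \<alpha> (t powr \<theta>) x) \<le> c / (2 * pi) * stable_profile \<alpha> (?w u * t powr \<theta>) x"
      unfolding wU(2)[OF tu(2), symmetric] using c tu \<alpha> by (intro mult_left_mono stable_profile_dilate_lower) auto
    also have "\<dots> = 1 / (2 * pi * (?w u * t powr \<theta>)) * (c * stable_profile \<alpha> 1 (x / (?w u * t powr \<theta>)))"
      using tu \<alpha> stable_profile_scaling[of "?w u * t powr \<theta>" \<alpha> x] by simp
    also have "\<dots> \<le> ?P t u x"
      unfolding P_eq[OF tu] using tu by (intro mult_left_mono c) auto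
    finally show ?thesis by simp
  qed
  have L_nn: "0 \<le> L u" for u by (simp add: L_def)
  have P_nn: "0 \<le> ?P t u x" if tu: "0 < t" "0 < u" for t u x
    using P_lower[OF tu, of x] c L_nn[of u] by (smt (verit) divide_pos_pos stable_profile_nonneg mult_nonneg_nonneg pi_gt_zero)
  have Ui: "integrable lborel (\<lambda>u. U u * g u)"
    using subordinator_negative_moment[OF g \<beta>(1)] subordinator_positive_moment[OF g \<theta>(1,2)]
    by (simp add: U_def distrib_right)
  have [measurable]: "U \<in> borel_measurable borel" "L \<in> borel_measurable borel"
    unfolding U_def L_def by measurable
  have Li: "integrable lborel (\<lambda>u. L u * g u)"
  proof (rule Bochner_Integration.integrable_bound[OF Ui])
    have "L u * g u \<le> U u * g u" for u by (intro mult_right_mono nn) (auto simp: U_def L_def min_def)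
    then show "AE u in lborel. norm (L u * g u) \<le> norm (U u * g u)"
      using nn by (auto simp: L_nn intro!: AE_I2 order_trans[OF _ abs_ge_self])
  qed simp
  let ?f = "\<lambda>t x u. indicator {0<..} u * (?P t u x * g u)"
  have f_upper: "?f t x u \<le> C / (2 * pi) * stable_profile \<alpha> (t powr \<theta>) x * (U u * g u)" if "0 < t" for t x u
    using mult_right_mono[OF P_upper[OF that, of u x] nn[of u]] g0[of u]
    by (cases "0 < u") (auto simp: mult_ac not_less)
  have f_lower: "c / (2 * pi) * stable_profile \<alpha> (t powr \<theta>) x * (L u * g u) \<le> ?f t x u" if "0 < t" for t x u
    using mult_right_mono[OF P_lower[OF that, of u x] nn[of u]] g0[of u]
    by (cases "0 < u") (auto simp: mult_ac not_less)
  have f_nn: "0 \<le> ?f t x u" if "0 < t" for t x u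
    using P_nn[OF that, of u x] nn[of u] by (cases "0 < u") auto
  have f_int: "integrable lborel (?f t x)" if "0 < t" for t x
  proof (rule Bochner_Integration.integrable_bound)
    show "integrable lborel (\<lambda>u. C / (2 * pi) * stable_profile \<alpha> (t powr \<theta>) x * (U u * g u))"
      using Ui by (intro integrable_mult_right)
    show "AE u in lborel. norm (?f t x u) \<le> norm (C / (2 * pi) * stable_profile \<alpha> (t powr \<theta>) x * (U u * g u))"
      using f_upper[OF that] f_nn[OF that] by (intro AE_I2) (smt (verit) real_norm_def)
  qed simp
  define mL where "mL = (\<integral>u. L u * g u \<partial>lborel)"
  define mU where "mU = (\<integral>u. U u * g u \<partial>lborel)"
  \<comment> \<open>\<open>L\<close> is positive for u > 0, so a vanishing integral would force g =
    0 almost everywhere, against total mass 1.\<close>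
  have mL: "0 < mL"
  proof -
    have "mL \<noteq> 0"
    proof
      assume "mL = 0"
      then have "AE u in lborel. L u * g u = 0"
        unfolding mL_def using Li nn L_nn by (subst (asm) integral_nonneg_eq_0_iff_AE) auto
      then have "AE u in lborel. g u = 0"
      proof eventually_elim
        case (elim u)
        then show ?case using g0[of u] by (cases "0 < u") (auto simp: L_def min_def split: if_splits)
      qed
      then have "(\<integral>u. g u \<partial>lborel) = (\<integral>u. 0 \<partial>(lborel :: real measure))"
        by (intro integral_cong_AE) auto
      then show False using subordinator_transform(2)[OF g, of 0] by simp
    qed
    moreover have "0 \<le> mL" unfolding mL_def using nn L_nn by (intro Bochner_Integration.integral_nonneg) auto
    ultimately show ?thesis by simp
  qed
  have "mL \<le> mU" unfolding mL_def mU_def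
    by (intro Bochner_Integration.integral_mono Li Ui mult_right_mono nn) (auto simp: U_def L_def min_def)
  then have mU: "0 < mU" using mL by simp
  have cont: "continuous_on ({0<..} \<times> UNIV) (\<lambda>(t, x). frac_kernel_line \<alpha> \<beta> g t x)"
  proof (rule continuous_on_halfspaceI)
    fix m b :: real assume m: "0 < m" "m < b"
    show "continuous_on ({m<..<b} \<times> UNIV) (\<lambda>(t, x). frac_kernel_line \<alpha> \<beta> g t x)"
      unfolding continuous_on_sequentially
    proof safe
      fix z :: "nat \<Rightarrow> real \<times> real" and t x :: real
      assume z: "\<forall>n. z n \<in> {m<..<b} \<times> UNIV" and t: "t \<in> {m<..<b}" and lim: "z \<longlonglongrightarrow> (t, x)"
      have l1: "(\<lambda>n. fst (z n)) \<longlonglongrightarrow> t" and l2: "(\<lambda>n. snd (z n)) \<longlonglongrightarrow> x"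
        using tendsto_fst[OF lim] tendsto_snd[OF lim] by auto
      have zm: "m < fst (z n)" "0 < fst (z n)" for n using z m by (auto simp: mem_Times_iff intro: less_trans)
      have tpos: "0 < t" using t m by auto
      have "(\<lambda>n. frac_kernel_line \<alpha> \<beta> g (fst (z n)) (snd (z n))) \<longlonglongrightarrow> frac_kernel_line \<alpha> \<beta> g t x"
        unfolding frac_kernel_line_def
      proof (rule integral_dominated_convergence[where w="\<lambda>u. C / (2 * pi) * m powr (- \<theta>) * (U u * g u)"])
        show "integrable lborel (\<lambda>u. C / (2 * pi) * m powr (- \<theta>) * (U u * g u))"
          using Ui by (intro integrable_mult_right)
        show "AE u in lborel. norm (?f (fst (z n)) (snd (z n)) u) \<le> C / (2 * pi) * m powr (- \<theta>) * (U u * g u)" for n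
        proof (intro AE_I2)
          fix u
          have "stable_profile \<alpha> (fst (z n) powr \<theta>) (snd (z n)) \<le> fst (z n) powr (- \<theta>)"
            using stable_profile_le_inverse[of "fst (z n) powr \<theta>" \<alpha>] zm[of n] \<alpha> by (simp add: powr_minus divide_inverse)
          also have "\<dots> \<le> m powr (- \<theta>)" using zm[of n] m \<theta> by (intro powr_mono2') auto
          finally have "C / (2 * pi) * stable_profile \<alpha> (fst (z n) powr \<theta>) (snd (z n)) * (U u * g u)
              \<le> C / (2 * pi) * m powr (- \<theta>) * (U u * g u)"
            using C nn by (intro mult_right_mono mult_left_mono) (auto simp: U_def)
          then show "norm (?f (fst (z n)) (snd (z n)) u) \<le> C / (2 * pi) * m powr (- \<theta>) * (U u * g u)"
            using f_upper[OF zm(2)[of n], of u "snd (z n)"] f_nn[OF zm(2)[of n], of u "snd (z n)"]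
            unfolding real_norm_def by linarith
        qed
        show "AE u in lborel. (\<lambda>n. ?f (fst (z n)) (snd (z n)) u) \<longlonglongrightarrow> ?f t x u"
        proof (intro AE_I2)
          fix u :: real
          show "(\<lambda>n. ?f (fst (z n)) (snd (z n)) u) \<longlonglongrightarrow> ?f t x u"
          proof (cases "0 < u")
            case True
            have ct: "isCont (cos_transform (stable_char \<alpha>)) y" for y
              using continuous_cos_transform[OF integrable_stable_char, of \<alpha>] \<alpha>
              by (simp add: continuous_on_eq_continuous_at)
            have p1: "(\<lambda>n. ?w u * fst (z n) powr \<theta>) \<longlonglongrightarrow> ?w u * t powr \<theta>"
              using tpos by (intro tendsto_intros l1) auto
            have nz: "?w u * t powr \<theta> \<noteq> 0" using True tpos by simp
            have p2: "(\<lambda>n. cos_transform (stable_char \<alpha>) (snd (z n) / (?w u * fst (z n) powr \<theta>)))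
                \<longlonglongrightarrow> cos_transform (stable_char \<alpha>) (x / (?w u * t powr \<theta>))"
              by (rule isCont_tendsto_compose[OF ct]) (intro tendsto_divide l2 p1 nz)
            have "(\<lambda>n. ?P (fst (z n)) u (snd (z n))) \<longlonglongrightarrow> ?P t u x"
              unfolding P_eq[OF zm(2) True] P_eq[OF tpos True] using nz
              by (intro tendsto_mult tendsto_divide tendsto_const p1 p2) auto
            then show ?thesis by (intro tendsto_intros)
          qed simp
        qed
      qed simp_all
      then show "((\<lambda>(t, x). frac_kernel_line \<alpha> \<beta> g t x) \<circ> z) \<longlonglongrightarrow> frac_kernel_line \<alpha> \<beta> g t x"
        by (simp add: o_def case_prod_beta)
    qed
  qed
  have meas: "(\<lambda>(t, x). frac_kernel_line \<alpha> \<beta> g t x) \<in> borel_measurable borel"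
  proof -
    have "(\<lambda>z. frac_kernel_line \<alpha> \<beta> g (fst z) (snd z)) \<in> borel_measurable (borel \<Otimes>\<^sub>M borel)"
      unfolding frac_kernel_line_def by measurable
    then show ?thesis by (simp add: case_prod_beta' borel_prod)
  qed
  have "heat_kernel_bounds (frac_kernel_line \<alpha> \<beta> g) \<alpha> \<theta> (c / (2 * pi) * mL) (C / (2 * pi) * mU)"
  proof
    fix t x :: real assume t: "0 < t"
    have "c / (2 * pi) * mL * stable_profile \<alpha> (t powr \<theta>) x = (\<integral>u. c / (2 * pi) * stable_profile \<alpha> (t powr \<theta>) x * (L u * g u) \<partial>lborel)"
      by (simp add: mL_def)
    also have "\<dots> \<le> frac_kernel_line \<alpha> \<beta> g t x"
      unfolding frac_kernel_line_def
      by (intro Bochner_Integration.integral_mono integrable_mult_right Li f_int f_lower t)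
    finally show "c / (2 * pi) * mL * stable_profile \<alpha> (t powr \<theta>) x \<le> frac_kernel_line \<alpha> \<beta> g t x" .
    have "frac_kernel_line \<alpha> \<beta> g t x \<le> (\<integral>u. C / (2 * pi) * stable_profile \<alpha> (t powr \<theta>) x * (U u * g u) \<partial>lborel)"
      unfolding frac_kernel_line_def
      by (intro Bochner_Integration.integral_mono integrable_mult_right Ui f_int f_upper t)
    also have "\<dots> = C / (2 * pi) * mU * stable_profile \<alpha> (t powr \<theta>) x" by (simp add: mU_def)
    finally show "frac_kernel_line \<alpha> \<beta> g t x \<le> C / (2 * pi) * mU * stable_profile \<alpha> (t powr \<theta>) x" .
  qed (use \<alpha> \<theta> c C mL mU cont meas in auto)
  then show ?thesis unfolding \<theta>_def by blast
qed

section \<open>Transfer to one-dimensional vectors\<close>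

definition line_vec :: "real \<Rightarrow> real ^ 'n" where "line_vec r = (\<chi> i. r)"

lemma line_vec_measurable [measurable]: "line_vec \<in> borel_measurable borel"
proof (rule borel_measurable_continuous_onI)
  show "continuous_on UNIV (line_vec :: real \<Rightarrow> real ^ 'n)"
    unfolding line_vec_def by (intro continuous_on_vec_lambda continuous_on_id)
qed

context
  fixes i :: "'n::finite"
  assumes UNIV_i: "UNIV = {i}"
begin

lemma line_vec_nth: "line_vec (x $ i) = (x :: real ^ 'n)" "line_vec r $ i = r"
proof -
  have "j = i" for j using UNIV_i by auto
  then show "line_vec (x $ i) = x" by (simp add: line_vec_def vec_eq_iff) metis
qed (simp add: line_vec_def)

text \<open>Lebesgue measure is determined by its values on boxes, and with a single coordinate
  these are intervals.\<close>

lemma distr_line_vec: "distr lborel borel line_vec = (lborel :: (real ^ 'n) measure)"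
proof (rule lborel_eqI[symmetric])
  have all: "(\<forall>j. P j) \<longleftrightarrow> P i" for P :: "'n \<Rightarrow> bool" using UNIV_i by (metis UNIV_I singletonD)
  have Basis: "Basis = {axis i (1::real)}" unfolding Basis_vec_def by (simp add: UNIV_i)
  fix l u :: "real ^ 'n" assume "\<And>b. b \<in> Basis \<Longrightarrow> l \<bullet> b \<le> u \<bullet> b"
  then have le: "l $ i \<le> u $ i" by (simp add: Basis inner_axis)
  have "line_vec -` box l u = {l $ i<..<u $ i}"
    by (auto simp: mem_box_cart all line_vec_nth)
  then show "emeasure (distr lborel borel line_vec) (box l u) = (\<Prod>b\<in>Basis. (u - l) \<bullet> b)"
    using le by (simp add: emeasure_distr Basis inner_axis)
qed simp

lemma nn_integral_line_vec:
  fixes f :: "real ^ 'n \<Rightarrow> ennreal"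
  assumes "f \<in> borel_measurable borel"
  shows "(\<integral>\<^sup>+ y. f y \<partial>lborel) = (\<integral>\<^sup>+ r. f (line_vec r) \<partial>lborel)"
  by (subst distr_line_vec[symmetric], subst nn_integral_distr) (use assms in auto)

lemma stable_density_eq: "stable_density \<alpha> t (x :: real ^ 'n) = stable_line \<alpha> t (x $ i)"
proof -
  have card: "CARD('n) = 1" unfolding UNIV_i by simp
  have norm: "norm (line_vec r :: real ^ 'n) = \<bar>r\<bar>" for r
    by (simp add: norm_vec_def L2_set_def UNIV_i line_vec_def)
  have inner: "line_vec r \<bullet> x = r * x $ i" for r
    by (simp add: inner_vec_def UNIV_i line_vec_def)
  have "(\<integral>\<xi>. cos (\<xi> \<bullet> x) * exp (- (t * norm \<xi> powr \<alpha>)) \<partial>lborel)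
      = (\<integral>r. cos (line_vec r \<bullet> x) * exp (- (t * norm (line_vec r :: real ^ 'n) powr \<alpha>)) \<partial>lborel)"
    by (subst distr_line_vec[symmetric], subst integral_distr) auto
  then show ?thesis by (simp add: stable_density_def stable_line_def card norm inner)
qed

lemma frac_heat_kernel_eq:
  "frac_heat_kernel \<alpha> \<beta> g t (x :: real ^ 'n) = frac_kernel_line \<alpha> \<beta> g t (x $ i)"
  by (simp add: frac_heat_kernel_def frac_kernel_line_def stable_density_eq)

end

text \<open>All integrands are nonnegative, so the equation is stated with integrals in
  [0, \<infinity>]; a real value on the left then includes the convergence of both
  integrals.\<close>

theorem theorem1p3:
  fixes \<alpha> \<beta> \<eta> \<gamma> :: real and g :: "real \<Rightarrow> real"
  assumes "0 < \<alpha>" "\<alpha> < 2" "real CARD('n) < \<alpha>"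
    and "0 < \<beta>" "\<beta> < 1"
    and "\<eta> > \<alpha> / (\<beta> * real CARD('n))"
    and "\<gamma> > 0"
    and "subordinator_density \<beta> g"
  shows "\<exists>\<delta>0>0. \<forall>\<delta>. 0 < \<delta> \<and> \<delta> < \<delta>0 \<longrightarrow>
    (\<forall>V0 :: real ^ 'n \<Rightarrow> real. V0 \<in> borel_measurable borel \<and>
       (\<forall>x. 0 \<le> V0 x \<and> V0 x \<le> \<delta> * frac_heat_kernel \<alpha> \<beta> g \<gamma> x) \<longrightarrow>
      (\<exists>(V :: real \<Rightarrow> real ^ 'n \<Rightarrow> real) C.
         (\<forall>t>0. \<forall>x. 0 \<le> V t x) \<and>
         (\<forall>t>0. \<forall>x. ennreal (V t x) =
             (\<integral>\<^sup>+ y. ennreal (frac_heat_kernel \<alpha> \<beta> g t (x - y) * V0 y) \<partial>lborel) +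
             (\<integral>\<^sup>+ y. (\<integral>\<^sup>+ s. indicator {0<..<t} s *
                 ennreal (frac_heat_kernel \<alpha> \<beta> g (t - s) (x - y) * V s y powr (1 + \<eta>))
                 \<partial>lborel) \<partial>lborel)) \<and>
         (\<forall>t>0. \<forall>x. V t x \<le> C * frac_heat_kernel \<alpha> \<beta> g (t + \<gamma>) x) \<and>
         continuous_on ({0<..} \<times> UNIV) (\<lambda>(t, x). V t x)))"
proof -
  \<comment> \<open>d < \<alpha> < 2 leaves only d = 1, and then \<alpha> > 1.\<close>
  have "real CARD('n) < real 2" using assms(2,3) by simp
  then have "CARD('n) < 2" by (simp only: of_nat_less_iff)
  then have card: "CARD('n) = 1" using zero_less_card_finite[where 'a='n] by linarith
  then obtain i :: 'n where UNIV_i: "UNIV = {i}" by (metis card_1_singletonE)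
  have \<alpha>: "1 < \<alpha>" "\<alpha> < 2" using assms(2,3) card by auto
  have \<eta>: "\<alpha> / \<beta> < \<eta>" using assms(6) card by simp
  \<comment> \<open>For d = 1 the hypothesis on \<eta> says \<theta> * \<eta> > 1, the integrability
    of (s + \<gamma>)^(-\<theta> \<eta>) at infinity.\<close>
  then have \<eta>': "1 < \<beta> / \<alpha> * \<eta>" "0 < \<eta>"
    using assms(4) \<alpha> by (auto simp: field_simps intro: less_trans[of 0 "\<alpha> / \<beta>" \<eta>])
  let ?G = "frac_kernel_line \<alpha> \<beta> g"
  obtain lo hi where hkb: "heat_kernel_bounds ?G \<alpha> (\<beta> / \<alpha>) lo hi"
    using frac_kernel_line_bounds[OF \<alpha> assms(4,5,8)] by blast
  interpret heat_kernel_bounds ?G \<alpha> "\<beta> / \<alpha>" lo hi by (rule hkb)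
  note nth = line_vec_nth[OF UNIV_i] and kernel = frac_heat_kernel_eq[OF UNIV_i]
  obtain \<delta>0 where "0 < \<delta>0" and sol: "\<forall>\<delta>. 0 < \<delta> \<and> \<delta> < \<delta>0 \<longrightarrow>
      (\<forall>W0. W0 \<in> borel_measurable borel \<and> (\<forall>r. 0 \<le> W0 r \<and> W0 r \<le> \<delta> * ?G \<gamma> r) \<longrightarrow>
      (\<exists>W C. (\<lambda>(t, r). W t r) \<in> borel_measurable borel \<and> (\<forall>t>0. \<forall>r. 0 \<le> W t r) \<and>
         (\<forall>t>0. \<forall>r. ennreal (W t r) = lin_term W0 t r + duhamel (\<lambda>s y. W s y powr (1 + \<eta>)) t r) \<and>
         (\<forall>t>0. \<forall>r. W t r \<le> C * ?G (t + \<gamma>) r) \<and>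
         continuous_on ({0<..} \<times> UNIV) (\<lambda>(t, r). W t r)))"
    using mild_solution_exists[OF \<eta>'(2,1) \<open>\<gamma> > 0\<close>] by (elim exE conjE) (rule that)
  show ?thesis
  proof (intro exI[of _ \<delta>0] conjI \<open>0 < \<delta>0\<close> allI impI)
    fix \<delta> and V0 :: "real ^ 'n \<Rightarrow> real"
    assume \<delta>: "0 < \<delta> \<and> \<delta> < \<delta>0"
      and V0: "V0 \<in> borel_measurable borel \<and> (\<forall>x. 0 \<le> V0 x \<and> V0 x \<le> \<delta> * frac_heat_kernel \<alpha> \<beta> g \<gamma> x)"
    then have V0_meas [measurable]: "V0 \<in> borel_measurable borel" by blast
    define W0 where "W0 r = V0 (line_vec r)" for r
    have W0_meas: "W0 \<in> borel_measurable borel" unfolding W0_def by measurable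
    have W0_le: "\<forall>r. 0 \<le> W0 r \<and> W0 r \<le> \<delta> * ?G \<gamma> r"
    proof
      fix r
      show "0 \<le> W0 r \<and> W0 r \<le> \<delta> * ?G \<gamma> r"
        using conjunct2[OF V0, THEN spec, of "line_vec r"] by (simp add: W0_def kernel nth)
    qed
    obtain W C where W_meas: "(\<lambda>(t, r). W t r) \<in> borel_measurable borel"
      and W_nn: "\<forall>t>0. \<forall>r. 0 \<le> W t r"
      and W_eq: "\<forall>t>0. \<forall>r. ennreal (W t r) = lin_term W0 t r + duhamel (\<lambda>s y. W s y powr (1 + \<eta>)) t r"
      and W_le: "\<forall>t>0. \<forall>r. W t r \<le> C * ?G (t + \<gamma>) r"
      and W_cont: "continuous_on ({0<..} \<times> UNIV) (\<lambda>(t, r). W t r)"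
      using sol[THEN spec, THEN mp, OF \<delta>, THEN spec, THEN mp, OF conjI[OF W0_meas W0_le]]
      by (elim exE conjE) (rule that)
    have [measurable]: "(\<lambda>(t, r). W t r) \<in> borel_measurable (borel \<Otimes>\<^sub>M borel)"
      using W_meas by (simp add: borel_prod)
    define V where "V t x = W t (x $ i)" for t and x :: "real ^ 'n"
    have [measurable]: "(\<lambda>x :: real ^ 'n. x $ i) \<in> borel_measurable borel"
      by (intro borel_measurable_continuous_onI continuous_intros)
    have lin: "lin_term W0 t (x $ i) = (\<integral>\<^sup>+ y. ennreal (frac_heat_kernel \<alpha> \<beta> g t (x - y) * V0 y) \<partial>lborel)"
      for t and x :: "real ^ 'n"
      unfolding kernel by (subst nn_integral_line_vec[OF UNIV_i]) (simp_all add: lin_term_def nth W0_def)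
    have duh: "duhamel (\<lambda>s y. W s y powr (1 + \<eta>)) t (x $ i) = (\<integral>\<^sup>+ y. (\<integral>\<^sup>+ s. indicator {0<..<t} s *
        ennreal (frac_heat_kernel \<alpha> \<beta> g (t - s) (x - y) * V s y powr (1 + \<eta>)) \<partial>lborel) \<partial>lborel)"
      for t and x :: "real ^ 'n"
      unfolding kernel V_def by (subst nn_integral_line_vec[OF UNIV_i]) (simp_all add: duhamel_def nth)
    have "continuous_on ({0<..} \<times> UNIV) (\<lambda>z. case (fst z, snd z $ i) of (t, r) \<Rightarrow> W t r)"
      by (rule continuous_on_compose2[OF W_cont]) (auto intro!: continuous_intros)
    then have "continuous_on ({0<..} \<times> UNIV) (\<lambda>(t, x). V t x)"
      by (simp add: V_def case_prod_beta')
    then show "\<exists>(V :: real \<Rightarrow> real ^ 'n \<Rightarrow> real) C.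
         (\<forall>t>0. \<forall>x. 0 \<le> V t x) \<and>
         (\<forall>t>0. \<forall>x. ennreal (V t x) =
             (\<integral>\<^sup>+ y. ennreal (frac_heat_kernel \<alpha> \<beta> g t (x - y) * V0 y) \<partial>lborel) +
             (\<integral>\<^sup>+ y. (\<integral>\<^sup>+ s. indicator {0<..<t} s *
                 ennreal (frac_heat_kernel \<alpha> \<beta> g (t - s) (x - y) * V s y powr (1 + \<eta>))
                 \<partial>lborel) \<partial>lborel)) \<and>
         (\<forall>t>0. \<forall>x. V t x \<le> C * frac_heat_kernel \<alpha> \<beta> g (t + \<gamma>) x) \<and>
         continuous_on ({0<..} \<times> UNIV) (\<lambda>(t, x). V t x)"
    proof (intro exI[of _ V] exI[of _ C] conjI allI impI)
      fix t :: real and x :: "real ^ 'n" assume t: "0 < t"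
      show "0 \<le> V t x" using W_nn t by (simp add: V_def)
      show "V t x \<le> C * frac_heat_kernel \<alpha> \<beta> g (t + \<gamma>) x" using W_le t by (simp add: V_def kernel)
      show "ennreal (V t x) =
          (\<integral>\<^sup>+ y. ennreal (frac_heat_kernel \<alpha> \<beta> g t (x - y) * V0 y) \<partial>lborel) +
          (\<integral>\<^sup>+ y. (\<integral>\<^sup>+ s. indicator {0<..<t} s *
              ennreal (frac_heat_kernel \<alpha> \<beta> g (t - s) (x - y) * V s y powr (1 + \<eta>))
              \<partial>lborel) \<partial>lborel)"
        unfolding lin[symmetric] duh[symmetric] V_def[of t] using W_eq t by blast
    qed
  qed
qed

end
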